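(* Let $(h,\nabla,\nabla^* )$ be a dually flat structure on a manifold $M$ of dimension $n$ and let $(g,J,\omega)$ be the Kähler structure on $TM$ associated to $(h,\nabla)$ via Dombrowski's construction. Let $f:TM\to\mathbb{R}$ be a smooth function and let $x:U\to\mathbb{R}^n$ be a coordinate system on $M$ that is affine with respect to $\nabla$, with associated complex coordinates $(z_1,\dots,z_n)=(x_1+i\dot x_1,\dots,x_n+i\dot x_n)$ on $\pi^{-1}(U)$. Then $f$ is Kähler on $\pi^{-1}(U)$ if and only if $$\frac{\partial^2f}{\partial z_i\partial z_j}=\sum_{b=1}^n\big((\Gamma^h)^b_{ij}\circ\pi\big)\frac{\partial f}{\partial z_b}\qquad\text{for all }i,j=1,\dots,n,$$ where $\frac{\partial}{\partial z_k}:=\frac12\big\{\frac{\partial}{\partial x_k}-i\frac{\partial}{\partial\dot x_k}\big\}$ and $(\Gamma^h)^b_{ij}$ are the Christoffel symbols of the Levi-Civita connection of $h$ in the coordinates $(x_1,\dots,x_n)$.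
   Context: Let $h$ be a Riemannian metric and $\nabla$ an affine connection on $M$. The dual connection $\nabla^*$ is the unique connection with $X(h(Y,Z))=h(\nabla_XY,Z)+h(Y,\nabla^*_XZ)$; $(h,\nabla,\nabla^* )$ is dually flat if both $\nabla$ and $\nabla^*$ have zero torsion and zero curvature. Coordinates are affine with respect to $\nabla$ if all Christoffel symbols of $\nabla$ vanish in them. $\pi:TM\to M$ is the projection and $(x_i,\dot x_i)$ are the coordinates on $\pi^{-1}(U)$ given by $x_i\circ\pi$ (still written $x_i$) and $\dot x_i=dx_i$. Dombrowski's construction: let $K:T(TM)\to TM$ be the connector of $\nabla$ (the unique map with $\nabla_XY=K\,Y_*X$). Identify $A\in T_{u}(TM)$, $u\in T_pM$, with $(u,v,w)=(u,\pi_*A,KA)$; then $g_u((u,v,w),(u,\bar v,\bar w))=h_p(v,\bar v)+h_p(w,\bar w)$, $J_u(u,v,w)=(u,-w,v)$, $\omega=g(J\cdot,\cdot)$. It is Kähler when the structure is dually flat. A smooth function $f$ on a Kähler manifold is Kähler if $\mathscr{L}_{X_f}g=0$, where $X_f$ is the Hamiltonian vector field ($\omega(X_f,\cdot)=df$). *)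

theory Defs
  imports "HOL-Analysis.Analysis"
begin

section \<open>Smooth functions between Euclidean spaces\<close>

text \<open>Meant for open \<open>S\<close>.\<close>

fun Ck_on :: "nat \<Rightarrow> 'e::real_normed_vector set \<Rightarrow> ('e \<Rightarrow> 'f::real_normed_vector) \<Rightarrow> bool" where
  "Ck_on 0 S f \<longleftrightarrow> continuous_on S f"
| "Ck_on (Suc k) S f \<longleftrightarrow> (\<forall>x\<in>S. f differentiable at x) \<and>
     (\<forall>v. Ck_on k S (\<lambda>x. frechet_derivative f (at x) v))"

definition smooth_on :: "'e::real_normed_vector set \<Rightarrow> ('e \<Rightarrow> 'f::real_normed_vector) \<Rightarrow> bool" where
  "smooth_on S f \<longleftrightarrow> (\<forall>k. Ck_on k S f)"


section \<open>Smooth manifolds\<close>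

text \<open>
  A chart is a pair of a domain and a coordinate map; the values of the coordinate map outside
  the domain are irrelevant. A manifold is given by its atlas, which determines both the
  set of points and the topology.
\<close>

type_synonym ('a, 'e) chart = "'a set \<times> ('a \<Rightarrow> 'e)"

abbreviation chart_dom :: "('a, 'e) chart \<Rightarrow> 'a set" where
  "chart_dom \<equiv> fst"

abbreviation chart_map :: "('a, 'e) chart \<Rightarrow> 'a \<Rightarrow> 'e" where
  "chart_map \<equiv> snd"

definition chart_inv :: "('a, 'e) chart \<Rightarrow> 'e \<Rightarrow> 'a" where
  "chart_inv c = inv_into (chart_dom c) (chart_map c)"

definition transition :: "('a, 'e) chart \<Rightarrow> ('a, 'e) chart \<Rightarrow> 'e \<Rightarrow> 'e" where
  "transition c d = chart_map d \<circ> chart_inv c"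

definition points :: "('a, 'e) chart set \<Rightarrow> 'a set" where
  "points A = (\<Union>c\<in>A. chart_dom c)"

definition charts_at :: "('a, 'e) chart set \<Rightarrow> 'a \<Rightarrow> ('a, 'e) chart set" where
  "charts_at A p = {c \<in> A. p \<in> chart_dom c}"

definition valid_chart :: "('a, 'e::euclidean_space) chart \<Rightarrow> bool" where
  "valid_chart c \<longleftrightarrow> inj_on (chart_map c) (chart_dom c) \<and> open (chart_map c ` chart_dom c)"

definition compatible :: "('a, 'e::euclidean_space) chart \<Rightarrow> ('a, 'e) chart \<Rightarrow> bool" where
  "compatible c d \<longleftrightarrow>
     open (chart_map c ` (chart_dom c \<inter> chart_dom d)) \<and>
     open (chart_map d ` (chart_dom c \<inter> chart_dom d)) \<and>
     smooth_on (chart_map c ` (chart_dom c \<inter> chart_dom d)) (transition c d) \<and>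
     smooth_on (chart_map d ` (chart_dom c \<inter> chart_dom d)) (transition d c)"

definition smooth_atlas :: "('a, 'e::euclidean_space) chart set \<Rightarrow> bool" where
  "smooth_atlas A \<longleftrightarrow> (\<forall>c\<in>A. valid_chart c) \<and> (\<forall>c\<in>A. \<forall>d\<in>A. compatible c d)"

definition manifold_open :: "('a, 'e::euclidean_space) chart set \<Rightarrow> 'a set \<Rightarrow> bool" where
  "manifold_open A W \<longleftrightarrow> W \<subseteq> points A \<and> (\<forall>c\<in>A. open (chart_map c ` (chart_dom c \<inter> W)))"

definition manifold_topology :: "('a, 'e::euclidean_space) chart set \<Rightarrow> 'a topology" where
  "manifold_topology A = topology (manifold_open A)"

lemma openin_manifold_topology:
  assumes "smooth_atlas A"
  shows "openin (manifold_topology A) = manifold_open A"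
proof -
  have "istopology (manifold_open A)"
    unfolding istopology_def
  proof (intro conjI allI impI)
    fix S T assume ST: "manifold_open A S" "manifold_open A T"
    have "open (chart_map c ` (chart_dom c \<inter> (S \<inter> T)))" if "c \<in> A" for c
    proof -
      have "inj_on (chart_map c) (chart_dom c)"
        using assms that by (auto simp: smooth_atlas_def valid_chart_def)
      then have "chart_map c ` (chart_dom c \<inter> (S \<inter> T)) =
          chart_map c ` (chart_dom c \<inter> S) \<inter> chart_map c ` (chart_dom c \<inter> T)"
        by (auto simp: inj_on_def)
      then show ?thesis
        using ST that by (auto simp: manifold_open_def intro: open_Int)
    qed
    with ST show "manifold_open A (S \<inter> T)"
      by (auto simp: manifold_open_def)
  next
    fix K assume K: "\<forall>S\<in>K. manifold_open A S"
    have "chart_map c ` (chart_dom c \<inter> \<Union>K) = (\<Union>S\<in>K. chart_map c ` (chart_dom c \<inter> S))" for c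
      by auto
    moreover have "open (\<Union>S\<in>K. chart_map c ` (chart_dom c \<inter> S))" if "c \<in> A" for c
      using K that by (intro open_UN ballI) (auto simp: manifold_open_def)
    ultimately have "open (chart_map c ` (chart_dom c \<inter> \<Union>K))" if "c \<in> A" for c
      using that by metis
    with K show "manifold_open A (\<Union>K)"
      unfolding manifold_open_def by blast
  qed
  then show ?thesis
    by (simp add: manifold_topology_def)
qed

text \<open>A smooth structure is a maximal atlas, so every admissible coordinate system is a member.\<close>

definition smooth_manifold :: "('a, 'e::euclidean_space) chart set \<Rightarrow> bool" where
  "smooth_manifold A \<longleftrightarrow>
     smooth_atlas A \<and>
     (\<forall>c. chart_dom c \<subseteq> points A \<and> valid_chart c \<and> (\<forall>d\<in>A. compatible c d) \<longrightarrow> c \<in> A) \<and>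
     Hausdorff_space (manifold_topology A) \<and>
     second_countable (manifold_topology A)"

definition smooth_fun_on :: "('a, 'e::euclidean_space) chart set \<Rightarrow> 'a set \<Rightarrow> ('a \<Rightarrow> real) \<Rightarrow> bool" where
  "smooth_fun_on A W f \<longleftrightarrow> (\<forall>c\<in>A. smooth_on (chart_map c ` (chart_dom c \<inter> W)) (f \<circ> chart_inv c))"


section \<open>Tangent vectors\<close>

text \<open>
  A tangent vector at \<open>p\<close> is the family of its coordinate vectors in the charts around \<open>p\<close>,
  subject to the usual transformation law; by convention the family is zero at charts not
  containing \<open>p\<close>. The base point is not part of a tangent vector, hence points of the
  tangent bundle are pairs.
\<close>

type_synonym ('a, 'e) tvec = "('a, 'e) chart \<Rightarrow> 'e"

type_synonym ('a, 'e) vfield = "'a \<Rightarrow> ('a, 'e) tvec"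

definition tangent_space :: "('a, 'e::euclidean_space) chart set \<Rightarrow> 'a \<Rightarrow> ('a, 'e) tvec set" where
  "tangent_space A p = {v.
     (\<forall>c\<in>charts_at A p. \<forall>d\<in>charts_at A p.
        v d = frechet_derivative (transition c d) (at (chart_map c p)) (v c)) \<and>
     (\<forall>c. c \<notin> charts_at A p \<longrightarrow> v c = 0)}"

definition tadd :: "('a, 'e::real_vector) tvec \<Rightarrow> ('a, 'e) tvec \<Rightarrow> ('a, 'e) tvec" where
  "tadd v w = (\<lambda>c. v c + w c)"

definition tscale :: "real \<Rightarrow> ('a, 'e::real_vector) tvec \<Rightarrow> ('a, 'e) tvec" where
  "tscale r v = (\<lambda>c. r *\<^sub>R v c)"

definition tminus :: "('a, 'e::real_vector) tvec \<Rightarrow> ('a, 'e) tvec" where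
  "tminus v = (\<lambda>c. - v c)"

definition tzero :: "('a, 'e::real_vector) tvec" where
  "tzero = (\<lambda>c. 0)"

definition some_chart_at :: "('a, 'e) chart set \<Rightarrow> 'a \<Rightarrow> ('a, 'e) chart" where
  "some_chart_at A p = (SOME c. c \<in> charts_at A p)"

text \<open>
  The derivative \<open>v f\<close> of a function and the differential of a map between manifolds; for
  smooth arguments neither depends on the choice of the chart around \<open>p\<close>.
\<close>

definition dir_deriv :: "('a, 'e::euclidean_space) chart set \<Rightarrow> ('a \<Rightarrow> real) \<Rightarrow> 'a \<Rightarrow> ('a, 'e) tvec \<Rightarrow> real" where
  "dir_deriv A f p v =
     (let c = some_chart_at A p in
        frechet_derivative (f \<circ> chart_inv c) (at (chart_map c p)) (v c))"

definition pushforward ::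
    "('a, 'e::euclidean_space) chart set \<Rightarrow> ('b, 'f::euclidean_space) chart set \<Rightarrow>
     ('a \<Rightarrow> 'b) \<Rightarrow> 'a \<Rightarrow> ('a, 'e) tvec \<Rightarrow> ('b, 'f) tvec" where
  "pushforward A B F p v =
     (let c = some_chart_at A p in
        (\<lambda>d. if d \<in> charts_at B (F p)
              then frechet_derivative (chart_map d \<circ> F \<circ> chart_inv c) (at (chart_map c p)) (v c)
              else 0))"

definition tangent_bundle :: "('a, 'e::euclidean_space) chart set \<Rightarrow> ('a \<times> ('a, 'e) tvec) set" where
  "tangent_bundle A = (SIGMA p:points A. tangent_space A p)"

definition bundle_restrict ::
    "('a, 'e::euclidean_space) chart set \<Rightarrow> 'a set \<Rightarrow> ('a \<times> ('a, 'e) tvec) set" where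
  "bundle_restrict A U = {u \<in> tangent_bundle A. fst u \<in> U}"

text \<open>The coordinates \<open>(x \<circ> \<pi>, dx)\<close> on \<open>\<pi>\<^sup>-\<^sup>1(U)\<close> induced by a chart \<open>(U, x)\<close>.\<close>

definition tangent_chart ::
    "('a, 'e::euclidean_space) chart set \<Rightarrow> ('a, 'e) chart \<Rightarrow>
     ('a \<times> ('a, 'e) tvec, 'e \<times> 'e) chart" where
  "tangent_chart A c = (bundle_restrict A (chart_dom c), \<lambda>(p, v). (chart_map c p, v c))"

definition tangent_atlas ::
    "('a, 'e::euclidean_space) chart set \<Rightarrow> ('a \<times> ('a, 'e) tvec, 'e \<times> 'e) chart set" where
  "tangent_atlas A = tangent_chart A ` A"


section \<open>Vector fields\<close>

text \<open>
  A vector field on an open set \<open>W\<close> is a total function of which only the values on \<open>W\<close> matter.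
\<close>

definition vector_field :: "('a, 'e::euclidean_space) chart set \<Rightarrow> 'a set \<Rightarrow> ('a, 'e) vfield \<Rightarrow> bool" where
  "vector_field A W X \<longleftrightarrow>
     (\<forall>p\<in>W. X p \<in> tangent_space A p) \<and>
     (\<forall>c\<in>A. smooth_on (chart_map c ` (chart_dom c \<inter> W)) (\<lambda>y. X (chart_inv c y) c))"

text \<open>In each chart, \<open>[X, Y]\<^sup>k = X(Y\<^sup>k) - Y(X\<^sup>k)\<close>.\<close>

definition lie_bracket ::
    "('a, 'e::euclidean_space) chart set \<Rightarrow> ('a, 'e) vfield \<Rightarrow> ('a, 'e) vfield \<Rightarrow> ('a, 'e) vfield" where
  "lie_bracket A X Y = (\<lambda>p c.
     if c \<in> charts_at A p then
       frechet_derivative (\<lambda>y. Y (chart_inv c y) c) (at (chart_map c p)) (X p c) -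
       frechet_derivative (\<lambda>y. X (chart_inv c y) c) (at (chart_map c p)) (Y p c)
     else 0)"

text \<open>The field on the domain of the chart \<open>c\<close> with constant coordinate vector \<open>e\<close>.\<close>

definition coord_field :: "('a, 'e::euclidean_space) chart set \<Rightarrow> ('a, 'e) chart \<Rightarrow> 'e \<Rightarrow> ('a, 'e) vfield" where
  "coord_field A c e = (\<lambda>p d.
     if d \<in> charts_at A p
     then frechet_derivative (transition c d) (at (chart_map c p)) e
     else 0)"


section \<open>Metrics and connections\<close>

type_synonym ('a, 'e) bilin_field = "'a \<Rightarrow> ('a, 'e) tvec \<Rightarrow> ('a, 'e) tvec \<Rightarrow> real"

definition riemannian_metric ::
    "('a, 'e::euclidean_space) chart set \<Rightarrow> ('a, 'e) bilin_field \<Rightarrow> bool" where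
  "riemannian_metric A h \<longleftrightarrow>
     (\<forall>p\<in>points A. \<forall>v\<in>tangent_space A p. \<forall>w\<in>tangent_space A p.
        h p v w = h p w v \<and>
        (\<forall>v'\<in>tangent_space A p. h p (tadd v v') w = h p v w + h p v' w) \<and>
        (\<forall>r. h p (tscale r v) w = r * h p v w) \<and>
        (v \<noteq> tzero \<longrightarrow> h p v v > 0)) \<and>
     (\<forall>W X Y. manifold_open A W \<and> vector_field A W X \<and> vector_field A W Y \<longrightarrow>
        smooth_fun_on A W (\<lambda>p. h p (X p) (Y p)))"

text \<open>
  Covariant derivatives are taken of vector fields on arbitrary open sets, so that they can be
  evaluated on coordinate fields. The last clause is compatibility with restriction: on an open
  set \<open>W\<close> the result depends only on the two fields on \<open>W\<close>. Every connection on
  globally defined vector fields extends uniquely to one in this sense. Real linearity in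
  \<open>Y\<close> is the Leibniz rule for constant functions.
\<close>

type_synonym ('a, 'e) covariant = "('a, 'e) vfield \<Rightarrow> ('a, 'e) vfield \<Rightarrow> ('a, 'e) vfield"

definition affine_connection ::
    "('a, 'e::euclidean_space) chart set \<Rightarrow> ('a, 'e) covariant \<Rightarrow> bool" where
  "affine_connection A N \<longleftrightarrow> (\<forall>W. manifold_open A W \<longrightarrow>
     (\<forall>X Y. vector_field A W X \<and> vector_field A W Y \<longrightarrow> vector_field A W (N X Y)) \<and>
     (\<forall>X X' Y. vector_field A W X \<and> vector_field A W X' \<and> vector_field A W Y \<longrightarrow>
        (\<forall>p\<in>W. N (\<lambda>q. tadd (X q) (X' q)) Y p = tadd (N X Y p) (N X' Y p))) \<and>
     (\<forall>f X Y. smooth_fun_on A W f \<and> vector_field A W X \<and> vector_field A W Y \<longrightarrow>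
        (\<forall>p\<in>W. N (\<lambda>q. tscale (f q) (X q)) Y p = tscale (f p) (N X Y p))) \<and>
     (\<forall>X Y Y'. vector_field A W X \<and> vector_field A W Y \<and> vector_field A W Y' \<longrightarrow>
        (\<forall>p\<in>W. N X (\<lambda>q. tadd (Y q) (Y' q)) p = tadd (N X Y p) (N X Y' p))) \<and>
     (\<forall>f X Y. smooth_fun_on A W f \<and> vector_field A W X \<and> vector_field A W Y \<longrightarrow>
        (\<forall>p\<in>W. N X (\<lambda>q. tscale (f q) (Y q)) p =
           tadd (tscale (dir_deriv A f p (X p)) (Y p)) (tscale (f p) (N X Y p)))) \<and>
     (\<forall>X X' Y Y'. vector_field A W X \<and> vector_field A W X' \<and>
        vector_field A W Y \<and> vector_field A W Y' \<and>
        (\<forall>p\<in>W. X p = X' p \<and> Y p = Y' p) \<longrightarrow> (\<forall>p\<in>W. N X Y p = N X' Y' p)))"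

definition torsion_free ::
    "('a, 'e::euclidean_space) chart set \<Rightarrow> ('a, 'e) covariant \<Rightarrow> bool" where
  "torsion_free A N \<longleftrightarrow>
     (\<forall>W X Y. manifold_open A W \<and> vector_field A W X \<and> vector_field A W Y \<longrightarrow>
        (\<forall>p\<in>W. tadd (tadd (N X Y p) (tminus (N Y X p))) (tminus (lie_bracket A X Y p)) = tzero))"

definition curvature_free ::
    "('a, 'e::euclidean_space) chart set \<Rightarrow> ('a, 'e) covariant \<Rightarrow> bool" where
  "curvature_free A N \<longleftrightarrow>
     (\<forall>W X Y Z. manifold_open A W \<and>
        vector_field A W X \<and> vector_field A W Y \<and> vector_field A W Z \<longrightarrow>
        (\<forall>p\<in>W. tadd (tadd (N X (N Y Z) p) (tminus (N Y (N X Z) p)))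
                     (tminus (N (lie_bracket A X Y) Z p)) = tzero))"

definition dual_condition ::
    "('a, 'e::euclidean_space) chart set \<Rightarrow> ('a, 'e) bilin_field \<Rightarrow>
     ('a, 'e) covariant \<Rightarrow> ('a, 'e) covariant \<Rightarrow> bool" where
  "dual_condition A h N N' \<longleftrightarrow>
     (\<forall>W X Y Z. manifold_open A W \<and>
        vector_field A W X \<and> vector_field A W Y \<and> vector_field A W Z \<longrightarrow>
        (\<forall>p\<in>W. dir_deriv A (\<lambda>q. h q (Y q) (Z q)) p (X p) =
           h p (N X Y p) (Z p) + h p (Y p) (N' X Z p)))"

definition dually_flat ::
    "('a, 'e::euclidean_space) chart set \<Rightarrow> ('a, 'e) bilin_field \<Rightarrow>
     ('a, 'e) covariant \<Rightarrow> ('a, 'e) covariant \<Rightarrow> bool" where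
  "dually_flat A h N N' \<longleftrightarrow>
     riemannian_metric A h \<and> affine_connection A N \<and> affine_connection A N' \<and>
     dual_condition A h N N' \<and>
     torsion_free A N \<and> torsion_free A N' \<and> curvature_free A N \<and> curvature_free A N'"

text \<open>Metric compatibility of a connection says that it is its own dual.\<close>

definition is_levi_civita ::
    "('a, 'e::euclidean_space) chart set \<Rightarrow> ('a, 'e) bilin_field \<Rightarrow> ('a, 'e) covariant \<Rightarrow> bool" where
  "is_levi_civita A h D \<longleftrightarrow> affine_connection A D \<and> torsion_free A D \<and> dual_condition A h D D"

text \<open>
  The choice operator is used because uniqueness holds only up to the irrelevant values outside
  the open set on which the argument fields are defined.
\<close>

definition levi_civita ::
    "('a, 'e::euclidean_space) chart set \<Rightarrow> ('a, 'e) bilin_field \<Rightarrow> ('a, 'e) covariant" where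
  "levi_civita A h = (SOME D. is_levi_civita A h D)"

text \<open>\<open>christoffel A N c i j b\<close> is \<open>\<Gamma>\<^sup>b\<^sub>i\<^sub>j\<close>, the \<open>b\<close>-th component of \<open>N \<partial>\<^sub>i \<partial>\<^sub>j\<close>.\<close>

definition christoffel ::
    "('a, real^'n::finite) chart set \<Rightarrow> ('a, real^'n) covariant \<Rightarrow> ('a, real^'n) chart \<Rightarrow>
     'n \<Rightarrow> 'n \<Rightarrow> 'n \<Rightarrow> 'a \<Rightarrow> real" where
  "christoffel A N c i j b p =
     N (coord_field A c (axis i 1)) (coord_field A c (axis j 1)) p c $ b"

definition affine_coordinates ::
    "('a, real^'n::finite) chart set \<Rightarrow> ('a, real^'n) covariant \<Rightarrow> ('a, real^'n) chart \<Rightarrow> bool" where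
  "affine_coordinates A N c \<longleftrightarrow>
     (\<forall>p\<in>chart_dom c. \<forall>i j b. christoffel A N c i j b p = 0)"


section \<open>Dombrowski's construction\<close>

text \<open>
  The connector is fibrewise linear; the equation with \<open>Y\<^sub>*X\<close> alone says nothing about
  vertical vectors, and linearity is what makes it unique on the tangent spaces of the tangent
  bundle.
\<close>

type_synonym ('a, 'e) ttvec = "('a \<times> ('a, 'e) tvec, 'e \<times> 'e) tvec"

type_synonym ('a, 'e) connector = "'a \<times> ('a, 'e) tvec \<Rightarrow> ('a, 'e) ttvec \<Rightarrow> ('a, 'e) tvec"

definition is_connector ::
    "('a, 'e::euclidean_space) chart set \<Rightarrow> ('a, 'e) covariant \<Rightarrow> ('a, 'e) connector \<Rightarrow> bool" where
  "is_connector A N K \<longleftrightarrow>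
     (\<forall>u\<in>tangent_bundle A. \<forall>\<xi>\<in>tangent_space (tangent_atlas A) u.
        K u \<xi> \<in> tangent_space A (fst u) \<and>
        (\<forall>\<eta>\<in>tangent_space (tangent_atlas A) u. K u (tadd \<xi> \<eta>) = tadd (K u \<xi>) (K u \<eta>)) \<and>
        (\<forall>r. K u (tscale r \<xi>) = tscale r (K u \<xi>))) \<and>
     (\<forall>W X Y. manifold_open A W \<and> vector_field A W X \<and> vector_field A W Y \<longrightarrow>
        (\<forall>p\<in>W. N X Y p =
           K (p, Y p) (pushforward A (tangent_atlas A) (\<lambda>q. (q, Y q)) p (X p))))"

definition connector ::
    "('a, 'e::euclidean_space) chart set \<Rightarrow> ('a, 'e) covariant \<Rightarrow> ('a, 'e) connector" where
  "connector A N = (SOME K. is_connector A N K)"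

definition proj_push ::
    "('a, 'e::euclidean_space) chart set \<Rightarrow> 'a \<times> ('a, 'e) tvec \<Rightarrow> ('a, 'e) ttvec \<Rightarrow> ('a, 'e) tvec" where
  "proj_push A = pushforward (tangent_atlas A) A fst"

definition dombrowski_metric ::
    "('a, 'e::euclidean_space) chart set \<Rightarrow> ('a, 'e) bilin_field \<Rightarrow> ('a, 'e) covariant \<Rightarrow>
     ('a \<times> ('a, 'e) tvec, 'e \<times> 'e) bilin_field" where
  "dombrowski_metric A h N u \<xi> \<eta> =
     h (fst u) (proj_push A u \<xi>) (proj_push A u \<eta>) +
     h (fst u) (connector A N u \<xi>) (connector A N u \<eta>)"

text \<open>\<open>J (u, v, w) = (u, -w, v)\<close> where \<open>v\<close> and \<open>w\<close> are the images under \<open>\<pi>\<^sub>*\<close> and \<open>K\<close>.\<close>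

definition dombrowski_J ::
    "('a, 'e::euclidean_space) chart set \<Rightarrow> ('a, 'e) covariant \<Rightarrow>
     'a \<times> ('a, 'e) tvec \<Rightarrow> ('a, 'e) ttvec \<Rightarrow> ('a, 'e) ttvec" where
  "dombrowski_J A N u \<xi> =
     (THE \<eta>. \<eta> \<in> tangent_space (tangent_atlas A) u \<and>
        proj_push A u \<eta> = tminus (connector A N u \<xi>) \<and>
        connector A N u \<eta> = proj_push A u \<xi>)"

definition dombrowski_form ::
    "('a, 'e::euclidean_space) chart set \<Rightarrow> ('a, 'e) bilin_field \<Rightarrow> ('a, 'e) covariant \<Rightarrow>
     ('a \<times> ('a, 'e) tvec, 'e \<times> 'e) bilin_field" where
  "dombrowski_form A h N u \<xi> \<eta> = dombrowski_metric A h N u (dombrowski_J A N u \<xi>) \<eta>"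


section \<open>Kaehler functions\<close>

definition hamiltonian_field ::
    "('b, 'f::euclidean_space) chart set \<Rightarrow> ('b, 'f) bilin_field \<Rightarrow> ('b \<Rightarrow> real) \<Rightarrow> ('b, 'f) vfield" where
  "hamiltonian_field B \<omega> f u =
     (THE \<xi>. \<xi> \<in> tangent_space B u \<and> (\<forall>\<eta>\<in>tangent_space B u. \<omega> u \<xi> \<eta> = dir_deriv B f u \<eta>))"

definition lie_deriv_metric ::
    "('b, 'f::euclidean_space) chart set \<Rightarrow> ('b, 'f) bilin_field \<Rightarrow> ('b, 'f) vfield \<Rightarrow>
     ('b, 'f) vfield \<Rightarrow> ('b, 'f) vfield \<Rightarrow> 'b \<Rightarrow> real" where
  "lie_deriv_metric B g X Y Z u =
     dir_deriv B (\<lambda>q. g q (Y q) (Z q)) u (X u)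
     - g u (lie_bracket B X Y u) (Z u) - g u (Y u) (lie_bracket B X Z u)"

definition kaehler_function_on ::
    "('b, 'f::euclidean_space) chart set \<Rightarrow> ('b, 'f) bilin_field \<Rightarrow> ('b, 'f) bilin_field \<Rightarrow>
     'b set \<Rightarrow> ('b \<Rightarrow> real) \<Rightarrow> bool" where
  "kaehler_function_on B g \<omega> W f \<longleftrightarrow>
     smooth_fun_on B W f \<and>
     (\<forall>Y Z. vector_field B W Y \<and> vector_field B W Z \<longrightarrow>
        (\<forall>u\<in>W. lie_deriv_metric B g (hamiltonian_field B \<omega> f) Y Z u = 0))"


section \<open>Complex coordinates on the tangent bundle\<close>

definition partial_along ::
    "('b, 'f::euclidean_space) chart \<Rightarrow> 'f \<Rightarrow> ('b \<Rightarrow> complex) \<Rightarrow> 'b \<Rightarrow> complex" where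
  "partial_along c e F u = frechet_derivative (F \<circ> chart_inv c) (at (chart_map c u)) e"

text \<open>
  The operator \<open>\<partial>/\<partial>z\<^sub>k = (\<partial>/\<partial>x\<^sub>k - \<i> \<partial>/\<partial>y\<^sub>k) / 2\<close>, where \<open>(x, y)\<close> are the coordinates
  \<open>tangent_chart A c\<close>.
\<close>

definition partial_z ::
    "('a, real^'n::finite) chart set \<Rightarrow> ('a, real^'n) chart \<Rightarrow> 'n \<Rightarrow>
     ('a \<times> ('a, real^'n) tvec \<Rightarrow> complex) \<Rightarrow> 'a \<times> ('a, real^'n) tvec \<Rightarrow> complex" where
  "partial_z A c k F u =
     (1/2) * (partial_along (tangent_chart A c) (axis k 1, 0) F u
              - \<i> * partial_along (tangent_chart A c) (0, axis k 1) F u)"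

end

(*
  In coordinates (x, y) on TM induced by a nabla-affine chart, the connector is the second component of
  a tangent vector of TM, so g = h_ij(x) (dx_i dx_j + dy_i dy_j) and J is multiplication by i. Flatness
  of both connections makes the derivative d_k h_ij totally symmetric, and half of it is the Christoffel
  symbol of h with lowered index. Lowering indices, the Hamiltonian field X_f = (a, b) has a = d_y f and
  b = - d_x f. Differentiating these relations turns the Lie derivative of g along X_f into

    (L_X g)(Y, Z) = P(Y1, Z1) - P(Y2, Z2) + Q(Y2, Z1) + Q(Z2, Y1),
    P_ij = f_{x_i y_j} + f_{x_j y_i} - a^k d_k h_ij,   Q_ij = f_{y_i y_j} - f_{x_i x_j} - b^k d_k h_ij,

  and P_ij = Q_ij = 0 are the imaginary and real parts of the complex equation.
  The Levi-Civita connection, which enters through a choice operator, exists because it is the mean of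
  nabla and its dual.
*)
theory Submission
  imports Defs
begin

text \<open>Connector, complex structure, Hamiltonian field and Levi-Civita connection are given by
  choice or definite description, so each needs existence, and uniqueness in a form that yields its
  coordinates, before any computation can start. The Hamiltonian field poses a second obstacle: its
  pointwise description does not say that it depends differentiably on the point, while the bracket
  in the Lie derivative differentiates it. Cramer's rule supplies one derivative, which is enough,
  and the lemmas on brackets are therefore stated for differentiable fields. The symmetry of d_k
  h_ij arises as follows. Where the symbols of nabla vanish, duality reads d_k h_ab = h(a, Gamma'_k
  b) with Gamma' the symbols of the dual connection, and these are symmetric because it has no
  torsion. This symmetry merges the three metric derivatives in the base block of L_X g into one,
  makes all blocks share the same P and Q, and reduces the Koszul formula to a single term.\<close>

section \<open>Calculus of smooth functions\<close>

abbreviation fd :: "('e::real_normed_vector \<Rightarrow> 'f::real_normed_vector) \<Rightarrow> 'e \<Rightarrow> 'e \<Rightarrow> 'f" where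
  "fd f x \<equiv> frechet_derivative f (at x)"

lemma fd_eqI: "(f has_derivative f') (at x) \<Longrightarrow> fd f x = f'"
  using frechet_derivative_at by metis

lemma has_derivative_fd: "f differentiable at x \<Longrightarrow> (f has_derivative fd f x) (at x)"
  using frechet_derivative_works by blast

lemma fd_add: "f differentiable at x \<Longrightarrow> fd f x (u + v) = fd f x u + fd f x v"
  and fd_scaleR: "f differentiable at x \<Longrightarrow> fd f x (r *\<^sub>R v) = r *\<^sub>R fd f x v"
  and fd_minus: "f differentiable at x \<Longrightarrow> fd f x (- v) = - fd f x v"
  by (simp_all add: linear_frechet_derivative linear_add linear_scale linear_neg)

text \<open>\<open>frechet_derivative\<close> is a choice from the set of all derivatives at the
  point, and functions that agree near the point have the same set. Hence no differentiability is
  assumed: the default values coincide too.\<close>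

lemma fd_cong_open:
  assumes "open S" "x \<in> S" "\<And>y. y \<in> S \<Longrightarrow> f y = g y"
  shows "fd f x = fd g x"
proof -
  have "(f has_derivative f') (at x) = (g has_derivative f') (at x)" for f'
    using has_derivative_transform_within_open[OF _ assms(1,2)] assms(3) by metis
  then show ?thesis
    by (simp add: frechet_derivative_def)
qed

lemma differentiable_cong_open:
  assumes "open S" "x \<in> S" "\<And>y. y \<in> S \<Longrightarrow> f y = g y" "f differentiable at x"
  shows "g differentiable at x"
  using assms has_derivative_transform_within_open unfolding differentiable_def by metis

lemma has_derivative_bilinear:
  assumes "bounded_bilinear B" "f differentiable at x" "g differentiable at x"
  shows "((\<lambda>y. B (f y) (g y)) has_derivative (\<lambda>v. B (f x) (fd g x v) + B (fd f x v) (g x))) (at x)"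
  using bounded_bilinear.FDERIV[OF assms(1) has_derivative_fd[OF assms(2)] has_derivative_fd[OF assms(3)]] .

section \<open>Closure properties of C^k and smooth maps\<close>

lemma Ck_on_mono: "Ck_on k T f \<Longrightarrow> S \<subseteq> T \<Longrightarrow> Ck_on k S f"
  by (induction k arbitrary: f) (auto intro: continuous_on_subset)

lemma Ck_on_cong:
  assumes "open S" "\<And>x. x \<in> S \<Longrightarrow> f x = g x" "Ck_on k S f"
  shows "Ck_on k S g"
  using assms(2,3)
proof (induction k arbitrary: f g)
  case 0
  then show ?case by (auto cong: continuous_on_cong)
next
  case (Suc k)
  have "Ck_on k S (\<lambda>x. fd g x v)" for v
    using Suc.IH[of "\<lambda>x. fd f x v" "\<lambda>x. fd g x v"] fd_cong_open[OF assms(1), of _ f g] Suc.prems by auto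
  moreover have "g differentiable at x" if "x \<in> S" for x
    using Suc.prems that by (intro differentiable_cong_open[OF assms(1) that, of f g]) auto
  ultimately show ?case by simp
qed

text \<open>The product and chain rules pair a differentiated factor with an undifferentiated one,
  so their inductions need the latter at the lower order as well. The step into order 0 is
  continuity of a differentiable function.\<close>

lemma Ck_on_SucD: "Ck_on (Suc k) S f \<Longrightarrow> Ck_on k S f"
proof (induction k arbitrary: f)
  case 0
  then show ?case
    by (auto simp: continuous_at_imp_continuous_on differentiable_imp_continuous_within)
next
  case (Suc k)
  then show ?case by (metis Ck_on.simps(2))
qed

lemma Ck_on_const: "Ck_on k S (\<lambda>x. c)"
  by (induction k arbitrary: c) auto

lemma Ck_on_linear_comp:
  assumes "bounded_linear L" "open S" "Ck_on k S f"
  shows "Ck_on k S (\<lambda>x. L (f x))"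
  using assms(3)
proof (induction k arbitrary: f)
  case 0
  then show ?case using bounded_linear.continuous_on[OF assms(1)] by auto
next
  case (Suc k)
  have D: "((\<lambda>x. L (f x)) has_derivative (\<lambda>v. L (fd f x v))) (at x)" if "x \<in> S" for x
    using Suc.prems that by (auto intro!: bounded_linear.has_derivative[OF assms(1)] has_derivative_fd)
  have "Ck_on k S (\<lambda>x. fd (\<lambda>x. L (f x)) x v)" for v
    using Suc.IH[of "\<lambda>x. fd f x v"] Suc.prems fd_eqI[OF D]
    by (auto intro!: Ck_on_cong[OF assms(2), of "\<lambda>x. L (fd f x v)"])
  then show ?case using D by (auto simp: differentiable_def)
qed

lemma Ck_on_id: "open S \<Longrightarrow> Ck_on k S (\<lambda>x. x)"
  by (cases k) (auto simp: Ck_on_const)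

lemma Ck_on_linear: "bounded_linear L \<Longrightarrow> open S \<Longrightarrow> Ck_on k S L"
  using Ck_on_linear_comp[of L S k "\<lambda>x. x"] Ck_on_id by auto

lemma Ck_on_add:
  assumes "open S" "Ck_on k S f" "Ck_on k S g"
  shows "Ck_on k S (\<lambda>x. f x + g x)"
  using assms(2,3)
proof (induction k arbitrary: f g)
  case 0
  then show ?case by (auto intro: continuous_on_add)
next
  case (Suc k)
  have D: "((\<lambda>x. f x + g x) has_derivative (\<lambda>v. fd f x v + fd g x v)) (at x)" if "x \<in> S" for x
    using Suc.prems that by (auto intro!: has_derivative_add has_derivative_fd)
  have "Ck_on k S (\<lambda>x. fd (\<lambda>x. f x + g x) x v)" for v
    using Suc.IH[of "\<lambda>x. fd f x v" "\<lambda>x. fd g x v"] Suc.prems fd_eqI[OF D]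
    by (auto intro!: Ck_on_cong[OF assms(1), of "\<lambda>x. fd f x v + fd g x v"])
  then show ?case using D by (auto simp: differentiable_def)
qed

lemma Ck_on_sum:
  assumes "open S" "\<And>i. i \<in> I \<Longrightarrow> Ck_on k S (f i)"
  shows "Ck_on k S (\<lambda>x. \<Sum>i\<in>I. f i x)"
  using assms(2) by (induction I rule: infinite_finite_induct)
    (auto simp: Ck_on_const intro!: Ck_on_add[OF assms(1)])

lemma Ck_on_bilinear:
  assumes "bounded_bilinear B" "open S" "Ck_on k S f" "Ck_on k S g"
  shows "Ck_on k S (\<lambda>x. B (f x) (g x))"
  using assms(3,4)
proof (induction k arbitrary: f g)
  case 0
  then show ?case by (auto intro: bounded_bilinear.continuous_on[OF assms(1)])
next
  case (Suc k)
  have D: "((\<lambda>x. B (f x) (g x)) has_derivative (\<lambda>v. B (f x) (fd g x v) + B (fd f x v) (g x))) (at x)"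
    if "x \<in> S" for x
    using Suc.prems that by (auto intro!: has_derivative_bilinear[OF assms(1)])
  have "Ck_on k S (\<lambda>x. fd (\<lambda>x. B (f x) (g x)) x v)" for v
  proof (rule Ck_on_cong[OF assms(2)])
    show "Ck_on k S (\<lambda>x. B (f x) (fd g x v) + B (fd f x v) (g x))"
      using Suc.prems Ck_on_SucD[OF Suc.prems(1)] Ck_on_SucD[OF Suc.prems(2)]
      by (intro Ck_on_add[OF assms(2)] Suc.IH) simp_all
  qed (simp add: fd_eqI[OF D])
  then show ?case using D by (auto simp: differentiable_def)
qed

lemma fd_Basis_expansion:
  fixes v :: "'e::euclidean_space"
  assumes "f differentiable at x"
  shows "fd f x v = (\<Sum>b\<in>Basis. (v \<bullet> b) *\<^sub>R fd f x b)"
proof -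
  have lin: "linear (fd f x)" using assms by (rule linear_frechet_derivative)
  have "fd f x (\<Sum>b\<in>Basis. (v \<bullet> b) *\<^sub>R b) = (\<Sum>b\<in>Basis. (v \<bullet> b) *\<^sub>R fd f x b)"
    by (simp only: linear_sum[OF lin] linear_scale[OF lin])
  then show ?thesis by (simp only: euclidean_representation)
qed

lemma has_derivative_comp_fd:
  assumes "f differentiable at x" "g differentiable at (f x)"
  shows "((\<lambda>x. g (f x)) has_derivative (\<lambda>v. fd g (f x) (fd f x v))) (at x)"
  using has_derivative_compose[OF has_derivative_fd[OF assms(1)] has_derivative_fd[OF assms(2)]] .

lemma fd_comp:
  assumes "f differentiable at x" "g differentiable at (f x)"
  shows "fd (\<lambda>x. g (f x)) x v = fd g (f x) (fd f x v)"
  using fd_eqI[OF has_derivative_comp_fd[OF assms]] by simp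

text \<open>The chain rule evaluates \<open>fd g\<close> in the direction \<open>fd f x v\<close>,
  which moves with \<open>x\<close>, whereas \<open>Ck_on\<close> controls only fixed directions.
  Expanding the direction in \<open>Basis\<close> gives a sum of products to which the induction
  hypothesis applies; this is why the intermediate space is Euclidean.\<close>

lemma Ck_on_comp:
  fixes f :: "'d::real_normed_vector \<Rightarrow> 'e::euclidean_space"
  assumes "open S" "f ` S \<subseteq> T" "Ck_on k S f" "Ck_on k T g"
  shows "Ck_on k S (\<lambda>x. g (f x))"
  using assms(3,4)
proof (induction k arbitrary: g)
  case 0
  then show ?case using assms(2) by (auto intro: continuous_on_compose2)
next
  case (Suc k)
  have diff: "f differentiable at x" "g differentiable at (f x)" if "x \<in> S" for x
    using Suc.prems assms(2) that by auto
  have "Ck_on k S (\<lambda>x. fd (\<lambda>x. g (f x)) x v)" for v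
  proof (rule Ck_on_cong[OF assms(1)])
    show "Ck_on k S (\<lambda>x. \<Sum>b\<in>Basis. (fd f x v \<bullet> b) *\<^sub>R fd g (f x) b)"
    proof (intro Ck_on_sum[OF assms(1)] Ck_on_bilinear[OF bounded_bilinear_scaleR assms(1)])
      fix b :: 'e
      show "Ck_on k S (\<lambda>x. fd f x v \<bullet> b)"
        using Suc.prems by (intro Ck_on_linear_comp[OF bounded_linear_inner_left assms(1)]) auto
      show "Ck_on k S (\<lambda>x. fd g (f x) b)"
        using Suc.prems Suc.IH[of "\<lambda>y. fd g y b"] Ck_on_SucD[of k S f] by auto
    qed
    show "(\<Sum>b\<in>Basis. (fd f x v \<bullet> b) *\<^sub>R fd g (f x) b) = fd (\<lambda>x. g (f x)) x v" if "x \<in> S" for x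
      using fd_comp[OF diff[OF that]] fd_Basis_expansion[OF diff(2)[OF that], of "fd f x v"] by simp
  qed
  then show ?case
    using has_derivative_comp_fd[OF diff] by (auto simp: differentiable_def)
qed

lemma smooth_on_mono: "smooth_on T f \<Longrightarrow> S \<subseteq> T \<Longrightarrow> smooth_on S f"
  unfolding smooth_on_def using Ck_on_mono by blast

lemma smooth_on_cong: "open S \<Longrightarrow> (\<And>x. x \<in> S \<Longrightarrow> f x = g x) \<Longrightarrow> smooth_on S f \<Longrightarrow> smooth_on S g"
  unfolding smooth_on_def using Ck_on_cong by blast

lemma smooth_on_const: "smooth_on S (\<lambda>x. c)"
  by (simp add: smooth_on_def Ck_on_const)

lemma smooth_on_linear: "bounded_linear L \<Longrightarrow> open S \<Longrightarrow> smooth_on S L"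
  by (simp add: smooth_on_def Ck_on_linear)

lemma smooth_on_linear_comp:
  "bounded_linear L \<Longrightarrow> open S \<Longrightarrow> smooth_on S f \<Longrightarrow> smooth_on S (\<lambda>x. L (f x))"
  by (simp add: smooth_on_def Ck_on_linear_comp)

lemma smooth_on_add:
  "open S \<Longrightarrow> smooth_on S f \<Longrightarrow> smooth_on S g \<Longrightarrow> smooth_on S (\<lambda>x. f x + g x)"
  by (simp add: smooth_on_def Ck_on_add)

lemma smooth_on_sum:
  "open S \<Longrightarrow> (\<And>i. i \<in> I \<Longrightarrow> smooth_on S (f i)) \<Longrightarrow> smooth_on S (\<lambda>x. \<Sum>i\<in>I. f i x)"
  by (simp add: smooth_on_def Ck_on_sum)

lemma smooth_on_bilinear:
  "bounded_bilinear B \<Longrightarrow> open S \<Longrightarrow> smooth_on S f \<Longrightarrow> smooth_on S g \<Longrightarrow>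
     smooth_on S (\<lambda>x. B (f x) (g x))"
  by (simp add: smooth_on_def Ck_on_bilinear)

lemma smooth_on_comp:
  fixes f :: "'d::real_normed_vector \<Rightarrow> 'e::euclidean_space"
  assumes "open S" "smooth_on S f" "smooth_on T g" "f ` S \<subseteq> T"
  shows "smooth_on S (\<lambda>x. g (f x))"
  using assms unfolding smooth_on_def by (blast intro: Ck_on_comp)

lemma smooth_on_Pair:
  assumes "open S" "smooth_on S f" "smooth_on S g"
  shows "smooth_on S (\<lambda>x. (f x, g x))"
proof -
  have L: "bounded_linear (\<lambda>a. (a, 0))" "bounded_linear (\<lambda>b. (0, b))"
    by (auto intro!: bounded_linear_Pair bounded_linear_ident bounded_linear_zero)
  have "smooth_on S (\<lambda>x. (f x, 0) + (0, g x))"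
    by (rule smooth_on_add[OF assms(1) smooth_on_linear_comp[OF L(1) assms(1,2)]
          smooth_on_linear_comp[OF L(2) assms(1,3)]])
  then show ?thesis by simp
qed

lemma smooth_on_differentiable: "smooth_on S f \<Longrightarrow> x \<in> S \<Longrightarrow> f differentiable at x"
  unfolding smooth_on_def by (metis Ck_on.simps(2))

lemma smooth_on_fd: "smooth_on S f \<Longrightarrow> smooth_on S (\<lambda>x. fd f x v)"
  unfolding smooth_on_def by (metis Ck_on.simps(2))

lemma smooth_on_continuous: "smooth_on S f \<Longrightarrow> continuous_on S f"
  unfolding smooth_on_def by (metis Ck_on.simps(1))

text \<open>Point and direction both vary here, as they do in the fibre part of the transition maps
  of the tangent bundle and in the components of a vector field in a new chart.\<close>

lemma smooth_on_fd_apply: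
  fixes g :: "'d::real_normed_vector \<Rightarrow> 'e::euclidean_space"
  assumes "open S" "smooth_on T f" "smooth_on S k" "k ` S \<subseteq> T" "smooth_on S g"
  shows "smooth_on S (\<lambda>x. fd f (k x) (g x))"
proof (rule smooth_on_cong[OF assms(1)])
  show "smooth_on S (\<lambda>x. \<Sum>b\<in>Basis. (g x \<bullet> b) *\<^sub>R fd f (k x) b)"
    by (intro smooth_on_sum[OF assms(1)] smooth_on_bilinear[OF bounded_bilinear_scaleR assms(1)]
      smooth_on_linear_comp[OF bounded_linear_inner_left assms(1)] assms(5)
      smooth_on_comp[OF assms(1,3) smooth_on_fd[OF assms(2)] assms(4)])
  show "(\<Sum>b\<in>Basis. (g x \<bullet> b) *\<^sub>R fd f (k x) b) = fd f (k x) (g x)" if "x \<in> S" for x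
    using smooth_on_differentiable[OF assms(2)] assms(4) that fd_Basis_expansion[of f "k x" "g x"] by auto
qed

section \<open>Symmetry of second derivatives\<close>

lemma has_real_derivative_along:
  fixes f :: "'e::real_normed_vector \<Rightarrow> real"
  assumes "f differentiable at (y + s *\<^sub>R u)"
  shows "((\<lambda>s. f (y + s *\<^sub>R u)) has_real_derivative fd f (y + s *\<^sub>R u) u) (at s)"
proof -
  have "((\<lambda>s. f (y + s *\<^sub>R u)) has_derivative (\<lambda>r. fd f (y + s *\<^sub>R u) (r *\<^sub>R u))) (at s)"
    by (rule has_derivative_compose[where g = f and f = "\<lambda>s. y + s *\<^sub>R u" and g' = "fd f (y + s *\<^sub>R u)"])
      (auto intro!: derivative_eq_intros has_derivative_fd assms)
  then show ?thesis
    by (simp add: has_field_derivative_def fd_scaleR[OF assms] mult.commute[of _ "fd f _ _"])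
qed

text \<open>The mean value theorem is applied along \<open>u\<close> to the difference of
  \<open>f\<close> on two opposite sides of a parallelogram, and then along \<open>v\<close> to
  \<open>fd f _ u\<close>. The second difference is symmetric in \<open>u\<close> and
  \<open>v\<close>, which is what makes the mixed derivatives comparable.\<close>

lemma second_difference_mean_value:
  fixes f :: "'e::real_normed_vector \<Rightarrow> real"
  assumes "t > 0" "\<And>s r. 0 \<le> s \<Longrightarrow> s \<le> t \<Longrightarrow> 0 \<le> r \<Longrightarrow> r \<le> t \<Longrightarrow> x + s *\<^sub>R u + r *\<^sub>R v \<in> S"
    and f: "\<And>y. y \<in> S \<Longrightarrow> f differentiable at y"
    and f': "\<And>y. y \<in> S \<Longrightarrow> (\<lambda>y. fd f y u) differentiable at y"
  shows "\<exists>s r. 0 \<le> s \<and> s \<le> t \<and> 0 \<le> r \<and> r \<le> t \<and>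
    f (x + t *\<^sub>R u + t *\<^sub>R v) - f (x + t *\<^sub>R u) - f (x + t *\<^sub>R v) + f x =
      t * (t * fd (\<lambda>y. fd f y u) (x + s *\<^sub>R u + r *\<^sub>R v) v)"
proof -
  define g where "g s = f ((x + t *\<^sub>R v) + s *\<^sub>R u) - f (x + s *\<^sub>R u)" for s
  define g' where "g' s = fd f ((x + t *\<^sub>R v) + s *\<^sub>R u) u - fd f (x + s *\<^sub>R u) u" for s
  have "(g has_real_derivative g' s) (at s)" if "0 \<le> s" "s \<le> t" for s
    unfolding g_def g'_def
    using assms(2)[OF that, of t] assms(2)[OF that, of 0] \<open>t > 0\<close>
    by (intro DERIV_diff has_real_derivative_along f) (auto simp: algebra_simps)
  then obtain s where s: "0 < s" "s < t" "g t - g 0 = t * g' s"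
    using MVT2[OF \<open>t > 0\<close>, of g g'] by auto
  have "((\<lambda>r. fd f ((x + s *\<^sub>R u) + r *\<^sub>R v) u) has_real_derivative
      fd (\<lambda>y. fd f y u) ((x + s *\<^sub>R u) + r *\<^sub>R v) v) (at r)" if "0 \<le> r" "r \<le> t" for r
    using assms(2)[of s r] s that by (intro has_real_derivative_along f') auto
  then obtain r where r: "0 < r" "r < t"
    "fd f ((x + s *\<^sub>R u) + t *\<^sub>R v) u - fd f ((x + s *\<^sub>R u) + 0 *\<^sub>R v) u =
      t * fd (\<lambda>y. fd f y u) ((x + s *\<^sub>R u) + r *\<^sub>R v) v"
    using MVT2[OF \<open>t > 0\<close>, of "\<lambda>r. fd f ((x + s *\<^sub>R u) + r *\<^sub>R v) u"
        "\<lambda>r. fd (\<lambda>y. fd f y u) ((x + s *\<^sub>R u) + r *\<^sub>R v) v"] by auto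
  show ?thesis
    using s r by (intro exI[of _ s] exI[of _ r]) (auto simp: g_def g'_def algebra_simps)
qed

lemma second_derivative_symmetric_real:
  fixes f :: "'e::real_normed_vector \<Rightarrow> real"
  assumes "open S" "x \<in> S" "smooth_on S f"
  shows "fd (\<lambda>y. fd f y u) x v = fd (\<lambda>y. fd f y v) x u"
proof -
  \<comment> \<open>At suitable points of a small parallelogram the two mixed derivatives agree, and
    by continuity each is there within \<open>e\<close> of its value at \<open>x\<close>; hence the
    bound \<open>2 * e\<close>.\<close>
  have small: "\<bar>fd (\<lambda>y. fd f y u) x v - fd (\<lambda>y. fd f y v) x u\<bar> < 2 * e" if "e > 0" for e
  proof -
    have cont: "isCont (\<lambda>y. fd (\<lambda>y. fd f y a) y b) x" for a b
      using smooth_on_continuous[OF smooth_on_fd[OF smooth_on_fd[OF assms(3)]]] assms(1,2)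
      by (auto simp: continuous_on_eq_continuous_at)
    have ev: "\<forall>\<^sub>F y in nhds x. y \<in> S \<and> \<bar>fd (\<lambda>y. fd f y u) y v - fd (\<lambda>y. fd f y u) x v\<bar> < e
        \<and> \<bar>fd (\<lambda>y. fd f y v) y u - fd (\<lambda>y. fd f y v) x u\<bar> < e"
      using cont[of u v] cont[of v u] assms(1,2) \<open>e > 0\<close>
      by (intro eventually_conj eventually_nhds_in_open)
        (auto simp: isCont_def tendsto_iff dist_real_def eventually_at_filter elim!: eventually_mono)
    then obtain d where d: "d > 0" and dS: "\<And>y. dist y x < d \<Longrightarrow> y \<in> S \<and>
        \<bar>fd (\<lambda>y. fd f y u) y v - fd (\<lambda>y. fd f y u) x v\<bar> < e \<and>
        \<bar>fd (\<lambda>y. fd f y v) y u - fd (\<lambda>y. fd f y v) x u\<bar> < e"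
      unfolding eventually_nhds_metric by blast
    \<comment> \<open>This size keeps the parallelogram inside the ball of radius \<open>d\<close>;
      the summand 1 keeps the denominator positive when \<open>u\<close> and \<open>v\<close> are
      both zero.\<close>
    define t where "t = d / (norm u + norm v + 1)"
    have nuv: "norm u + norm v + 1 > 0" by (simp add: add_nonneg_pos)
    have "t > 0" using d nuv by (simp add: t_def)
    have near: "dist (x + s *\<^sub>R a + r *\<^sub>R b) x < d"
      if "0 \<le> s" "s \<le> t" "0 \<le> r" "r \<le> t" "(a, b) = (u, v) \<or> (a, b) = (v, u)" for s r a b
    proof -
      have "norm (s *\<^sub>R a + r *\<^sub>R b) \<le> s * norm a + r * norm b"
        using norm_triangle_ineq[of "s *\<^sub>R a" "r *\<^sub>R b"] that by simp
      also have "\<dots> \<le> t * norm a + t * norm b"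
        using that by (intro add_mono mult_right_mono) auto
      also have "\<dots> = t * (norm u + norm v)" using that by (auto simp: algebra_simps)
      also have "\<dots> < t * (norm u + norm v + 1)" using \<open>t > 0\<close> by simp
      also have "\<dots> = d" using nuv by (simp add: t_def)
      finally show ?thesis by (simp add: dist_norm add.assoc)
    qed
    have diff: "f differentiable at y" "(\<lambda>y. fd f y a) differentiable at y" if "y \<in> S" for y a
      using assms(3) that smooth_on_fd smooth_on_differentiable by blast+
    obtain s r where sr: "0 \<le> s" "s \<le> t" "0 \<le> r" "r \<le> t"
      "f (x + t *\<^sub>R u + t *\<^sub>R v) - f (x + t *\<^sub>R u) - f (x + t *\<^sub>R v) + f x =
        t * (t * fd (\<lambda>y. fd f y u) (x + s *\<^sub>R u + r *\<^sub>R v) v)"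
      using second_difference_mean_value[OF \<open>t > 0\<close> _ diff, of x u v S] near dS by metis
    obtain s' r' where sr': "0 \<le> s'" "s' \<le> t" "0 \<le> r'" "r' \<le> t"
      "f (x + t *\<^sub>R v + t *\<^sub>R u) - f (x + t *\<^sub>R v) - f (x + t *\<^sub>R u) + f x =
        t * (t * fd (\<lambda>y. fd f y v) (x + s' *\<^sub>R v + r' *\<^sub>R u) u)"
      using second_difference_mean_value[OF \<open>t > 0\<close> _ diff, of x v u S] near dS by metis
    have "x + t *\<^sub>R v + t *\<^sub>R u = x + t *\<^sub>R u + t *\<^sub>R v" by (simp add: add_ac)
    then have "t * (t * fd (\<lambda>y. fd f y v) (x + s' *\<^sub>R v + r' *\<^sub>R u) u)
      = t * (t * fd (\<lambda>y. fd f y u) (x + s *\<^sub>R u + r *\<^sub>R v) v)"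
      unfolding sr(5)[symmetric] sr'(5)[symmetric] by (simp only:)
    then have "fd (\<lambda>y. fd f y v) (x + s' *\<^sub>R v + r' *\<^sub>R u) u
      = fd (\<lambda>y. fd f y u) (x + s *\<^sub>R u + r *\<^sub>R v) v"
      using \<open>t > 0\<close> by simp
    then show ?thesis
      using dS[OF near[OF sr(1-4), of u v]] dS[OF near[OF sr'(1-4), of v u]] by force
  qed
  have "\<bar>fd (\<lambda>y. fd f y u) x v - fd (\<lambda>y. fd f y v) x u\<bar> \<le> 0 + e" if "e > 0" for e
    using small[of "e / 2"] that by simp
  then have "\<bar>fd (\<lambda>y. fd f y u) x v - fd (\<lambda>y. fd f y v) x u\<bar> \<le> 0"
    by (rule field_le_epsilon)
  then show ?thesis by simp
qed

lemma fd_linear_comp: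
  assumes "bounded_linear L" "f differentiable at x"
  shows "fd (\<lambda>x. L (f x)) x v = L (fd f x v)"
  using fd_eqI[OF bounded_linear.has_derivative[OF assms(1) has_derivative_fd[OF assms(2)]]] by simp

lemma second_derivative_symmetric:
  fixes f :: "'e::real_normed_vector \<Rightarrow> 'f::euclidean_space"
  assumes "open S" "x \<in> S" "smooth_on S f"
  shows "fd (\<lambda>y. fd f y u) x v = fd (\<lambda>y. fd f y v) x u"
proof (rule euclidean_eqI)
  fix b :: 'f assume "b \<in> Basis"
  have "fd (\<lambda>y. fd f y u) x v \<bullet> b = fd (\<lambda>y. fd (\<lambda>z. f z \<bullet> b) y u) x v" for u v
  proof -
    have "fd (\<lambda>y. fd (\<lambda>z. f z \<bullet> b) y u) x v = fd (\<lambda>y. fd f y u \<bullet> b) x v"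
      using fd_linear_comp[OF bounded_linear_inner_left smooth_on_differentiable[OF assms(3)]]
      by (subst fd_cong_open[OF assms(1,2)]) auto
    then show ?thesis
      using fd_linear_comp[OF bounded_linear_inner_left
          smooth_on_differentiable[OF smooth_on_fd[OF assms(3)] assms(2)]] by simp
  qed
  then show "fd (\<lambda>y. fd f y u) x v \<bullet> b = fd (\<lambda>y. fd f y v) x u \<bullet> b"
    using second_derivative_symmetric_real[OF assms(1,2)
        smooth_on_linear_comp[OF bounded_linear_inner_left assms(1,3)]] by simp
qed

section \<open>Charts and tangent vectors\<close>

text \<open>A product rule for a differential paired with a vector, both varying; expansion in
  \<open>Basis\<close> reduces it to products of scalars with \<open>fd t (k z) b\<close>. The first
  term is a second derivative of \<open>t\<close>, the source of the non-tensorial terms under a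
  change of chart.\<close>

lemma has_derivative_fd_apply:
  fixes G :: "'d::real_normed_vector \<Rightarrow> 'e::euclidean_space"
    and t :: "'e \<Rightarrow> 'f::euclidean_space"
  assumes "open T" "smooth_on T t" "k x \<in> T"
    and k: "(k has_derivative k') (at x)" and G: "(G has_derivative G') (at x)"
  shows "((\<lambda>z. fd t (k z) (G z)) has_derivative
    (\<lambda>v. fd (\<lambda>y. fd t y (G x)) (k x) (k' v) + fd t (k x) (G' v))) (at x)"
proof -
  have dt: "t differentiable at y" if "y \<in> T" for y
    using that assms(2) smooth_on_differentiable by blast
  have dt': "(\<lambda>y. fd t y w) differentiable at (k x)" for w
    using assms(2,3) smooth_on_differentiable smooth_on_fd by blast
  have D: "((\<lambda>z. \<Sum>b\<in>Basis. (G z \<bullet> b) *\<^sub>R fd t (k z) b) has_derivative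
      (\<lambda>v. \<Sum>b\<in>Basis. (G x \<bullet> b) *\<^sub>R fd (\<lambda>y. fd t y b) (k x) (k' v) + (G' v \<bullet> b) *\<^sub>R fd t (k x) b)) (at x)"
    by (intro has_derivative_sum has_derivative_scaleR has_derivative_inner_left G
        has_derivative_compose[OF k has_derivative_fd[OF dt']])
  obtain S where S: "open S" "x \<in> S" "\<And>z. z \<in> S \<Longrightarrow> k z \<in> T"
    using topological_tendstoD[OF has_derivative_continuous[OF k, unfolded continuous_within] assms(1,3)]
      assms(3) unfolding eventually_at_topological by (metis UNIV_I)
  have "((\<lambda>z. fd t (k z) (G z)) has_derivative
      (\<lambda>v. \<Sum>b\<in>Basis. (G x \<bullet> b) *\<^sub>R fd (\<lambda>y. fd t y b) (k x) (k' v) + (G' v \<bullet> b) *\<^sub>R fd t (k x) b)) (at x)"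
    by (rule has_derivative_transform_within_open[OF D S(1,2)])
      (simp add: fd_Basis_expansion[OF dt[OF S(3)], of _ "G _"])
  moreover have "fd (\<lambda>y. fd t y (G x)) (k x) w = (\<Sum>b\<in>Basis. (G x \<bullet> b) *\<^sub>R fd (\<lambda>y. fd t y b) (k x) w)" for w
  proof -
    have D: "((\<lambda>y. \<Sum>b\<in>Basis. (G x \<bullet> b) *\<^sub>R fd t y b) has_derivative
      (\<lambda>w. \<Sum>b\<in>Basis. (G x \<bullet> b) *\<^sub>R fd (\<lambda>y. fd t y b) (k x) w)) (at (k x))"
      by (intro has_derivative_sum has_derivative_scaleR_right has_derivative_fd[OF dt'])
    have "((\<lambda>y. fd t y (G x)) has_derivative
      (\<lambda>w. \<Sum>b\<in>Basis. (G x \<bullet> b) *\<^sub>R fd (\<lambda>y. fd t y b) (k x) w)) (at (k x))"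
      by (rule has_derivative_transform_within_open[OF D assms(1,3)])
        (simp add: fd_Basis_expansion[OF dt, of _ "G x"])
    from fd_eqI[OF this] show ?thesis by simp
  qed
  moreover have "fd t (k x) (G' v) = (\<Sum>b\<in>Basis. (G' v \<bullet> b) *\<^sub>R fd t (k x) b)" for v
    by (rule fd_Basis_expansion[OF dt[OF assms(3)]])
  ultimately show ?thesis
    by (simp add: sum.distrib)
qed

abbreviation img :: "('a, 'e) chart \<Rightarrow> 'a set \<Rightarrow> 'e set" where
  "img c W \<equiv> chart_map c ` (chart_dom c \<inter> W)"

lemma charts_at_iff: "c \<in> charts_at A p \<longleftrightarrow> c \<in> A \<and> p \<in> chart_dom c"
  by (simp add: charts_at_def)

lemma tadd_apply [simp]: "tadd v w c = v c + w c"
  and tscale_apply [simp]: "tscale r v c = r *\<^sub>R v c"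
  and tminus_apply [simp]: "tminus v c = - v c"
  and tzero_apply [simp]: "tzero c = 0"
  by (simp_all add: tadd_def tscale_def tminus_def tzero_def)

locale atlas =
  fixes A :: "('a, 'e::euclidean_space) chart set"
  assumes smooth_atlas: "smooth_atlas A"
begin

lemma inj: "c \<in> A \<Longrightarrow> inj_on (chart_map c) (chart_dom c)"
  using smooth_atlas by (auto simp: smooth_atlas_def valid_chart_def)

lemma inv_map [simp]: "c \<in> A \<Longrightarrow> p \<in> chart_dom c \<Longrightarrow> chart_inv c (chart_map c p) = p"
  by (simp add: chart_inv_def inj)

lemma img_inv:
  assumes "c \<in> A" "y \<in> img c W"
  shows "chart_inv c y \<in> chart_dom c" "chart_inv c y \<in> W" "chart_map c (chart_inv c y) = y"
  using assms by auto

lemma open_img_dom: "c \<in> A \<Longrightarrow> d \<in> A \<Longrightarrow> open (img c (chart_dom d))"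
  using smooth_atlas by (auto simp: smooth_atlas_def compatible_def)

lemma manifold_open_dom: "c \<in> A \<Longrightarrow> manifold_open A (chart_dom c)"
  using open_img_dom by (auto simp: manifold_open_def points_def)

lemma manifold_open_Int: "manifold_open A V \<Longrightarrow> manifold_open A W \<Longrightarrow> manifold_open A (V \<inter> W)"
  using openin_Int[of "manifold_topology A" V W] openin_manifold_topology[OF smooth_atlas] by simp

lemma open_img: "manifold_open A W \<Longrightarrow> c \<in> A \<Longrightarrow> open (img c W)"
  by (simp add: manifold_open_def)

lemma transition_map [simp]: "c \<in> A \<Longrightarrow> p \<in> chart_dom c \<Longrightarrow> transition c d (chart_map c p) = chart_map d p"
  by (simp add: transition_def inv_map)

lemma transition_img: "c \<in> A \<Longrightarrow> y \<in> img c (chart_dom d \<inter> W) \<Longrightarrow> transition c d y \<in> img d W"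
  by auto

lemma transition_smooth: "c \<in> A \<Longrightarrow> d \<in> A \<Longrightarrow> smooth_on (img c (chart_dom d)) (transition c d)"
  using smooth_atlas by (auto simp: smooth_atlas_def compatible_def)

lemma transition_differentiable:
  assumes "c \<in> charts_at A p" "d \<in> charts_at A p"
  shows "transition c d differentiable at (chart_map c p)"
  using assms smooth_on_differentiable[OF transition_smooth[of c d]] by (auto simp: charts_at_iff)

lemma fd_transition_self:
  assumes "c \<in> charts_at A p"
  shows "fd (transition c c) (chart_map c p) v = v"
proof -
  have "fd (transition c c) (chart_map c p) = fd (\<lambda>y. y) (chart_map c p)"
    using assms open_img_dom[of c c]
    by (intro fd_cong_open[of "img c (chart_dom c)"]) (auto simp: charts_at_iff)
  then show ?thesis by simp
qed

text \<open>\<open>F\<close> may take values in any normed space, so that this one chain rule yields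
  the cocycle identity for transitions (\<open>F\<close> a chart map) and the chart independence of
  both \<open>dir_deriv\<close> and \<open>pushforward\<close>.\<close>

lemma chart_change:
  assumes "c \<in> charts_at A p" "d \<in> charts_at A p" "(\<lambda>y. F (chart_inv c y)) differentiable at (chart_map c p)"
  shows "(\<lambda>y. F (chart_inv d y)) differentiable at (chart_map d p)"
    and "fd (\<lambda>y. F (chart_inv d y)) (chart_map d p) v =
      fd (\<lambda>y. F (chart_inv c y)) (chart_map c p) (fd (transition d c) (chart_map d p) v)"
proof -
  have cd: "c \<in> A" "d \<in> A" "p \<in> chart_dom c" "p \<in> chart_dom d" using assms by (auto simp: charts_at_iff)
  have p: "transition d c (chart_map d p) = chart_map c p" using cd by simp
  have o: "open (img d (chart_dom c))" "chart_map d p \<in> img d (chart_dom c)" using cd open_img_dom by auto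
  have eq: "F (chart_inv c (transition d c y)) = F (chart_inv d y)" if "y \<in> img d (chart_dom c)" for y
    using that cd by auto
  note D = has_derivative_comp_fd[OF transition_differentiable[OF assms(2,1)], of "\<lambda>y. F (chart_inv c y)",
      unfolded p, OF assms(3)]
  have "((\<lambda>y. F (chart_inv d y)) has_derivative (\<lambda>v. fd (\<lambda>y. F (chart_inv c y)) (chart_map c p)
      (fd (transition d c) (chart_map d p) v))) (at (chart_map d p))"
    using has_derivative_transform_within_open[OF D o] eq by auto
  then show "(\<lambda>y. F (chart_inv d y)) differentiable at (chart_map d p)"
    "fd (\<lambda>y. F (chart_inv d y)) (chart_map d p) v =
      fd (\<lambda>y. F (chart_inv c y)) (chart_map c p) (fd (transition d c) (chart_map d p) v)"
    by (auto simp: differentiable_def dest: fd_eqI)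
qed

lemma fd_transition_trans:
  assumes "c \<in> charts_at A p" "d \<in> charts_at A p" "e \<in> charts_at A p"
  shows "fd (transition d e) (chart_map d p) (fd (transition c d) (chart_map c p) v) =
    fd (transition c e) (chart_map c p) v"
  using chart_change(2)[OF assms(2,1), of "chart_map e" v] transition_differentiable[OF assms(2,3)]
  by (simp add: transition_def comp_def)

lemma tangent_change:
  assumes "v \<in> tangent_space A p" "c \<in> charts_at A p" "d \<in> charts_at A p"
  shows "v d = fd (transition c d) (chart_map c p) (v c)"
  using assms unfolding tangent_space_def by blast

lemma tangent_outside: "v \<in> tangent_space A p \<Longrightarrow> c \<notin> charts_at A p \<Longrightarrow> v c = 0"
  unfolding tangent_space_def by blast

lemma tangent_spaceI:
  assumes "\<And>c d. c \<in> charts_at A p \<Longrightarrow> d \<in> charts_at A p \<Longrightarrow> v d = fd (transition c d) (chart_map c p) (v c)"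
    and "\<And>c. c \<notin> charts_at A p \<Longrightarrow> v c = 0"
  shows "v \<in> tangent_space A p"
  using assms unfolding tangent_space_def by blast

lemma tangent_eqI:
  assumes "v \<in> tangent_space A p" "w \<in> tangent_space A p" "c \<in> charts_at A p" "v c = w c"
  shows "v = w"
proof
  fix d
  show "v d = w d"
  proof (cases "d \<in> charts_at A p")
    case True
    then show ?thesis using tangent_change assms by metis
  next
    case False
    then show ?thesis using assms tangent_outside by metis
  qed
qed

text \<open>By the cocycle identity \<open>fd_transition_trans\<close>, the transformation law from
  one fixed chart to all others implies the law between any two.\<close>

lemma tangent_spaceI_chart:
  assumes "c \<in> charts_at A p"
    and "\<And>d. d \<in> charts_at A p \<Longrightarrow> v d = fd (transition c d) (chart_map c p) (v c)"
    and "\<And>d. d \<notin> charts_at A p \<Longrightarrow> v d = 0"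
  shows "v \<in> tangent_space A p"
proof (rule tangent_spaceI)
  fix d e assume de: "d \<in> charts_at A p" "e \<in> charts_at A p"
  show "v e = fd (transition d e) (chart_map d p) (v d)"
    unfolding assms(2)[OF de(1)] assms(2)[OF de(2)] by (rule fd_transition_trans[OF assms(1) de, symmetric])
qed (rule assms(3))

lemma tangent_tadd:
  assumes "v \<in> tangent_space A p" "w \<in> tangent_space A p"
  shows "tadd v w \<in> tangent_space A p"
proof (rule tangent_spaceI)
  fix c d assume cd: "c \<in> charts_at A p" "d \<in> charts_at A p"
  show "tadd v w d = fd (transition c d) (chart_map c p) (tadd v w c)"
    unfolding tadd_apply tangent_change[OF assms(1) cd] tangent_change[OF assms(2) cd]
    by (rule fd_add[OF transition_differentiable[OF cd], symmetric])
qed (simp add: tangent_outside[OF assms(1)] tangent_outside[OF assms(2)])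

lemma tangent_tscale:
  assumes "v \<in> tangent_space A p"
  shows "tscale r v \<in> tangent_space A p"
proof (rule tangent_spaceI)
  fix c d assume cd: "c \<in> charts_at A p" "d \<in> charts_at A p"
  show "tscale r v d = fd (transition c d) (chart_map c p) (tscale r v c)"
    unfolding tscale_apply tangent_change[OF assms cd]
    by (rule fd_scaleR[OF transition_differentiable[OF cd], symmetric])
qed (simp add: tangent_outside[OF assms])

lemma tangent_tminus:
  assumes "v \<in> tangent_space A p"
  shows "tminus v \<in> tangent_space A p"
  using tangent_tscale[OF assms, of "-1"] by (simp add: tscale_def tminus_def)

lemma coord_field_tangent: "c \<in> charts_at A p \<Longrightarrow> coord_field A c e p \<in> tangent_space A p"
  by (rule tangent_spaceI_chart) (auto simp: coord_field_def fd_transition_self)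

lemma coord_field_same: "c \<in> charts_at A p \<Longrightarrow> coord_field A c e p c = e"
  by (simp add: coord_field_def fd_transition_self)

lemma coord_field_coords:
  assumes "v \<in> tangent_space A p" "c \<in> charts_at A p"
  shows "coord_field A c (v c) p = v"
  using tangent_eqI[OF coord_field_tangent[OF assms(2)] assms(1,2)] coord_field_same[OF assms(2)] by simp

lemma coord_field_add:
  "c \<in> charts_at A p \<Longrightarrow> coord_field A c (a + b) p = tadd (coord_field A c a p) (coord_field A c b p)"
  by (rule tangent_eqI[of _ p _ c]) (simp_all add: coord_field_tangent coord_field_same tangent_tadd)

lemma coord_field_scaleR:
  "c \<in> charts_at A p \<Longrightarrow> coord_field A c (r *\<^sub>R b) p = tscale r (coord_field A c b p)"
  by (rule tangent_eqI[of _ p _ c]) (simp_all add: coord_field_tangent coord_field_same tangent_tscale)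

lemma some_chart_at: "p \<in> points A \<Longrightarrow> some_chart_at A p \<in> charts_at A p"
  unfolding some_chart_at_def by (rule someI_ex) (auto simp: charts_at_iff points_def)

lemma points_charts_at: "c \<in> charts_at A p \<Longrightarrow> p \<in> points A"
  by (auto simp: charts_at_iff points_def)

lemma dir_deriv_chart:
  assumes "c \<in> charts_at A p" "v \<in> tangent_space A p" "(\<lambda>y. F (chart_inv c y)) differentiable at (chart_map c p)"
  shows "dir_deriv A F p v = fd (\<lambda>y. F (chart_inv c y)) (chart_map c p) (v c)"
proof -
  let ?d = "some_chart_at A p"
  have d: "?d \<in> charts_at A p" by (rule some_chart_at[OF points_charts_at[OF assms(1)]])
  show ?thesis
    using chart_change(2)[OF assms(1) d assms(3)] tangent_change[OF assms(2) d assms(1)]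
    by (simp add: dir_deriv_def Let_def comp_def)
qed

lemma pushforward_chart:
  assumes "c \<in> charts_at A p" "v \<in> tangent_space A p" "d \<in> charts_at B (F p)"
    "(\<lambda>y. chart_map d (F (chart_inv c y))) differentiable at (chart_map c p)"
  shows "pushforward A B F p v d = fd (\<lambda>y. chart_map d (F (chart_inv c y))) (chart_map c p) (v c)"
proof -
  let ?d = "some_chart_at A p"
  have d: "?d \<in> charts_at A p" by (rule some_chart_at[OF points_charts_at[OF assms(1)]])
  show ?thesis
    using chart_change(2)[OF assms(1) d assms(4)] tangent_change[OF assms(2) d assms(1)] assms(3)
    by (simp add: pushforward_def Let_def comp_def)
qed

section \<open>Vector fields and Lie brackets\<close>

lemma vector_field_tangent: "vector_field A W X \<Longrightarrow> p \<in> W \<Longrightarrow> X p \<in> tangent_space A p"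
  by (simp add: vector_field_def)

lemma vector_field_smooth: "vector_field A W X \<Longrightarrow> c \<in> A \<Longrightarrow> smooth_on (img c W) (\<lambda>y. X (chart_inv c y) c)"
  by (simp add: vector_field_def)

lemma vector_field_differentiable:
  "vector_field A W X \<Longrightarrow> c \<in> charts_at A p \<Longrightarrow> p \<in> W \<Longrightarrow>
    (\<lambda>y. X (chart_inv c y) c) differentiable at (chart_map c p)"
  using smooth_on_differentiable[OF vector_field_smooth] by (auto simp: charts_at_iff)

lemma vector_field_mono: "vector_field A W X \<Longrightarrow> V \<subseteq> W \<Longrightarrow> vector_field A V X"
  unfolding vector_field_def by (auto intro!: smooth_on_mono[where S = "img _ V" and T = "img _ W"])

lemma smooth_fun_mono: "smooth_fun_on A W X \<Longrightarrow> V \<subseteq> W \<Longrightarrow> smooth_fun_on A V X"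
  unfolding smooth_fun_on_def by (auto intro!: smooth_on_mono[where S = "img _ V" and T = "img _ W"])

lemma smooth_transition_pullback:
  assumes "manifold_open A W" "W \<subseteq> chart_dom c" "c \<in> A" "d \<in> A" "smooth_on (img c W) F"
  shows "smooth_on (img d W) (\<lambda>y. F (transition d c y))"
proof (rule smooth_on_comp[OF open_img[OF assms(1,4)] _ assms(5)])
  show "smooth_on (img d W) (transition d c)"
    using assms by (intro smooth_on_mono[OF transition_smooth]) auto
  show "transition d c ` img d W \<subseteq> img c W"
    using assms transition_img[of d _ c W] by (auto simp: Int_absorb1)
qed

lemma smooth_fun_chart:
  assumes "manifold_open A W" "W \<subseteq> chart_dom c" "c \<in> A" "smooth_on (img c W) (\<lambda>y. F (chart_inv c y))"
  shows "smooth_fun_on A W F"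
  unfolding smooth_fun_on_def
proof
  fix d assume d: "d \<in> A"
  show "smooth_on (img d W) (F \<circ> chart_inv d)"
    by (rule smooth_on_cong[OF open_img[OF assms(1) d] _ smooth_transition_pullback[OF assms(1-3) d assms(4)]])
      (use assms d in auto)
qed

text \<open>In any other chart the components are the differential of the transition map applied to
  the components in \<open>c\<close>, a case of \<open>smooth_on_fd_apply\<close>; one chart whose
  domain contains \<open>W\<close> is therefore enough.\<close>

lemma vector_field_chart:
  assumes "manifold_open A W" "W \<subseteq> chart_dom c" "c \<in> A"
    and X: "\<And>p. p \<in> W \<Longrightarrow> X p \<in> tangent_space A p" and S: "smooth_on (img c W) (\<lambda>y. X (chart_inv c y) c)"
  shows "vector_field A W X"
  unfolding vector_field_def
proof (intro conjI ballI)
  fix d assume d: "d \<in> A"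
  have "smooth_on (img d W) (\<lambda>y. fd (transition c d) (transition d c y) (X (chart_inv c (transition d c y)) c))"
  proof (rule smooth_on_fd_apply[OF open_img[OF assms(1) d] transition_smooth[OF assms(3) d]])
    show "smooth_on (img d W) (transition d c)"
      using assms d by (intro smooth_on_mono[OF transition_smooth]) auto
    show "transition d c ` img d W \<subseteq> img c (chart_dom d)"
      using assms d by auto
  qed (rule smooth_transition_pullback[OF assms(1-3) d S])
  then show "smooth_on (img d W) (\<lambda>y. X (chart_inv d y) d)"
  proof (rule smooth_on_cong[OF open_img[OF assms(1) d], rotated])
    fix y assume "y \<in> img d W"
    then obtain p where p: "p \<in> chart_dom d" "p \<in> W" "y = chart_map d p" by auto
    show "fd (transition c d) (transition d c y) (X (chart_inv c (transition d c y)) c) = X (chart_inv d y) d"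
      using p d assms(2,3) tangent_change[OF X[OF p(2)], of c d]
      by (auto simp: charts_at_iff)
  qed
qed (rule X)

lemma coord_field_comp_vector_field:
  assumes "manifold_open A W" "W \<subseteq> chart_dom c" "c \<in> A" "smooth_on (img c W) F"
  shows "vector_field A W (\<lambda>p. coord_field A c (F (chart_map c p)) p)"
proof (rule vector_field_chart[OF assms(1-3)])
  show "coord_field A c (F (chart_map c p)) p \<in> tangent_space A p" if "p \<in> W" for p
    using assms that by (auto intro!: coord_field_tangent simp: charts_at_iff)
  show "smooth_on (img c W) (\<lambda>y. coord_field A c (F (chart_map c (chart_inv c y))) (chart_inv c y) c)"
    by (rule smooth_on_cong[OF open_img[OF assms(1,3)] _ assms(4)])
      (use assms img_inv[OF assms(3)] in \<open>auto simp: coord_field_same charts_at_iff\<close>)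
qed

lemma coord_field_vector_field:
  assumes "manifold_open A W" "W \<subseteq> chart_dom c" "c \<in> A"
  shows "vector_field A W (coord_field A c e)"
  using coord_field_comp_vector_field[OF assms smooth_on_const, of e] by simp

text \<open>Differentiating the transformation law of \<open>X\<close> produces, besides the
  tensorial term, a second derivative of the transition map. Its symmetry in \<open>v\<close> and
  \<open>X p c\<close> makes it cancel in the bracket, and the same term occurs in the transition
  maps of the double tangent bundle.\<close>

lemma field_chart_change:
  assumes W: "manifold_open A W" "p \<in> W" and c: "c \<in> charts_at A p" and d: "d \<in> charts_at A p"
    and X: "\<And>q. q \<in> W \<Longrightarrow> X q \<in> tangent_space A q"
    and Xc: "(\<lambda>y. X (chart_inv c y) c) differentiable at (chart_map c p)"
    and Xd: "(\<lambda>y. X (chart_inv d y) d) differentiable at (chart_map d p)"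
  shows "fd (\<lambda>y. X (chart_inv d y) d) (chart_map d p) (fd (transition c d) (chart_map c p) v) =
    fd (\<lambda>y. fd (transition c d) y (X p c)) (chart_map c p) v +
    fd (transition c d) (chart_map c p) (fd (\<lambda>y. X (chart_inv c y) c) (chart_map c p) v)"
proof -
  have cd: "c \<in> A" "d \<in> A" "p \<in> chart_dom c" "p \<in> chart_dom d" using c d by (auto simp: charts_at_iff)
  have "((\<lambda>y. fd (transition c d) y (X (chart_inv c y) c)) has_derivative
    (\<lambda>v. fd (\<lambda>y. fd (transition c d) y (X (chart_inv c (chart_map c p)) c)) (chart_map c p) v +
     fd (transition c d) (chart_map c p) (fd (\<lambda>y. X (chart_inv c y) c) (chart_map c p) v))) (at (chart_map c p))"
    using has_derivative_fd_apply[OF open_img_dom[OF cd(1,2)] transition_smooth[OF cd(1,2)] _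
        has_derivative_ident has_derivative_fd[OF Xc]] cd by auto
  then have "((\<lambda>y. X (chart_inv d (transition c d y)) d) has_derivative
    (\<lambda>v. fd (\<lambda>y. fd (transition c d) y (X (chart_inv c (chart_map c p)) c)) (chart_map c p) v +
     fd (transition c d) (chart_map c p) (fd (\<lambda>y. X (chart_inv c y) c) (chart_map c p) v))) (at (chart_map c p))"
  proof (rule has_derivative_transform_within_open)
    show "open (img c (chart_dom d \<inter> W))" "chart_map c p \<in> img c (chart_dom d \<inter> W)"
      using cd W open_img[OF manifold_open_Int[OF manifold_open_dom]] by auto
    fix y assume "y \<in> img c (chart_dom d \<inter> W)"
    then obtain q where q: "q \<in> chart_dom c" "q \<in> chart_dom d" "q \<in> W" "y = chart_map c q" by auto
    show "fd (transition c d) y (X (chart_inv c y) c) = X (chart_inv d (transition c d y)) d"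
      using q cd tangent_change[OF X[OF q(3)], of c d] by (auto simp: charts_at_iff)
  qed
  from fd_eqI[OF this]
  show ?thesis
    using fd_comp[OF transition_differentiable[OF c d], of "\<lambda>y. X (chart_inv d y) d" v] Xd cd
    by (simp add: transition_map inv_map)
qed

text \<open>The second derivatives of the transition map are symmetric and cancel between the two
  halves of the bracket. Differentiability at \<open>p\<close> is assumed instead of
  \<open>vector_field\<close> because this is what is known of the Hamiltonian field.\<close>

lemma lie_bracket_tangent:
  assumes W: "manifold_open A W" "p \<in> W"
    and X: "\<And>q. q \<in> W \<Longrightarrow> X q \<in> tangent_space A q"
    and dX: "\<And>c. c \<in> charts_at A p \<Longrightarrow> (\<lambda>y. X (chart_inv c y) c) differentiable at (chart_map c p)"
    and Y: "\<And>q. q \<in> W \<Longrightarrow> Y q \<in> tangent_space A q"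
    and dY: "\<And>c. c \<in> charts_at A p \<Longrightarrow> (\<lambda>y. Y (chart_inv c y) c) differentiable at (chart_map c p)"
  shows "lie_bracket A X Y p \<in> tangent_space A p"
proof -
  obtain c where c: "c \<in> charts_at A p"
    using W by (metis manifold_open_def some_chart_at subsetD)
  show ?thesis
  proof (rule tangent_spaceI_chart[OF c])
    fix d assume d: "d \<in> charts_at A p"
    have cd: "c \<in> A" "d \<in> A" "p \<in> chart_dom c" using c d by (auto simp: charts_at_iff)
    have "fd (\<lambda>y. fd (transition c d) y (X p c)) (chart_map c p) (Y p c) =
      fd (\<lambda>y. fd (transition c d) y (Y p c)) (chart_map c p) (X p c)"
      by (rule second_derivative_symmetric[OF open_img_dom[OF cd(1,2)] _ transition_smooth[OF cd(1,2)]])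
        (use c d in \<open>auto simp: charts_at_iff\<close>)
    then show "lie_bracket A X Y p d = fd (transition c d) (chart_map c p) (lie_bracket A X Y p c)"
      using c d field_chart_change[OF W c d X dX[OF c] dX[OF d], of "Y p c"]
        field_chart_change[OF W c d Y dY[OF c] dY[OF d], of "X p c"]
        tangent_change[OF X[OF W(2)] c d] tangent_change[OF Y[OF W(2)] c d]
      by (simp add: lie_bracket_def linear_diff[OF linear_frechet_derivative[OF transition_differentiable[OF c d]]])
  qed (simp add: lie_bracket_def)
qed

end

section \<open>The tangent bundle\<close>

lemma tangent_chart_dom [simp]: "chart_dom (tangent_chart A c) = bundle_restrict A (chart_dom c)"
  by (simp add: tangent_chart_def)

lemma tangent_chart_map [simp]: "chart_map (tangent_chart A c) u = (chart_map c (fst u), snd u c)"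
  by (simp add: tangent_chart_def split_beta)

lemma mem_tangent_bundle: "u \<in> tangent_bundle A \<longleftrightarrow> fst u \<in> points A \<and> snd u \<in> tangent_space A (fst u)"
  by (cases u) (simp add: tangent_bundle_def)

lemma mem_bundle_restrict: "u \<in> bundle_restrict A W \<longleftrightarrow> u \<in> tangent_bundle A \<and> fst u \<in> W"
  by (simp add: bundle_restrict_def)

context atlas
begin

lemma bundle_restrict_Int: "bundle_restrict A (V \<inter> W) = bundle_restrict A V \<inter> bundle_restrict A W"
  by (auto simp: bundle_restrict_def)

lemma inj_tangent_chart:
  assumes "c \<in> A"
  shows "inj_on (chart_map (tangent_chart A c)) (bundle_restrict A (chart_dom c))"
proof (rule inj_onI)
  fix u u'
  assume *: "u \<in> bundle_restrict A (chart_dom c)" "u' \<in> bundle_restrict A (chart_dom c)"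
    "chart_map (tangent_chart A c) u = chart_map (tangent_chart A c) u'"
  then have "fst u = fst u'"
    using inj[OF assms] by (auto simp: mem_bundle_restrict inj_on_def)
  moreover from this have "snd u = snd u'"
    using * assms by (intro tangent_eqI[of _ "fst u" _ c])
      (auto simp: mem_bundle_restrict mem_tangent_bundle charts_at_iff)
  ultimately show "u = u'" by (simp add: prod_eq_iff)
qed

lemma mem_coord_field_bundle:
  "c \<in> charts_at A p \<Longrightarrow> p \<in> W \<Longrightarrow> (p, coord_field A c w p) \<in> bundle_restrict A W"
  using points_charts_at coord_field_tangent by (simp add: mem_bundle_restrict mem_tangent_bundle)

text \<open>Every vector of the model space occurs as a fibre coordinate, by way of
  \<open>coord_field\<close>, so the image is a full product and openness becomes a question about
  the base.\<close>

lemma img_tangent_chart: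
  assumes "c \<in> A"
  shows "img (tangent_chart A c) (bundle_restrict A W) = img c W \<times> UNIV"
proof
  show "img (tangent_chart A c) (bundle_restrict A W) \<subseteq> img c W \<times> UNIV"
    by (auto simp: mem_bundle_restrict)
  show "img c W \<times> (UNIV :: 'e set) \<subseteq> img (tangent_chart A c) (bundle_restrict A W)"
  proof
    fix z :: "'e \<times> 'e" assume "z \<in> img c W \<times> UNIV"
    then obtain p w where p: "p \<in> chart_dom c" "p \<in> W" "z = (chart_map c p, w)" by auto
    then show "z \<in> img (tangent_chart A c) (bundle_restrict A W)"
      using mem_coord_field_bundle[of c p "chart_dom c \<inter> W" w] coord_field_same[of c p w] assms
      by (intro image_eqI[of _ _ "(p, coord_field A c w p)"])
        (simp_all add: charts_at_iff bundle_restrict_Int)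
  qed
qed

lemma chart_inv_tangent_chart:
  assumes "c \<in> A" "y \<in> img c (chart_dom c)"
  shows "chart_inv (tangent_chart A c) (y, w) = (chart_inv c y, coord_field A c w (chart_inv c y))"
proof -
  obtain p where p: "p \<in> chart_dom c" "y = chart_map c p" using assms by auto
  show ?thesis
    using inv_into_f_eq[OF inj_tangent_chart[OF assms(1)], of "(p, coord_field A c w p)" "(y, w)"]
      mem_coord_field_bundle[of c p "chart_dom c" w] coord_field_same[of c p w] p assms(1)
    by (simp add: chart_inv_def[of "tangent_chart A c"] charts_at_iff)
qed

lemma transition_tangent_chart:
  assumes "c \<in> A" "d \<in> A" "y \<in> img c (chart_dom d)"
  shows "transition (tangent_chart A c) (tangent_chart A d) (y, w) =
    (transition c d y, fd (transition c d) y w)"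
proof -
  obtain p where p: "p \<in> chart_dom c" "p \<in> chart_dom d" "y = chart_map c p" using assms by auto
  then show ?thesis
    using chart_inv_tangent_chart[OF assms(1), of y w] assms
    by (simp add: transition_def coord_field_def charts_at_iff)
qed

lemma smooth_transition_tangent_chart:
  assumes "c \<in> A" "d \<in> A"
  shows "smooth_on (img c (chart_dom d) \<times> UNIV) (transition (tangent_chart A c) (tangent_chart A d))"
proof -
  let ?S = "img c (chart_dom d) \<times> (UNIV :: 'e set)"
  have o: "open ?S" using open_img_dom[OF assms] by (intro open_Times) auto
  have fst: "smooth_on ?S fst" and snd: "smooth_on ?S snd"
    by (auto intro: smooth_on_linear[OF _ o] bounded_linear_fst bounded_linear_snd)
  have "smooth_on ?S (\<lambda>z. (transition c d (fst z), fd (transition c d) (fst z) (snd z)))"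
    by (intro smooth_on_Pair[OF o] smooth_on_comp[OF o fst transition_smooth[OF assms]]
        smooth_on_fd_apply[OF o transition_smooth[OF assms] fst _ snd]) auto
  then show ?thesis
    by (rule smooth_on_cong[OF o, rotated]) (use transition_tangent_chart[OF assms] in auto)
qed

text \<open>The locale \<open>atlas\<close> asks for compatibility and not for maximality, so the
  calculus developed for \<open>A\<close> carries over to the induced charts, which need not form a
  maximal atlas.\<close>

lemma atlas_tangent_atlas: "atlas (tangent_atlas A)"
proof
  have img: "img (tangent_chart A c) (chart_dom (tangent_chart A d)) = img c (chart_dom d) \<times> UNIV"
    if "c \<in> A" for c d
    using img_tangent_chart[OF that, of "chart_dom d"] by simp
  have o: "open (img c (chart_dom d) \<times> (UNIV::'e set))" if "c \<in> A" "d \<in> A" for c d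
    using open_img_dom[OF that] by (intro open_Times) auto
  have "valid_chart (tangent_chart A c)" if "c \<in> A" for c
    unfolding valid_chart_def
    using inj_tangent_chart[OF that] img[OF that, of c] o[OF that that] by simp
  moreover have "compatible (tangent_chart A c) (tangent_chart A d)" if "c \<in> A" "d \<in> A" for c d
    unfolding compatible_def
    using img[OF that(1), of d] img[OF that(2), of c] o[OF that] o[OF that(2,1)]
      smooth_transition_tangent_chart[OF that] smooth_transition_tangent_chart[OF that(2,1)]
    by (simp add: Int_commute)
  ultimately show "smooth_atlas (tangent_atlas A)"
    by (auto simp: smooth_atlas_def tangent_atlas_def)
qed

interpretation T: atlas "tangent_atlas A"
  by (rule atlas_tangent_atlas)

lemma tangent_chart_mem: "c \<in> A \<Longrightarrow> tangent_chart A c \<in> tangent_atlas A"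
  by (simp add: tangent_atlas_def)

lemma charts_at_tangent_atlas:
  assumes "u \<in> tangent_bundle A"
  shows "charts_at (tangent_atlas A) u = tangent_chart A ` charts_at A (fst u)"
proof (intro equalityI subsetI)
  fix c' assume c': "c' \<in> charts_at (tangent_atlas A) u"
  obtain c where "c \<in> A" "c' = tangent_chart A c"
    using c' unfolding charts_at_iff tangent_atlas_def by (elim conjE imageE)
  then show "c' \<in> tangent_chart A ` charts_at A (fst u)"
    using c' by (intro image_eqI[of _ _ c]) (simp_all add: charts_at_iff mem_bundle_restrict)
next
  fix c' assume c': "c' \<in> tangent_chart A ` charts_at A (fst u)"
  then show "c' \<in> charts_at (tangent_atlas A) u"
    using assms by (elim imageE) (simp add: charts_at_iff tangent_atlas_def mem_bundle_restrict)
qed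

lemma tangent_chart_charts_at:
  "u \<in> tangent_bundle A \<Longrightarrow> c \<in> charts_at A (fst u) \<Longrightarrow>
    tangent_chart A c \<in> charts_at (tangent_atlas A) u"
  by (simp add: charts_at_tangent_atlas)

lemma manifold_open_bundle_restrict:
  assumes "manifold_open A W"
  shows "manifold_open (tangent_atlas A) (bundle_restrict A W)"
proof -
  have "bundle_restrict A W \<subseteq> points (tangent_atlas A)"
    by (auto simp: points_def tangent_atlas_def mem_bundle_restrict mem_tangent_bundle)
  moreover have "open (img c (bundle_restrict A W))" if "c \<in> tangent_atlas A" for c
    using that open_img[OF assms] img_tangent_chart[of _ W] by (auto simp: tangent_atlas_def intro!: open_Times)
  ultimately show ?thesis by (simp add: manifold_open_def)
qed

section \<open>The double tangent bundle\<close>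

lemma fd_transition_tangent_chart:
  assumes "c \<in> charts_at A p" "d \<in> charts_at A p"
  shows "fd (transition (tangent_chart A c) (tangent_chart A d)) (chart_map c p, w) m =
    (fd (transition c d) (chart_map c p) (fst m),
     fd (\<lambda>y. fd (transition c d) y w) (chart_map c p) (fst m) + fd (transition c d) (chart_map c p) (snd m))"
proof -
  have cd: "c \<in> A" "d \<in> A" "chart_map c p \<in> img c (chart_dom d)" using assms by (auto simp: charts_at_iff)
  have fst: "(fst has_derivative fst) (at (chart_map c p, w))"
    and snd: "(snd has_derivative snd) (at (chart_map c p, w))"
    by (auto intro!: bounded_linear_imp_has_derivative bounded_linear_fst bounded_linear_snd)
  have 1: "((\<lambda>z. transition c d (fst z)) has_derivative (\<lambda>m. fd (transition c d) (chart_map c p) (fst m)))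
      (at (chart_map c p, w))"
    using has_derivative_compose[OF fst, of "transition c d"] has_derivative_fd[OF transition_differentiable[OF assms]]
    by simp
  have 2: "((\<lambda>z. fd (transition c d) (fst z) (snd z)) has_derivative
      (\<lambda>m. fd (\<lambda>y. fd (transition c d) y w) (chart_map c p) (fst m) + fd (transition c d) (chart_map c p) (snd m)))
      (at (chart_map c p, w))"
    using has_derivative_fd_apply[OF open_img_dom[OF cd(1,2)] transition_smooth[OF cd(1,2)] _ fst snd] cd(3)
    by simp
  have "(transition (tangent_chart A c) (tangent_chart A d) has_derivative
      (\<lambda>m. (fd (transition c d) (chart_map c p) (fst m),
     fd (\<lambda>y. fd (transition c d) y w) (chart_map c p) (fst m) + fd (transition c d) (chart_map c p) (snd m))))
      (at (chart_map c p, w))"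
    by (rule has_derivative_transform_within_open[OF has_derivative_Pair[OF 1 2], of "img c (chart_dom d) \<times> UNIV"])
      (use cd open_img_dom[OF cd(1,2)] transition_tangent_chart[OF cd(1,2)] in \<open>auto intro!: open_Times\<close>)
  from fd_eqI[OF this] show ?thesis by simp
qed

text \<open>The base part is tensorial, which is why \<open>proj_push\<close> lands in the tangent
  space. The fibre part picks up a second derivative of the transition map and is no tangent vector
  by itself; the Christoffel term of the connector compensates for this.\<close>

lemma tangent_bundle_change:
  assumes "u \<in> tangent_bundle A" "\<xi> \<in> tangent_space (tangent_atlas A) u"
    and c: "c \<in> charts_at A (fst u)" and d: "d \<in> charts_at A (fst u)"
  shows "\<xi> (tangent_chart A d) =
    (fd (transition c d) (chart_map c (fst u)) (fst (\<xi> (tangent_chart A c))),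
     fd (\<lambda>y. fd (transition c d) y (snd u c)) (chart_map c (fst u)) (fst (\<xi> (tangent_chart A c))) +
     fd (transition c d) (chart_map c (fst u)) (snd (\<xi> (tangent_chart A c))))"
  using T.tangent_change[OF assms(2) tangent_chart_charts_at[OF assms(1) c] tangent_chart_charts_at[OF assms(1) d]]
    fd_transition_tangent_chart[OF c d, of "snd u c" "\<xi> (tangent_chart A c)"] by simp

lemma proj_push_chart:
  assumes u: "u \<in> tangent_bundle A" and xi: "\<xi> \<in> tangent_space (tangent_atlas A) u" and c: "c \<in> charts_at A (fst u)"
  shows "proj_push A u \<xi> c = fst (\<xi> (tangent_chart A c))"
proof -
  have cA: "c \<in> A" "fst u \<in> chart_dom c" using c by (auto simp: charts_at_iff)
  have "((\<lambda>z. chart_map c (fst (chart_inv (tangent_chart A c) z))) has_derivative fst)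
      (at (chart_map (tangent_chart A c) u))"
  proof (rule has_derivative_transform_within_open[of fst fst _ _ "img c (chart_dom c) \<times> UNIV"])
    show "(fst has_derivative fst) (at (chart_map (tangent_chart A c) u))"
      by (auto intro!: bounded_linear_imp_has_derivative bounded_linear_fst)
    show "open (img c (chart_dom c) \<times> (UNIV::'e set))"
      using open_img_dom[OF cA(1,1)] by (intro open_Times) auto
    show "chart_map (tangent_chart A c) u \<in> img c (chart_dom c) \<times> UNIV" using cA by auto
    show "fst z = chart_map c (fst (chart_inv (tangent_chart A c) z))" if "z \<in> img c (chart_dom c) \<times> UNIV" for z
      using that chart_inv_tangent_chart[OF cA(1), of "fst z" "snd z"] cA by auto
  qed
  note D = this
  show ?thesis
    unfolding proj_push_def
    using T.pushforward_chart[OF tangent_chart_charts_at[OF u c] xi, of c A fst] c D fd_eqI[OF D]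
    by (simp add: differentiableI)
qed

lemma proj_push_tangent:
  assumes u: "u \<in> tangent_bundle A" and xi: "\<xi> \<in> tangent_space (tangent_atlas A) u"
  shows "proj_push A u \<xi> \<in> tangent_space A (fst u)"
proof (rule tangent_spaceI)
  fix c d assume cd: "c \<in> charts_at A (fst u)" "d \<in> charts_at A (fst u)"
  show "proj_push A u \<xi> d = fd (transition c d) (chart_map c (fst u)) (proj_push A u \<xi> c)"
    unfolding proj_push_chart[OF u xi cd(1)] proj_push_chart[OF u xi cd(2)] tangent_bundle_change[OF u xi cd]
    by simp
qed (simp add: proj_push_def pushforward_def Let_def)

lemma section_push_chart:
  assumes W: "manifold_open A W" and Y: "vector_field A W Y" and p: "p \<in> W" and v: "v \<in> tangent_space A p"
    and c: "c \<in> charts_at A p"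
  shows "pushforward A (tangent_atlas A) (\<lambda>q. (q, Y q)) p v (tangent_chart A c) =
    (v c, fd (\<lambda>y. Y (chart_inv c y) c) (chart_map c p) (v c))"
proof -
  have cA: "c \<in> A" "p \<in> chart_dom c" using c by (auto simp: charts_at_iff)
  have u: "(p, Y p) \<in> tangent_bundle A"
    using points_charts_at[OF c] vector_field_tangent[OF Y p] by (simp add: mem_tangent_bundle)
  have "((\<lambda>y. (y, Y (chart_inv c y) c)) has_derivative
      (\<lambda>v. (v, fd (\<lambda>y. Y (chart_inv c y) c) (chart_map c p) v))) (at (chart_map c p))"
    by (intro has_derivative_Pair has_derivative_ident has_derivative_fd vector_field_differentiable[OF Y c p])
  then have D: "((\<lambda>y. chart_map (tangent_chart A c) (chart_inv c y, Y (chart_inv c y))) has_derivative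
      (\<lambda>v. (v, fd (\<lambda>y. Y (chart_inv c y) c) (chart_map c p) v))) (at (chart_map c p))"
    by (rule has_derivative_transform_within_open[of _ _ _ _ "img c (chart_dom c)"])
      (use cA open_img_dom[of c c] in auto)
  show ?thesis
    using pushforward_chart[OF c v, of "tangent_chart A c" "tangent_atlas A" "\<lambda>q. (q, Y q)"]
      tangent_chart_charts_at[OF u] c D fd_eqI[OF D] by (simp add: differentiableI)
qed

text \<open>The second derivative of the transition map that \<open>field_chart_change\<close>
  produces for \<open>Y\<close> is exactly the one in
  \<open>fd_transition_tangent_chart\<close>.\<close>

lemma section_push_tangent:
  assumes W: "manifold_open A W" and Y: "vector_field A W Y" and p: "p \<in> W" and v: "v \<in> tangent_space A p"
  shows "pushforward A (tangent_atlas A) (\<lambda>q. (q, Y q)) p v \<in> tangent_space (tangent_atlas A) (p, Y p)"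
proof (rule T.tangent_spaceI)
  have u: "(p, Y p) \<in> tangent_bundle A"
    using W p vector_field_tangent[OF Y p] by (auto simp: mem_tangent_bundle manifold_open_def)
  fix c' d' assume "c' \<in> charts_at (tangent_atlas A) (p, Y p)" "d' \<in> charts_at (tangent_atlas A) (p, Y p)"
  then obtain c d where c: "c \<in> charts_at A p" "c' = tangent_chart A c"
    and d: "d \<in> charts_at A p" "d' = tangent_chart A d"
    by (auto simp: charts_at_tangent_atlas[OF u])
  show "pushforward A (tangent_atlas A) (\<lambda>q. (q, Y q)) p v d' =
    fd (transition c' d') (chart_map c' (p, Y p)) (pushforward A (tangent_atlas A) (\<lambda>q. (q, Y q)) p v c')"
    unfolding c(2) d(2) section_push_chart[OF assms c(1)] section_push_chart[OF assms d(1)]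
    using fd_transition_tangent_chart[OF c(1) d(1)] tangent_change[OF v c(1) d(1)]
      field_chart_change[OF W p c(1) d(1) vector_field_tangent[OF Y] vector_field_differentiable[OF Y c(1) p]
        vector_field_differentiable[OF Y d(1) p]]
    by simp
qed (simp add: pushforward_def Let_def)

end

section \<open>Connections and connectors\<close>

lemma linear_Basis_expansion:
  fixes L :: "'e::euclidean_space \<Rightarrow> 'f::real_vector"
  assumes "linear L"
  shows "L v = (\<Sum>b\<in>Basis. (v \<bullet> b) *\<^sub>R L b)"
proof -
  have "L (\<Sum>b\<in>Basis. (v \<bullet> b) *\<^sub>R b) = (\<Sum>b\<in>Basis. (v \<bullet> b) *\<^sub>R L b)"
    by (simp only: linear_sum[OF assms] linear_scale[OF assms])
  then show ?thesis by (simp only: euclidean_representation)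
qed

context atlas
begin

lemma vector_field_tadd:
  assumes "manifold_open A W" "vector_field A W X" "vector_field A W Y"
  shows "vector_field A W (\<lambda>q. tadd (X q) (Y q))"
  using assms tangent_tadd unfolding vector_field_def
  by (auto intro!: smooth_on_add open_img[OF assms(1)])

lemma vector_field_tscale:
  assumes "manifold_open A W" "smooth_fun_on A W f" "vector_field A W Y"
  shows "vector_field A W (\<lambda>q. tscale (f q) (Y q))"
  using assms tangent_tscale unfolding vector_field_def smooth_fun_on_def comp_def
  by (auto intro!: smooth_on_bilinear[OF bounded_bilinear_scaleR] open_img[OF assms(1)])

lemma smooth_fun_const: "smooth_fun_on A W (\<lambda>q. r)"
  by (simp add: smooth_fun_on_def comp_def smooth_on_const)

lemma dir_deriv_const [simp]: "dir_deriv A (\<lambda>q. r) p v = 0"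
  by (simp add: dir_deriv_def Let_def comp_def)

lemma dir_deriv_cong:
  assumes "manifold_open A W" "p \<in> W" "\<And>q. q \<in> W \<Longrightarrow> F q = G q"
  shows "dir_deriv A F p v = dir_deriv A G p v"
proof -
  let ?c = "some_chart_at A p"
  have c: "?c \<in> A" "p \<in> chart_dom ?c"
    using some_chart_at[of p] assms(1,2) by (auto simp: manifold_open_def charts_at_iff)
  have "fd (F \<circ> chart_inv ?c) (chart_map ?c p) = fd (G \<circ> chart_inv ?c) (chart_map ?c p)"
    by (rule fd_cong_open[OF open_img[OF assms(1) c(1)]]) (use assms c in auto)
  then show ?thesis by (simp add: dir_deriv_def Let_def)
qed

lemma smooth_fun_differentiable:
  "smooth_fun_on A W f \<Longrightarrow> c \<in> charts_at A p \<Longrightarrow> p \<in> W \<Longrightarrow>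
    (\<lambda>y. f (chart_inv c y)) differentiable at (chart_map c p)"
  unfolding smooth_fun_on_def comp_def
  by (auto simp: charts_at_iff intro!: smooth_on_differentiable[of "img c W"])

lemma coord_field_expansion:
  assumes "c \<in> charts_at A p"
  shows "coord_field A c e p d = (\<Sum>b\<in>Basis. (e \<bullet> b) *\<^sub>R coord_field A c b p d)"
  using fd_Basis_expansion[OF transition_differentiable[OF assms], of d e]
  by (simp add: coord_field_def)

lemma tangent_expansion:
  assumes "v \<in> tangent_space A p" "c \<in> charts_at A p"
  shows "v = (\<lambda>d. \<Sum>b\<in>Basis. (v c \<bullet> b) *\<^sub>R coord_field A c b p d)"
proof
  fix d
  have "coord_field A c (v c) p d = v d" by (simp only: coord_field_coords[OF assms])
  then show "v d = (\<Sum>b\<in>Basis. (v c \<bullet> b) *\<^sub>R coord_field A c b p d)"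
    using coord_field_expansion[OF assms(2), of "v c" d] by (rule trans[OF sym])
qed

lemma component_smooth:
  assumes "manifold_open A W" "W \<subseteq> chart_dom c" "c \<in> A" "vector_field A W X"
  shows "smooth_fun_on A W (\<lambda>q. X q c \<bullet> b)"
  by (rule smooth_fun_chart[OF assms(1-3)])
    (rule smooth_on_linear_comp[OF bounded_linear_inner_left open_img[OF assms(1,3)] vector_field_smooth[OF assms(4,3)]])

end

text \<open>This is \<open>christoffel\<close> with coordinate vectors for the lower indices and the
  upper index left free: sums over indices become bilinearity, and the model space can be any
  Euclidean space.\<close>

definition Christoffel ::
    "('a, 'e::euclidean_space) chart set \<Rightarrow> ('a, 'e) covariant \<Rightarrow> ('a, 'e) chart \<Rightarrow> 'a \<Rightarrow> 'e \<Rightarrow> 'e \<Rightarrow> 'e" where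
  "Christoffel A N c p a b = N (coord_field A c a) (coord_field A c b) p c"

section \<open>Covariant derivatives in a chart\<close>

locale connection = atlas A for A :: "('a, 'e::euclidean_space) chart set" +
  fixes N :: "('a, 'e) covariant"
  assumes affine: "affine_connection A N"
begin

lemmas affine_at = affine[unfolded affine_connection_def, THEN spec, THEN mp]

lemma vector_field_N:
  "manifold_open A W \<Longrightarrow> vector_field A W X \<Longrightarrow> vector_field A W Y \<Longrightarrow> vector_field A W (N X Y)"
  by (drule affine_at[THEN conjunct1]) blast

lemma N_tangent:
  "manifold_open A W \<Longrightarrow> vector_field A W X \<Longrightarrow> vector_field A W Y \<Longrightarrow> p \<in> W \<Longrightarrow> N X Y p \<in> tangent_space A p"
  using vector_field_N vector_field_tangent by blast

lemma N_add_left: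
  "manifold_open A W \<Longrightarrow> vector_field A W X \<Longrightarrow> vector_field A W X' \<Longrightarrow> vector_field A W Y \<Longrightarrow> p \<in> W \<Longrightarrow>
    N (\<lambda>q. tadd (X q) (X' q)) Y p = tadd (N X Y p) (N X' Y p)"
  by (drule affine_at[THEN conjunct2, THEN conjunct1]) blast

lemma N_scale_left:
  "manifold_open A W \<Longrightarrow> smooth_fun_on A W f \<Longrightarrow> vector_field A W X \<Longrightarrow> vector_field A W Y \<Longrightarrow> p \<in> W \<Longrightarrow>
    N (\<lambda>q. tscale (f q) (X q)) Y p = tscale (f p) (N X Y p)"
  by (drule affine_at[THEN conjunct2, THEN conjunct2, THEN conjunct1]) blast

lemma N_add_right:
  "manifold_open A W \<Longrightarrow> vector_field A W X \<Longrightarrow> vector_field A W Y \<Longrightarrow> vector_field A W Y' \<Longrightarrow> p \<in> W \<Longrightarrow>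
    N X (\<lambda>q. tadd (Y q) (Y' q)) p = tadd (N X Y p) (N X Y' p)"
  by (drule affine_at[THEN conjunct2, THEN conjunct2, THEN conjunct2, THEN conjunct1]) blast

lemma N_Leibniz:
  "manifold_open A W \<Longrightarrow> smooth_fun_on A W f \<Longrightarrow> vector_field A W X \<Longrightarrow> vector_field A W Y \<Longrightarrow> p \<in> W \<Longrightarrow>
    N X (\<lambda>q. tscale (f q) (Y q)) p =
      tadd (tscale (dir_deriv A f p (X p)) (Y p)) (tscale (f p) (N X Y p))"
  by (drule affine_at[THEN conjunct2, THEN conjunct2, THEN conjunct2, THEN conjunct2, THEN conjunct1]) blast

lemma N_cong:
  "manifold_open A W \<Longrightarrow> vector_field A W X \<Longrightarrow> vector_field A W X' \<Longrightarrow>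
    vector_field A W Y \<Longrightarrow> vector_field A W Y' \<Longrightarrow>
    (\<And>q. q \<in> W \<Longrightarrow> X q = X' q) \<Longrightarrow> (\<And>q. q \<in> W \<Longrightarrow> Y q = Y' q) \<Longrightarrow> p \<in> W \<Longrightarrow> N X Y p = N X' Y' p"
  by (drule affine_at[THEN conjunct2, THEN conjunct2, THEN conjunct2, THEN conjunct2, THEN conjunct2]) blast

text \<open>The three claims share one induction because the axioms for \<open>N\<close> apply to a
  partial sum only once it is known to be a vector field.\<close>

lemma N_sum:
  assumes W: "manifold_open A W" "p \<in> W" and X: "vector_field A W X" and "finite I"
    and g: "\<And>i. i \<in> I \<Longrightarrow> smooth_fun_on A W (g i)" and E: "\<And>i. i \<in> I \<Longrightarrow> vector_field A W (E i)"
  shows "vector_field A W (\<lambda>q d. \<Sum>i\<in>I. g i q *\<^sub>R E i q d) \<and>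
    N (\<lambda>q d. \<Sum>i\<in>I. g i q *\<^sub>R E i q d) X p = (\<lambda>d. \<Sum>i\<in>I. g i p *\<^sub>R N (E i) X p d) \<and>
    N X (\<lambda>q d. \<Sum>i\<in>I. g i q *\<^sub>R E i q d) p =
      (\<lambda>d. \<Sum>i\<in>I. dir_deriv A (g i) p (X p) *\<^sub>R E i p d + g i p *\<^sub>R N X (E i) p d)"
  using assms(4) g E
proof (induction I)
  case empty
  \<comment> \<open>The empty sum is the zero field, written as a multiple of \<open>X\<close> so
    that homogeneity and the Leibniz rule for the constant 0 apply to it.\<close>
  have 0: "(\<lambda>q d. 0) = (\<lambda>q. tscale 0 (X q))" by (simp add: tscale_def)
  show ?case
    unfolding sum.empty 0
    using vector_field_tscale[OF W(1) smooth_fun_const X, of 0] N_scale_left[OF W(1) smooth_fun_const X X W(2), of 0]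
      N_Leibniz[OF W(1) smooth_fun_const X X W(2), of 0]
    by (simp add: tscale_def tadd_def)
next
  case (insert i I)
  have eq: "(\<lambda>q d. \<Sum>i\<in>insert i I. g i q *\<^sub>R E i q d) =
    (\<lambda>q. tadd (tscale (g i q) (E i q)) (\<lambda>d. \<Sum>i\<in>I. g i q *\<^sub>R E i q d))"
    using insert.hyps by (simp add: tadd_def tscale_def)
  have IH: "vector_field A W (\<lambda>q d. \<Sum>i\<in>I. g i q *\<^sub>R E i q d)"
    "N (\<lambda>q d. \<Sum>i\<in>I. g i q *\<^sub>R E i q d) X p = (\<lambda>d. \<Sum>i\<in>I. g i p *\<^sub>R N (E i) X p d)"
    "N X (\<lambda>q d. \<Sum>i\<in>I. g i q *\<^sub>R E i q d) p =
      (\<lambda>d. \<Sum>i\<in>I. dir_deriv A (g i) p (X p) *\<^sub>R E i p d + g i p *\<^sub>R N X (E i) p d)"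
    using insert by auto
  have i: "smooth_fun_on A W (g i)" "vector_field A W (E i)" using insert.prems by auto
  have gE: "vector_field A W (\<lambda>q. tscale (g i q) (E i q))" by (rule vector_field_tscale[OF W(1) i])
  show ?case
    unfolding eq N_add_left[OF W(1) gE IH(1) X W(2)] N_add_right[OF W(1) X gE IH(1) W(2)] IH(2,3)
      N_scale_left[OF W(1) i X W(2)] N_Leibniz[OF W(1) i(1) X i(2) W(2)]
    using vector_field_tadd[OF W(1) gE IH(1)] insert.hyps
    by (simp add: tadd_def tscale_def)
qed

lemmas vector_field_sum = N_sum[THEN conjunct1]
  and N_sum_left = N_sum[THEN conjunct2, THEN conjunct1]
  and N_sum_right = N_sum[THEN conjunct2, THEN conjunct2]

abbreviation Gam :: "('a, 'e) chart \<Rightarrow> 'a \<Rightarrow> 'e \<Rightarrow> 'e \<Rightarrow> 'e" where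
  "Gam \<equiv> Christoffel A N"

lemma N_pointwise_left:
  assumes W: "manifold_open A W" "p \<in> W" "W \<subseteq> chart_dom c" "c \<in> A" and X: "vector_field A W X" and Y: "vector_field A W Y"
  shows "N X Y p = (\<lambda>d. \<Sum>b\<in>Basis. (X p c \<bullet> b) *\<^sub>R N (coord_field A c b) Y p d)"
proof -
  note c = coord_field_vector_field[OF W(1,3,4)]
  note s = component_smooth[OF W(1,3,4) X]
  have eq: "X q = (\<lambda>d. \<Sum>b\<in>Basis. (X q c \<bullet> b) *\<^sub>R coord_field A c b q d)" if "q \<in> W" for q
    using that W by (intro tangent_expansion vector_field_tangent[OF X]) (auto simp: charts_at_iff)
  have "N X Y p = N (\<lambda>q d. \<Sum>b\<in>Basis. (X q c \<bullet> b) *\<^sub>R coord_field A c b q d) Y p"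
    by (rule N_cong[OF W(1) X vector_field_sum[where g = "\<lambda>b q. X q c \<bullet> b" and E = "coord_field A c", OF W(1,2) Y finite_Basis s c] Y Y eq refl W(2)])
  then show ?thesis
    unfolding N_sum_left[where g = "\<lambda>b q. X q c \<bullet> b" and E = "coord_field A c", OF W(1,2) Y finite_Basis s c] .
qed

lemma N_expansion_right:
  assumes W: "manifold_open A W" "p \<in> W" "W \<subseteq> chart_dom c" "c \<in> A" and X: "vector_field A W X" and Y: "vector_field A W Y"
  shows "N X Y p = (\<lambda>d. \<Sum>b\<in>Basis. dir_deriv A (\<lambda>q. Y q c \<bullet> b) p (X p) *\<^sub>R coord_field A c b p d
    + (Y p c \<bullet> b) *\<^sub>R N X (coord_field A c b) p d)"
proof -
  note c = coord_field_vector_field[OF W(1,3,4)]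
  note s = component_smooth[OF W(1,3,4) Y]
  have eq: "Y q = (\<lambda>d. \<Sum>b\<in>Basis. (Y q c \<bullet> b) *\<^sub>R coord_field A c b q d)" if "q \<in> W" for q
    using that W by (intro tangent_expansion vector_field_tangent[OF Y]) (auto simp: charts_at_iff)
  have "N X Y p = N X (\<lambda>q d. \<Sum>b\<in>Basis. (Y q c \<bullet> b) *\<^sub>R coord_field A c b q d) p"
    by (rule N_cong[OF W(1) X X Y vector_field_sum[where g = "\<lambda>b q. Y q c \<bullet> b" and E = "coord_field A c", OF W(1,2) X finite_Basis s c] refl eq W(2)])
  then show ?thesis
    unfolding N_sum_right[where g = "\<lambda>b q. Y q c \<bullet> b" and E = "coord_field A c", OF W(1,2) X finite_Basis s c] .
qed

lemma Gam_expansion_left: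
  assumes "c \<in> charts_at A p"
  shows "Gam c p a b = (\<Sum>i\<in>Basis. (a \<bullet> i) *\<^sub>R Gam c p i b)"
proof -
  have c: "c \<in> A" "p \<in> chart_dom c" using assms by (auto simp: charts_at_iff)
  note W = manifold_open_dom[OF c(1)]
  show ?thesis
    using N_pointwise_left[OF W c(2) _ c(1) coord_field_vector_field[OF W _ c(1)] coord_field_vector_field[OF W _ c(1)],
        of a b] coord_field_same[OF assms] by (simp add: Christoffel_def)
qed

text \<open>The components of a coordinate field are constant, so the derivative terms of the
  Leibniz rule vanish.\<close>

lemma Gam_expansion_right:
  assumes "c \<in> charts_at A p"
  shows "Gam c p a b = (\<Sum>i\<in>Basis. (b \<bullet> i) *\<^sub>R Gam c p a i)"
proof -
  have c: "c \<in> A" "p \<in> chart_dom c" using assms by (auto simp: charts_at_iff)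
  note W = manifold_open_dom[OF c(1)]
  have 0: "dir_deriv A (\<lambda>q. coord_field A c b q c \<bullet> i) p v = 0" for i v
  proof -
    have "dir_deriv A (\<lambda>q. coord_field A c b q c \<bullet> i) p v = dir_deriv A (\<lambda>q. b \<bullet> i) p v"
      by (rule dir_deriv_cong[OF W c(2)]) (use c in \<open>auto simp: coord_field_same charts_at_iff\<close>)
    then show ?thesis by simp
  qed
  show ?thesis
    using N_expansion_right[OF W c(2) _ c(1) coord_field_vector_field[OF W _ c(1)] coord_field_vector_field[OF W _ c(1)],
        of a b] coord_field_same[OF assms] by (simp add: Christoffel_def 0)
qed

lemma linear_inner_sum: "linear (\<lambda>a. \<Sum>i\<in>Basis. (a \<bullet> i) *\<^sub>R G i)"
  by (auto intro!: linearI simp: inner_add_left scaleR_add_left sum.distrib scaleR_sum_right)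

lemma linear_Gam_left: "c \<in> charts_at A p \<Longrightarrow> linear (\<lambda>a. Gam c p a b)"
  using linear_inner_sum[of "\<lambda>i. Gam c p i b"] by (simp add: Gam_expansion_left[of c p _ b, symmetric])

text \<open>Expanding \<open>Y\<close> in coordinate fields brings in the Leibniz rule, whence the
  derivative of the components; expanding \<open>X\<close> is linear over functions and only
  contributes to the symbol.\<close>

lemma N_chart:
  assumes W: "manifold_open A W" "p \<in> W" and X: "vector_field A W X" and Y: "vector_field A W Y"
    and cp: "c \<in> charts_at A p"
  shows "N X Y p c = fd (\<lambda>y. Y (chart_inv c y) c) (chart_map c p) (X p c) + Gam c p (X p c) (Y p c)"
proof -
  have c: "c \<in> A" "p \<in> chart_dom c" using cp by (auto simp: charts_at_iff)
  \<comment> \<open>The coordinate fields live on this smaller set. \<open>X\<close> and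
    \<open>Y\<close> are fields there too, and \<open>N X Y p\<close> is the same term for both
    sets.\<close>
  let ?V = "W \<inter> chart_dom c"
  have V: "manifold_open A ?V" "p \<in> ?V" "?V \<subseteq> chart_dom c"
    using manifold_open_Int[OF W(1) manifold_open_dom[OF c(1)]] W c by auto
  have XV: "vector_field A ?V X" and YV: "vector_field A ?V Y"
    using X Y vector_field_mono by auto
  note cf = coord_field_vector_field[OF V(1,3) c(1)]
  note Xp = vector_field_tangent[OF X W(2)]
  note dY = vector_field_differentiable[OF Y cp W(2)]
  have dd: "dir_deriv A (\<lambda>q. Y q c \<bullet> b) p (X p) = fd (\<lambda>y. Y (chart_inv c y) c) (chart_map c p) (X p c) \<bullet> b" for b
    using dir_deriv_chart[OF cp Xp smooth_fun_differentiable[OF component_smooth[OF V(1,3) c(1) YV] cp V(2)], of b]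
      fd_linear_comp[OF bounded_linear_inner_left dY] by simp
  have "N X (coord_field A c b) p c = Gam c p (X p c) b" for b
    using N_pointwise_left[OF V c(1) XV cf, of b] Gam_expansion_left[OF cp, of "X p c" b] by (simp add: Christoffel_def)
  then show ?thesis
    using N_expansion_right[OF V c(1) XV YV] coord_field_same[OF cp] Gam_expansion_right[OF cp, of "X p c" "Y p c"]
    by (simp add: dd sum.distrib euclidean_representation)
qed

section \<open>The connector\<close>

interpretation T: atlas "tangent_atlas A"
  by (rule atlas_tangent_atlas)

text \<open>The witness is the classical w + Gamma(v, u), evaluated in one chosen chart at the base
  point and turned into a tangent vector by \<open>coord_field\<close>, so that no charts have to be
  compared. Its linearity is that of the symbol in the first argument.\<close>

lemma connector_exists: "\<exists>K. is_connector A N K"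
proof -
  define K where "K u \<xi> = (let p = fst u; c = some_chart_at A p in
    coord_field A c (snd (\<xi> (tangent_chart A c)) + Gam c p (fst (\<xi> (tangent_chart A c))) (snd u c)) p)"
    for u \<xi>
  have "is_connector A N K"
    unfolding is_connector_def
  proof (intro conjI ballI allI impI)
    fix u \<xi> assume u: "u \<in> tangent_bundle A"
    define c where "c = some_chart_at A (fst u)"
    have c: "c \<in> charts_at A (fst u)"
      using u some_chart_at by (simp add: c_def mem_tangent_bundle)
    note lin = linear_Gam_left[OF c]
    show "K u \<xi> \<in> tangent_space A (fst u)"
      using coord_field_tangent[OF c] by (simp add: K_def Let_def c_def[symmetric])
    show "K u (tadd \<xi> \<eta>) = tadd (K u \<xi>) (K u \<eta>)" for \<eta>
      by (simp add: K_def Let_def c_def[symmetric] coord_field_add[OF c, symmetric] linear_add[OF lin] add_ac)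
    show "K u (tscale r \<xi>) = tscale r (K u \<xi>)" for r
      by (simp add: K_def Let_def c_def[symmetric] coord_field_scaleR[OF c, symmetric] linear_scale[OF lin]
          scaleR_add_right)
  next
    fix W X Y p
    assume "manifold_open A W \<and> vector_field A W X \<and> vector_field A W Y" and p: "p \<in> W"
    then have W: "manifold_open A W" and X: "vector_field A W X" and Y: "vector_field A W Y" by auto
    define c where "c = some_chart_at A p"
    have c: "c \<in> charts_at A p"
      using W p some_chart_at by (auto simp: c_def manifold_open_def)
    show "N X Y p = K (p, Y p) (pushforward A (tangent_atlas A) (\<lambda>q. (q, Y q)) p (X p))"
      using coord_field_tangent[OF c] coord_field_same[OF c] N_chart[OF W p X Y c]
        section_push_chart[OF W Y p vector_field_tangent[OF X p] c] N_tangent[OF W X Y p]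
      by (intro tangent_eqI[OF _ _ c]) (simp_all add: K_def Let_def c_def[symmetric])
  qed
  then show ?thesis by blast
qed

lemma is_connector_connector: "is_connector A N (connector A N)"
  unfolding connector_def by (rule someI_ex[OF connector_exists])

lemmas connector_at = is_connector_connector[unfolded is_connector_def, THEN conjunct1, THEN bspec, THEN bspec]

lemma connector_tangent:
  "u \<in> tangent_bundle A \<Longrightarrow> \<xi> \<in> tangent_space (tangent_atlas A) u \<Longrightarrow> connector A N u \<xi> \<in> tangent_space A (fst u)"
  by (rule connector_at[THEN conjunct1])

lemma connector_tadd:
  "u \<in> tangent_bundle A \<Longrightarrow> \<xi> \<in> tangent_space (tangent_atlas A) u \<Longrightarrow> \<eta> \<in> tangent_space (tangent_atlas A) u \<Longrightarrow>
    connector A N u (tadd \<xi> \<eta>) = tadd (connector A N u \<xi>) (connector A N u \<eta>)"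
  by (rule connector_at[THEN conjunct2, THEN conjunct1, THEN bspec])

lemma connector_section:
  "manifold_open A W \<Longrightarrow> vector_field A W X \<Longrightarrow> vector_field A W Y \<Longrightarrow> p \<in> W \<Longrightarrow>
    connector A N (p, Y p) (pushforward A (tangent_atlas A) (\<lambda>q. (q, Y q)) p (X p)) = N X Y p"
  by (rule is_connector_connector[unfolded is_connector_def, THEN conjunct2, THEN spec, THEN spec, THEN spec,
        THEN mp, THEN bspec, symmetric]) simp_all

text \<open>
  A non-vertical vector is the image of a tangent vector under an affine section, which determines
  the connector there; a vertical vector is a difference of two non-vertical ones.
\<close>

lemma connector_chart:
  assumes u: "u \<in> tangent_bundle A" and xi: "\<xi> \<in> tangent_space (tangent_atlas A) u" and c: "c \<in> charts_at A (fst u)"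
  shows "connector A N u \<xi> c = snd (\<xi> (tangent_chart A c)) + Gam c (fst u) (fst (\<xi> (tangent_chart A c))) (snd u c)"
proof -
  define p where "p = fst u"
  have cA: "c \<in> A" "p \<in> chart_dom c" and cp: "c \<in> charts_at A p" using c by (auto simp: charts_at_iff p_def)
  note W = manifold_open_dom[OF cA(1)]
  note tc = tangent_chart_charts_at[OF u c]
  have nonvertical: "connector A N u \<eta> c = snd (\<eta> (tangent_chart A c)) + Gam c p (fst (\<eta> (tangent_chart A c))) (snd u c)"
    if eta: "\<eta> \<in> tangent_space (tangent_atlas A) u" and "fst (\<eta> (tangent_chart A c)) \<noteq> 0" for \<eta>
  proof -
    define a where "a = fst (\<eta> (tangent_chart A c))"
    define b where "b = snd (\<eta> (tangent_chart A c))"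
    have "a \<noteq> 0" using that by (simp add: a_def)
    \<comment> \<open>At \<open>p\<close> the value is the fibre coordinate of \<open>u\<close>, and
      the derivative in direction \<open>a\<close> is \<open>b\<close>; the quotient is where
      \<open>a\<close> nonzero enters.\<close>
    define F where "F y = snd u c + (((y - chart_map c p) \<bullet> a) / (a \<bullet> a)) *\<^sub>R b" for y
    define X where "X = coord_field A c a"
    define Y where "Y q = coord_field A c (F (chart_map c q)) q" for q
    have F_alt: "F = (\<lambda>y. (snd u c - ((chart_map c p \<bullet> a) / (a \<bullet> a)) *\<^sub>R b) + ((y \<bullet> a) / (a \<bullet> a)) *\<^sub>R b)"
      by (simp add: F_def fun_eq_iff inner_diff_left diff_divide_distrib scaleR_diff_left)
    have L: "bounded_linear (\<lambda>y. ((y \<bullet> a) / (a \<bullet> a)) *\<^sub>R b)"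
      unfolding linear_conv_bounded_linear[symmetric]
      by (rule linearI) (simp_all add: inner_add_left add_divide_distrib scaleR_add_left)
    have FS: "smooth_on (img c (chart_dom c)) F"
      unfolding F_alt
      by (rule smooth_on_add[OF _ smooth_on_const smooth_on_linear[OF L]]) (rule open_img_dom[OF cA(1) cA(1)])+
    have X: "vector_field A (chart_dom c) X"
      unfolding X_def by (rule coord_field_vector_field[OF W _ cA(1)]) simp
    have Y: "vector_field A (chart_dom c) Y"
      unfolding Y_def by (rule coord_field_comp_vector_field[OF W _ cA(1) FS]) simp
    have Xp: "X p c = a" by (simp add: X_def coord_field_same[OF cp])
    have Yp: "Y p = snd u"
      using coord_field_coords[OF _ cp, of "snd u"] u by (simp add: Y_def F_def mem_tangent_bundle p_def)
    have "(F has_derivative (\<lambda>v. ((v \<bullet> a) / (a \<bullet> a)) *\<^sub>R b)) (at (chart_map c p))"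
      unfolding F_alt using has_derivative_add[OF has_derivative_const bounded_linear_imp_has_derivative[OF L]] by simp
    then have "((\<lambda>y. Y (chart_inv c y) c) has_derivative (\<lambda>v. ((v \<bullet> a) / (a \<bullet> a)) *\<^sub>R b)) (at (chart_map c p))"
      by (rule has_derivative_transform_within_open[of _ _ _ _ "img c (chart_dom c)"])
        (use cA open_img_dom[of c c] in \<open>auto simp: Y_def coord_field_same charts_at_iff\<close>)
    from fd_eqI[OF this] have dY: "fd (\<lambda>y. Y (chart_inv c y) c) (chart_map c p) a = b"
      using \<open>a \<noteq> 0\<close> by simp
    have u_eq: "u = (p, Y p)" unfolding Yp by (simp add: p_def)
    note Xt = vector_field_tangent[OF X cA(2)]
    have "pushforward A (tangent_atlas A) (\<lambda>q. (q, Y q)) p (X p) = \<eta>"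
    proof (rule T.tangent_eqI[of _ u _ "tangent_chart A c"])
      show "pushforward A (tangent_atlas A) (\<lambda>q. (q, Y q)) p (X p) \<in> tangent_space (tangent_atlas A) u"
        unfolding u_eq by (rule section_push_tangent[OF W Y cA(2) Xt])
      show "pushforward A (tangent_atlas A) (\<lambda>q. (q, Y q)) p (X p) (tangent_chart A c) = \<eta> (tangent_chart A c)"
        unfolding section_push_chart[OF W Y cA(2) Xt cp] Xp dY by (simp add: a_def b_def)
    qed (use eta tc in auto)
    then show ?thesis
      using connector_section[OF W X Y cA(2)] N_chart[OF W cA(2) X Y cp]
      unfolding u_eq[symmetric] Xp dY unfolding Yp a_def b_def by simp
  qed
  show ?thesis
  proof (cases "fst (\<xi> (tangent_chart A c)) = 0")
    case False
    then show ?thesis using nonvertical[OF xi] by (simp add: p_def)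
  next
    case True
    obtain a :: 'e where "a \<noteq> 0" using nonempty_Basis nonzero_Basis by blast
    define \<eta> where "\<eta> = coord_field (tangent_atlas A) (tangent_chart A c) (a, 0) u"
    have eta: "\<eta> \<in> tangent_space (tangent_atlas A) u" "\<eta> (tangent_chart A c) = (a, 0)"
      using T.coord_field_tangent[OF tc] T.coord_field_same[OF tc] by (simp_all add: \<eta>_def)
    have "connector A N u (tadd \<xi> \<eta>) c = snd (\<xi> (tangent_chart A c)) + Gam c p a (snd u c)"
      using nonvertical[OF T.tangent_tadd[OF xi eta(1)]] True \<open>a \<noteq> 0\<close> by (simp add: eta)
    moreover have "connector A N u \<eta> c = Gam c p a (snd u c)"
      using nonvertical[OF eta(1)] \<open>a \<noteq> 0\<close> by (simp add: eta)
    ultimately show ?thesis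
      using connector_tadd[OF u xi eta(1)] True linear_0[OF linear_Gam_left[OF c]] by simp
  qed
qed

end

section \<open>Riemannian metrics and dual connections\<close>

lemma bilinear_Basis_expansion:
  fixes B :: "'e::euclidean_space \<Rightarrow> 'e \<Rightarrow> real"
  assumes "\<And>b. linear (\<lambda>a. B a b)" "\<And>a. linear (B a)"
  shows "B a b = (\<Sum>i\<in>Basis. \<Sum>j\<in>Basis. (a \<bullet> i) * ((b \<bullet> j) * B i j))"
proof -
  have "B a b = (\<Sum>i\<in>Basis. (a \<bullet> i) * B i b)"
    using linear_Basis_expansion[OF assms(1)[of b], of a] by simp
  also have "\<dots> = (\<Sum>i\<in>Basis. (a \<bullet> i) * (\<Sum>j\<in>Basis. (b \<bullet> j) * B i j))"
  proof (rule sum.cong[OF refl])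
    show "a \<bullet> i * B i b = a \<bullet> i * (\<Sum>j\<in>Basis. b \<bullet> j * B i j)" for i
      using linear_Basis_expansion[OF assms(2)[of i], of b] by simp
  qed
  finally show ?thesis by (simp add: sum_distrib_left)
qed

text \<open>\<open>B\<close> is differentiable for fixed arguments only; bilinearity in finite
  dimension reduces the three-term product rule to the entries \<open>B y i j\<close>. The metric in
  a chart will be such a \<open>B\<close>.\<close>

lemma has_derivative_bilinear_family:
  fixes B :: "'y::real_normed_vector \<Rightarrow> 'e::euclidean_space \<Rightarrow> 'e \<Rightarrow> real"
  assumes S: "open S" "k z \<in> S"
    and lin: "\<And>y b. y \<in> S \<Longrightarrow> linear (\<lambda>a. B y a b)" "\<And>y a. y \<in> S \<Longrightarrow> linear (B y a)"
    and diff: "\<And>a b. (\<lambda>y. B y a b) differentiable at (k z)"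
    and k: "(k has_derivative k') (at z)" and f: "(f has_derivative f') (at z)" and g: "(g has_derivative g') (at z)"
  shows "((\<lambda>z. B (k z) (f z) (g z)) has_derivative
    (\<lambda>v. fd (\<lambda>y. B y (f z) (g z)) (k z) (k' v) + B (k z) (f' v) (g z) + B (k z) (f z) (g' v))) (at z)"
proof -
  have B: "B y a b = (\<Sum>i\<in>Basis. \<Sum>j\<in>Basis. (a \<bullet> i) * ((b \<bullet> j) * B y i j))" if "y \<in> S" for y a b
    using bilinear_Basis_expansion[OF lin[OF that]] .
  have D: "((\<lambda>z. \<Sum>i\<in>Basis. \<Sum>j\<in>Basis. (f z \<bullet> i) * ((g z \<bullet> j) * B (k z) i j)) has_derivative
    (\<lambda>v. \<Sum>i\<in>Basis. \<Sum>j\<in>Basis. (f z \<bullet> i) * ((g z \<bullet> j) * fd (\<lambda>y. B y i j) (k z) (k' v) + (g' v \<bullet> j) * B (k z) i j) +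
      (f' v \<bullet> i) * ((g z \<bullet> j) * B (k z) i j))) (at z)"
    by (intro has_derivative_sum has_derivative_mult has_derivative_inner_left f g
        has_derivative_compose[OF k has_derivative_fd[OF diff]])
  obtain T where T: "open T" "z \<in> T" "\<And>x. x \<in> T \<Longrightarrow> k x \<in> S"
    using topological_tendstoD[OF has_derivative_continuous[OF k, unfolded continuous_within] S]
      S(2) unfolding eventually_at_topological by (metis UNIV_I)
  have D1: "((\<lambda>z. B (k z) (f z) (g z)) has_derivative
    (\<lambda>v. \<Sum>i\<in>Basis. \<Sum>j\<in>Basis. (f z \<bullet> i) * ((g z \<bullet> j) * fd (\<lambda>y. B y i j) (k z) (k' v) + (g' v \<bullet> j) * B (k z) i j) +
      (f' v \<bullet> i) * ((g z \<bullet> j) * B (k z) i j))) (at z)"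
    by (rule has_derivative_transform_within_open[OF D T(1,2)]) (rule B[OF T(3), symmetric])
  have fdB: "fd (\<lambda>y. B y a b) (k z) w = (\<Sum>i\<in>Basis. \<Sum>j\<in>Basis. (a \<bullet> i) * ((b \<bullet> j) * fd (\<lambda>y. B y i j) (k z) w))"
    for a b w
  proof -
    have D: "((\<lambda>y. \<Sum>i\<in>Basis. \<Sum>j\<in>Basis. (a \<bullet> i) * ((b \<bullet> j) * B y i j)) has_derivative
      (\<lambda>w. \<Sum>i\<in>Basis. \<Sum>j\<in>Basis. (a \<bullet> i) * ((b \<bullet> j) * fd (\<lambda>y. B y i j) (k z) w))) (at (k z))"
      by (intro has_derivative_sum has_derivative_mult_right has_derivative_fd diff)
    have "((\<lambda>y. B y a b) has_derivative
      (\<lambda>w. \<Sum>i\<in>Basis. \<Sum>j\<in>Basis. (a \<bullet> i) * ((b \<bullet> j) * fd (\<lambda>y. B y i j) (k z) w))) (at (k z))"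
      by (rule has_derivative_transform_within_open[OF D S]) (rule B[symmetric])
    from fd_eqI[OF this] show ?thesis by simp
  qed
  have "fd (\<lambda>y. B y (f z) (g z)) (k z) (k' v) + B (k z) (f' v) (g z) + B (k z) (f z) (g' v) =
    (\<Sum>i\<in>Basis. \<Sum>j\<in>Basis. (f z \<bullet> i) * ((g z \<bullet> j) * fd (\<lambda>y. B y i j) (k z) (k' v) + (g' v \<bullet> j) * B (k z) i j) +
      (f' v \<bullet> i) * ((g z \<bullet> j) * B (k z) i j))" for v
    unfolding fdB[of "f z" "g z" "k' v"] B[OF S(2), of "f' v" "g z"] B[OF S(2), of "f z" "g' v"] sum.distrib[symmetric]
    by (intro sum.cong refl) (simp add: algebra_simps)
  then show ?thesis using D1 by presburger
qed

section \<open>The metric in a chart\<close>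

locale riemannian = atlas A for A :: "('a, 'e::euclidean_space) chart set" +
  fixes h :: "('a, 'e) bilin_field"
  assumes metric: "riemannian_metric A h"
begin

lemma h_sym: "p \<in> points A \<Longrightarrow> v \<in> tangent_space A p \<Longrightarrow> w \<in> tangent_space A p \<Longrightarrow> h p v w = h p w v"
  using metric unfolding riemannian_metric_def by simp

lemma h_add_left:
  "p \<in> points A \<Longrightarrow> v \<in> tangent_space A p \<Longrightarrow> v' \<in> tangent_space A p \<Longrightarrow> w \<in> tangent_space A p \<Longrightarrow>
    h p (tadd v v') w = h p v w + h p v' w"
  using metric unfolding riemannian_metric_def by simp

lemma h_scale_left:
  "p \<in> points A \<Longrightarrow> v \<in> tangent_space A p \<Longrightarrow> w \<in> tangent_space A p \<Longrightarrow> h p (tscale r v) w = r * h p v w"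
  using metric unfolding riemannian_metric_def by simp

lemma h_pos: "p \<in> points A \<Longrightarrow> v \<in> tangent_space A p \<Longrightarrow> v \<noteq> tzero \<Longrightarrow> h p v v > 0"
  using metric unfolding riemannian_metric_def by simp

lemma h_smooth:
  "manifold_open A W \<Longrightarrow> vector_field A W X \<Longrightarrow> vector_field A W Y \<Longrightarrow> smooth_fun_on A W (\<lambda>p. h p (X p) (Y p))"
  using metric unfolding riemannian_metric_def by simp

definition G :: "('a, 'e) chart \<Rightarrow> 'a \<Rightarrow> 'e \<Rightarrow> 'e \<Rightarrow> real" where
  "G c p a b = h p (coord_field A c a p) (coord_field A c b p)"

text \<open>These are the partial derivatives d_k h_ab of the metric coefficients, with vectors in
  place of indices; the first vector is the direction.\<close>

definition DG :: "('a, 'e) chart \<Rightarrow> 'a \<Rightarrow> 'e \<Rightarrow> 'e \<Rightarrow> 'e \<Rightarrow> real" where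
  "DG c p k a b = fd (\<lambda>y. G c (chart_inv c y) a b) (chart_map c p) k"

lemma h_chart:
  "c \<in> charts_at A p \<Longrightarrow> v \<in> tangent_space A p \<Longrightarrow> w \<in> tangent_space A p \<Longrightarrow> h p v w = G c p (v c) (w c)"
  by (simp add: G_def coord_field_coords)

lemma G_sym: "c \<in> charts_at A p \<Longrightarrow> G c p a b = G c p b a"
  unfolding G_def by (rule h_sym[OF points_charts_at coord_field_tangent coord_field_tangent])

lemma linear_G_left:
  assumes c: "c \<in> charts_at A p"
  shows "linear (\<lambda>a. G c p a b)"
proof (rule linearI)
  note t = coord_field_tangent[OF c]
  show "G c p (x + y) b = G c p x b + G c p y b" for x y
    unfolding G_def coord_field_add[OF c] by (rule h_add_left[OF points_charts_at[OF c] t t t])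
  show "G c p (r *\<^sub>R x) b = r *\<^sub>R G c p x b" for r x
    unfolding G_def coord_field_scaleR[OF c] real_scaleR_def by (rule h_scale_left[OF points_charts_at[OF c] t t])
qed

lemma linear_G_right:
  assumes c: "c \<in> charts_at A p"
  shows "linear (G c p a)"
proof -
  have "G c p a = (\<lambda>b. G c p b a)" by (rule ext) (rule G_sym[OF c])
  then show ?thesis using linear_G_left[OF c, of a] by simp
qed

lemma G_pos:
  assumes c: "c \<in> charts_at A p" and "a \<noteq> 0"
  shows "G c p a a > 0"
  unfolding G_def
proof (rule h_pos[OF points_charts_at[OF c] coord_field_tangent[OF c]])
  show "coord_field A c a p \<noteq> tzero"
    using coord_field_same[OF c, of a] assms(2) by auto
qed

lemma G_nondegenerate:
  assumes c: "c \<in> charts_at A p" and "\<And>e. G c p a e = G c p b e"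
  shows "a = b"
proof (rule ccontr)
  assume "a \<noteq> b"
  then have "G c p (a - b) (a - b) > 0" using G_pos[OF c] by simp
  then show False using assms(2)[of "a - b"] by (simp add: linear_diff[OF linear_G_left[OF c]])
qed

lemma G_smooth:
  assumes "c \<in> A"
  shows "smooth_fun_on A (chart_dom c) (\<lambda>q. G c q a b)"
  unfolding G_def
  by (intro h_smooth manifold_open_dom coord_field_vector_field assms order_refl)

lemma G_differentiable:
  "c \<in> charts_at A p \<Longrightarrow> (\<lambda>y. G c (chart_inv c y) a b) differentiable at (chart_map c p)"
  using smooth_fun_differentiable[OF G_smooth] by (simp add: charts_at_iff)

lemma has_derivative_G:
  assumes c: "c \<in> charts_at A p" and kz: "k z = chart_map c p"
    and k: "(k has_derivative k') (at z)" and f: "(f has_derivative f') (at z)" and g: "(g has_derivative g') (at z)"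
  shows "((\<lambda>z. G c (chart_inv c (k z)) (f z) (g z)) has_derivative
    (\<lambda>v. DG c p (k' v) (f z) (g z) + G c p (f' v) (g z) + G c p (f z) (g' v))) (at z)"
proof -
  have cA: "c \<in> A" "p \<in> chart_dom c" using c by (auto simp: charts_at_iff)
  have at: "c \<in> charts_at A (chart_inv c y)" if "y \<in> img c (chart_dom c)" for y
    using img_inv[OF cA(1) that] cA by (simp add: charts_at_iff)
  show ?thesis
    using has_derivative_bilinear_family[where B = "\<lambda>y. G c (chart_inv c y)",
        OF open_img_dom[OF cA(1) cA(1)] _ linear_G_left[OF at] linear_G_right[OF at] _ k f g]
      G_differentiable[OF c] kz cA
    by (simp add: DG_def)
qed

lemma DG_sym:
  assumes "c \<in> charts_at A p"
  shows "DG c p k a b = DG c p k b a"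
proof -
  have cA: "c \<in> A" "p \<in> chart_dom c" using assms by (auto simp: charts_at_iff)
  show ?thesis
    unfolding DG_def
    by (rule arg_cong[where f = "\<lambda>F. F k"], rule fd_cong_open[OF open_img_dom[OF cA(1) cA(1)]])
      (use cA in \<open>auto intro!: G_sym simp: charts_at_iff\<close>)
qed

lemma linear_DG: "c \<in> charts_at A p \<Longrightarrow> linear (\<lambda>k. DG c p k a b)"
  unfolding DG_def by (rule linear_frechet_derivative[OF G_differentiable])

text \<open>This is the dual condition evaluated on coordinate fields. With \<open>N'\<close> equal
  to \<open>N\<close> it is metric compatibility, the input of the Koszul formula.\<close>

lemma dual_chart:
  assumes N: "connection A N" "connection A N'" and dual: "dual_condition A h N N'" and c: "c \<in> charts_at A p"
  shows "DG c p k a b = G c p (Christoffel A N c p k a) b + G c p a (Christoffel A N' c p k b)"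
proof -
  have cA: "c \<in> A" "p \<in> chart_dom c" using c by (auto simp: charts_at_iff)
  note W = manifold_open_dom[OF cA(1)]
  note vf = coord_field_vector_field[OF W order_refl cA(1)]
  have "dir_deriv A (\<lambda>q. G c q a b) p (coord_field A c k p) =
    h p (N (coord_field A c k) (coord_field A c a) p) (coord_field A c b p) +
    h p (coord_field A c a p) (N' (coord_field A c k) (coord_field A c b) p)"
    using dual W vf cA(2) unfolding dual_condition_def G_def by blast
  moreover have "dir_deriv A (\<lambda>q. G c q a b) p (coord_field A c k p) = DG c p k a b"
    using dir_deriv_chart[OF c coord_field_tangent[OF c] G_differentiable[OF c]]
    by (simp add: DG_def coord_field_same[OF c])
  ultimately show ?thesis
    using h_chart[OF c connection.N_tangent[OF N(1) W vf vf cA(2)] coord_field_tangent[OF c]]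
      h_chart[OF c coord_field_tangent[OF c] connection.N_tangent[OF N(2) W vf vf cA(2)]]
    by (simp add: Christoffel_def coord_field_same[OF c])
qed

end

text \<open>Coordinate fields have constant components, so their bracket vanishes and torsion
  becomes the antisymmetric part of the symbols.\<close>

lemma (in connection) Christoffel_sym:
  assumes tf: "torsion_free A N" and c: "c \<in> charts_at A p"
  shows "Gam c p a b = Gam c p b a"
proof -
  have cA: "c \<in> A" "p \<in> chart_dom c" using c by (auto simp: charts_at_iff)
  note W = manifold_open_dom[OF cA(1)]
  note vf = coord_field_vector_field[OF W order_refl cA(1)]
  let ?X = "coord_field A c a" and ?Y = "coord_field A c b"
  have const: "fd (\<lambda>y. coord_field A c e (chart_inv c y) c) (chart_map c p) v = 0" for e v
  proof -
    have "fd (\<lambda>y. coord_field A c e (chart_inv c y) c) (chart_map c p) = fd (\<lambda>y. e) (chart_map c p)"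
      by (rule fd_cong_open[OF open_img_dom[OF cA(1) cA(1)]])
        (use cA in \<open>auto simp: coord_field_same charts_at_iff\<close>)
    then show ?thesis by simp
  qed
  have "tadd (tadd (N ?X ?Y p) (tminus (N ?Y ?X p))) (tminus (lie_bracket A ?X ?Y p)) = tzero"
    using tf W vf cA(2) unfolding torsion_free_def by blast
  from fun_cong[OF this, of c] show ?thesis
    using c by (simp add: Christoffel_def lie_bracket_def const)
qed

context riemannian
begin

text \<open>Metric compatibility expands each of the three derivatives into two terms, and symmetry
  cancels four of the six. As \<open>D\<close> is absent from the right side and \<open>G\<close> is
  nondegenerate, the symbols are the same for whichever connection \<open>levi_civita\<close>
  selects.\<close>

lemma Koszul:
  assumes D: "is_levi_civita A h D" and c: "c \<in> charts_at A p"
  shows "2 * G c p (Christoffel A D c p a b) e = DG c p a b e + DG c p b a e - DG c p e a b"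
proof -
  interpret D: connection A D
    using D by unfold_locales (simp add: is_levi_civita_def)
  have d: "DG c p k a b = G c p (Christoffel A D c p k a) b + G c p a (Christoffel A D c p k b)" for k a b
    using dual_chart[OF D.connection_axioms D.connection_axioms _ c] D by (simp add: is_levi_civita_def)
  have s: "Christoffel A D c p a b = Christoffel A D c p b a" for a b
    using D.Christoffel_sym[OF _ c] D by (simp add: is_levi_civita_def)
  show ?thesis
    using G_sym[OF c] s[of a b] s[of a e] s[of b e]
    by (simp add: d)
qed

end

section \<open>The Levi-Civita connection of a dual pair\<close>

locale dually_flat_manifold = riemannian A h + nabla: connection A N + dual: connection A N'
  for A :: "('a, 'e::euclidean_space) chart set" and h and N N' +
  assumes dual: "dual_condition A h N N'" and tf: "torsion_free A N" and tf': "torsion_free A N'"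
begin

definition mean :: "('a, 'e) covariant" where
  "mean X Y p = tscale (1/2) (tadd (N X Y p) (N' X Y p))"

text \<open>Exchanging \<open>Y\<close> and \<open>Z\<close> in the dual condition shows that
  \<open>N'\<close> and \<open>N\<close> are dual in this order too, and the average of the two
  identities is metric compatibility. The weights 1/2 add up to 1, as the Leibniz rule and the
  torsion condition require.\<close>

lemma mean_levi_civita: "is_levi_civita A h mean"
proof -
  have "affine_connection A mean"
    unfolding affine_connection_def
  proof (intro allI impI conjI ballI; (elim conjE)?)
    fix W X Y assume W: "manifold_open A W" and X: "vector_field A W X" and Y: "vector_field A W Y"
    show "vector_field A W (mean X Y)"
      unfolding mean_def[abs_def]
      by (intro vector_field_tscale[OF W smooth_fun_const] vector_field_tadd[OF W]
          nabla.vector_field_N[OF W X Y] dual.vector_field_N[OF W X Y])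
  next
    fix W X X' Y p assume "manifold_open A W" "vector_field A W X" "vector_field A W X'" "vector_field A W Y" "p \<in> W"
    note * = this
    show "mean (\<lambda>q. tadd (X q) (X' q)) Y p = tadd (mean X Y p) (mean X' Y p)"
      unfolding mean_def nabla.N_add_left[OF *] dual.N_add_left[OF *]
      by (rule ext) (simp add: algebra_simps)
  next
    fix W f X Y p assume "manifold_open A W" "smooth_fun_on A W f" "vector_field A W X" "vector_field A W Y" "p \<in> W"
    note * = this
    show "mean (\<lambda>q. tscale (f q) (X q)) Y p = tscale (f p) (mean X Y p)"
      unfolding mean_def nabla.N_scale_left[OF *] dual.N_scale_left[OF *]
      by (rule ext) (simp add: algebra_simps)
  next
    fix W X Y Y' p assume "manifold_open A W" "vector_field A W X" "vector_field A W Y" "vector_field A W Y'" "p \<in> W"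
    note * = this
    show "mean X (\<lambda>q. tadd (Y q) (Y' q)) p = tadd (mean X Y p) (mean X Y' p)"
      unfolding mean_def nabla.N_add_right[OF *] dual.N_add_right[OF *]
      by (rule ext) (simp add: algebra_simps)
  next
    fix W f X Y p assume "manifold_open A W" "smooth_fun_on A W f" "vector_field A W X" "vector_field A W Y" "p \<in> W"
    note * = this
    show "mean X (\<lambda>q. tscale (f q) (Y q)) p =
        tadd (tscale (dir_deriv A f p (X p)) (Y p)) (tscale (f p) (mean X Y p))"
      unfolding mean_def nabla.N_Leibniz[OF *] dual.N_Leibniz[OF *]
      by (rule ext) (simp add: algebra_simps flip: scaleR_add_left)
  next
    fix W X X' Y Y' p assume *: "manifold_open A W" "vector_field A W X" "vector_field A W X'"
      "vector_field A W Y" "vector_field A W Y'" "\<forall>p\<in>W. X p = X' p \<and> Y p = Y' p" "p \<in> W"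
    have eq: "\<And>q. q \<in> W \<Longrightarrow> X q = X' q" "\<And>q. q \<in> W \<Longrightarrow> Y q = Y' q" using *(6) by auto
    have "N X Y p = N X' Y' p" "N' X Y p = N' X' Y' p"
      using nabla.N_cong[OF *(1-5)] dual.N_cong[OF *(1-5)] eq *(7) by blast+
    then show "mean X Y p = mean X' Y' p"
      by (simp add: mean_def)
  qed
  moreover have "torsion_free A mean"
    unfolding torsion_free_def
  proof (intro allI impI ballI; elim conjE)
    fix W X Y p assume W: "manifold_open A W" "vector_field A W X" "vector_field A W Y" "p \<in> W"
    have 1: "tadd (tadd (N X Y p) (tminus (N Y X p))) (tminus (lie_bracket A X Y p)) = tzero"
      using tf W unfolding torsion_free_def by blast
    have 2: "tadd (tadd (N' X Y p) (tminus (N' Y X p))) (tminus (lie_bracket A X Y p)) = tzero"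
      using tf' W unfolding torsion_free_def by blast
    have "N X Y p c + N' X Y p c = N Y X p c + N' Y X p c + (lie_bracket A X Y p c + lie_bracket A X Y p c)" for c
      using fun_cong[OF 1, of c] fun_cong[OF 2, of c] by (simp add: algebra_simps)
    then show "tadd (tadd (mean X Y p) (tminus (mean Y X p))) (tminus (lie_bracket A X Y p)) = tzero"
      by (intro ext) (simp add: mean_def scaleR_add_right flip: scaleR_add_left)
  qed
  moreover have "dual_condition A h mean mean"
    unfolding dual_condition_def
  proof (intro allI impI ballI; elim conjE)
    fix W X Y Z p assume W: "manifold_open A W" and p: "p \<in> W"
      and X: "vector_field A W X" and Y: "vector_field A W Y" and Z: "vector_field A W Z"
    have pp: "q \<in> points A" if "q \<in> W" for q using W that by (auto simp: manifold_open_def)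
    note t = vector_field_tangent[OF Y] vector_field_tangent[OF Z]
    note NY = nabla.N_tangent[OF W X Y p] dual.N_tangent[OF W X Y p]
    note NZ = nabla.N_tangent[OF W X Z p] dual.N_tangent[OF W X Z p]
    have 1: "dir_deriv A (\<lambda>q. h q (Y q) (Z q)) p (X p) = h p (N X Y p) (Z p) + h p (Y p) (N' X Z p)"
      using dual W X Y Z p unfolding dual_condition_def by blast
    have 2: "dir_deriv A (\<lambda>q. h q (Z q) (Y q)) p (X p) = h p (N X Z p) (Y p) + h p (Z p) (N' X Y p)"
      using dual W X Y Z p unfolding dual_condition_def by blast
    have 3: "dir_deriv A (\<lambda>q. h q (Y q) (Z q)) p (X p) = dir_deriv A (\<lambda>q. h q (Z q) (Y q)) p (X p)"
      by (rule dir_deriv_cong[OF W p]) (rule h_sym[OF pp t])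
    have 4: "h p (mean X Y p) (Z p) = (1/2) * (h p (N X Y p) (Z p) + h p (N' X Y p) (Z p))"
      unfolding mean_def
      by (simp only: h_scale_left[OF pp[OF p] tangent_tadd[OF NY] t(2)[OF p]] h_add_left[OF pp[OF p] NY t(2)[OF p]])
    have m: "mean X Z p \<in> tangent_space A p"
      unfolding mean_def by (intro tangent_tscale tangent_tadd NZ)
    have 5: "h p (Y p) (mean X Z p) = (1/2) * (h p (N X Z p) (Y p) + h p (N' X Z p) (Y p))"
      unfolding h_sym[OF pp[OF p] t(1)[OF p] m]
      unfolding mean_def
      by (simp only: h_scale_left[OF pp[OF p] tangent_tadd[OF NZ] t(1)[OF p]] h_add_left[OF pp[OF p] NZ t(1)[OF p]])
    show "dir_deriv A (\<lambda>q. h q (Y q) (Z q)) p (X p) = h p (mean X Y p) (Z p) + h p (Y p) (mean X Z p)"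
      using 1 2 3 4 5 h_sym[OF pp[OF p] t(1)[OF p] NZ(2)] h_sym[OF pp[OF p] t(2)[OF p] NY(2)] by simp
  qed
  ultimately show ?thesis by (simp add: is_levi_civita_def)
qed

lemma is_levi_civita_levi_civita: "is_levi_civita A h (levi_civita A h)"
  unfolding levi_civita_def using someI[of "is_levi_civita A h"] mean_levi_civita by blast

text \<open>With the symbols of \<open>N\<close> zero, duality leaves
  \<open>DG c p k a b = G c p a (Christoffel A N' c p k b)\<close>, which is symmetric in
  \<open>k\<close> and \<open>b\<close> since \<open>N'\<close> has no torsion. Together with
  \<open>DG_sym\<close> this generates all permutations of the three arguments.\<close>

lemma DG_totally_symmetric:
  assumes c: "c \<in> charts_at A p" and flat: "\<And>a b. Christoffel A N c p a b = 0"
  shows "DG c p a b e = DG c p e b a"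
proof -
  have "DG c p k a b = G c p a (Christoffel A N' c p k b)" for k a b
    using dual_chart[OF nabla.connection_axioms dual.connection_axioms dual c] linear_0[OF linear_G_left[OF c]]
    by (simp add: flat)
  then show ?thesis
    using dual.Christoffel_sym[OF tf' c] by simp
qed

text \<open>By total symmetry the three derivatives in the Koszul formula are equal, so two of them
  cancel.\<close>

lemma Levi_Civita_affine_chart:
  assumes c: "c \<in> charts_at A p" and flat: "\<And>a b. Christoffel A N c p a b = 0"
  shows "2 * G c p (Christoffel A (levi_civita A h) c p a b) e = DG c p e a b"
  using Koszul[OF is_levi_civita_levi_civita c, of a b e] DG_totally_symmetric[OF c flat, of a b e]
    DG_totally_symmetric[OF c flat, of b a e] DG_sym[OF c] by simp

end

section \<open>Differentiable solutions of linear systems\<close>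

lemma differentiable_det:
  fixes M :: "'y::real_normed_vector \<Rightarrow> real^'n^'n"
  assumes "\<And>i j. (\<lambda>y. M y $ i $ j) differentiable at y0"
  shows "(\<lambda>y. det (M y)) differentiable at y0"
proof -
  have "(\<lambda>y. \<Sum>p\<in>{p. p permutes UNIV}. of_int (sign p) * (\<Prod>i\<in>UNIV. M y $ i $ p i)) differentiable at y0"
  proof (intro differentiable_sum differentiable_mult differentiable_const ballI)
    show "(\<lambda>y. \<Prod>i\<in>UNIV. M y $ i $ p i) differentiable at y0" for p
      using has_derivative_prod[where I = UNIV and f = "\<lambda>i y. M y $ i $ p i", OF has_derivative_fd[OF assms]]
      by (auto simp: differentiable_def)
  qed auto
  then show ?thesis by (simp add: det_def)
qed

lemma differentiable_vec_lambda:
  fixes g :: "'n::finite \<Rightarrow> 'y::real_normed_vector \<Rightarrow> real"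
  assumes "\<And>k. g k differentiable at y"
  shows "(\<lambda>y. \<chi> k. g k y) differentiable at y"
proof -
  have "(\<lambda>y. \<Sum>k\<in>UNIV. g k y *\<^sub>R (axis k 1 :: real^'n)) differentiable at y"
    by (intro differentiable_sum differentiable_scaleR differentiable_const ballI assms) simp
  moreover have "(\<Sum>k\<in>UNIV. g k y *\<^sub>R axis k 1) = (\<chi> k. g k y)" for y
    using basis_expansion[of "\<chi> k. g k y"] by (simp add: scalar_mult_eq_scaleR)
  ultimately show ?thesis by simp
qed

text \<open>The solution of the linear system is given by Cramer's rule, hence is differentiable.\<close>

lemma differentiable_solution:
  fixes B :: "'y::real_normed_vector \<Rightarrow> real^'n \<Rightarrow> real^'n \<Rightarrow> real" and r :: "'y \<Rightarrow> real^'n \<Rightarrow> real"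
  assumes S: "open S"
    and lin: "\<And>y b. y \<in> S \<Longrightarrow> linear (\<lambda>a. B y a b)" "\<And>y a. y \<in> S \<Longrightarrow> linear (B y a)" "\<And>y. y \<in> S \<Longrightarrow> linear (r y)"
    and pos: "\<And>y a. y \<in> S \<Longrightarrow> a \<noteq> 0 \<Longrightarrow> B y a a > 0"
    and diff: "\<And>y a b. y \<in> S \<Longrightarrow> (\<lambda>y. B y a b) differentiable at y" "\<And>y a. y \<in> S \<Longrightarrow> (\<lambda>y. r y a) differentiable at y"
  shows "\<exists>a. \<forall>y\<in>S. (\<forall>e. B y (a y) e = r y e) \<and> a differentiable at y"
proof -
  define M :: "'y \<Rightarrow> real^'n^'n" where "M y = (\<chi> j k. B y (axis k 1) (axis j 1))" for y
  define v :: "'y \<Rightarrow> real^'n" where "v y = (\<chi> j. r y (axis j 1))" for y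
  define a :: "'y \<Rightarrow> real^'n" where
    "a y = (\<chi> k. det (\<chi> i j. if j = k then v y $ i else M y $ i $ j) / det (M y))" for y
  have expand: "L x = (\<Sum>k\<in>UNIV. x $ k * L (axis k 1))" if "linear L" for L :: "real^'n \<Rightarrow> real" and x
  proof -
    have "L (\<Sum>k\<in>UNIV. x $ k *\<^sub>R axis k 1) = (\<Sum>k\<in>UNIV. x $ k * L (axis k 1))"
      by (simp add: linear_sum[OF that] linear_scale[OF that])
    then show ?thesis using basis_expansion[of x] by (simp add: scalar_mult_eq_scaleR)
  qed
  have Mx: "(M y *v x) $ j = B y x (axis j 1)" if "y \<in> S" for y x j
    using expand[OF lin(1)[OF that, of "axis j 1"], of x] by (simp add: matrix_vector_mult_def M_def mult.commute)
  \<comment> \<open>For \<open>x\<close> in the kernel, \<open>B y x x\<close> is the inner product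
    of \<open>x\<close> with \<open>M y *v x\<close> and hence zero, so positivity forces
    \<open>x\<close> to vanish.\<close>
  have det: "det (M y) \<noteq> 0" if y: "y \<in> S" for y
  proof -
    have "x = 0" if "M y *v x = 0" for x
    proof (rule ccontr)
      assume "x \<noteq> 0"
      have "B y x x = (\<Sum>k\<in>UNIV. x $ k * B y x (axis k 1))" by (rule expand[OF lin(2)[OF y]])
      also have "\<dots> = (\<Sum>k\<in>UNIV. x $ k * (M y *v x) $ k)" by (simp add: Mx[OF y])
      also have "\<dots> = 0" using that by simp
      finally show False using pos[OF y \<open>x \<noteq> 0\<close>] by simp
    qed
    then show ?thesis
      using invertible_det_nz[of "M y"] matrix_left_invertible_ker[of "M y"] invertible_left_inverse[of "M y"] by auto
  qed
  have "B y (a y) e = r y e" if y: "y \<in> S" for y e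
  proof -
    have "M y *v a y = v y" using cramer[OF det[OF y]] unfolding a_def by blast
    then have "B y (a y) (axis j 1) = r y (axis j 1)" for j
      using Mx[OF y, of "a y" j] by (simp add: v_def)
    then show ?thesis
      using expand[OF lin(2)[OF y], of "a y" e] expand[OF lin(3)[OF y], of e] by simp
  qed
  moreover have "a differentiable at y" if y: "y \<in> S" for y
  proof -
    have M_entry: "(\<lambda>y. M y $ i $ j) differentiable at y" for i j
      using diff[OF y] by (simp add: M_def)
    have entry: "(\<lambda>y. if j = k then v y $ i else M y $ i $ j) differentiable at y" for i j k
      using diff[OF y] by (cases "j = k") (simp_all add: M_def v_def)
    have "(\<lambda>y. \<chi> k. det (\<chi> i j. if j = k then v y $ i else M y $ i $ j) / det (M y)) differentiable at y"
      by (intro differentiable_vec_lambda differentiable_divide differentiable_det)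
        (use det[OF y] diff[OF y] entry in \<open>simp_all add: M_entry\<close>)
    then show ?thesis unfolding a_def .
  qed
  ultimately show ?thesis by blast
qed

text \<open>For a \<open>vector_field\<close>, regularity in every chart is part of the definition.
  The Hamiltonian field is controlled in one chart of the tangent bundle only, while
  \<open>lie_bracket_tangent\<close> asks for all charts at the point.\<close>

lemma (in atlas) field_differentiable_chart:
  assumes W: "manifold_open A W" "p \<in> W" and X: "\<And>q. q \<in> W \<Longrightarrow> X q \<in> tangent_space A q"
    and c: "c \<in> charts_at A p" and d: "d \<in> charts_at A p"
    and Xc: "(\<lambda>y. X (chart_inv c y) c) differentiable at (chart_map c p)"
  shows "(\<lambda>y. X (chart_inv d y) d) differentiable at (chart_map d p)"
proof -
  have cd: "c \<in> A" "d \<in> A" "p \<in> chart_dom c" "p \<in> chart_dom d" using c d by (auto simp: charts_at_iff)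
  have "((\<lambda>y. fd (transition c d) (transition d c y) (X (chart_inv c (transition d c y)) c)) has_derivative
    (\<lambda>v. fd (\<lambda>y. fd (transition c d) y (X (chart_inv c (transition d c (chart_map d p))) c))
        (transition d c (chart_map d p)) (fd (transition d c) (chart_map d p) v) +
     fd (transition c d) (transition d c (chart_map d p))
       (fd (\<lambda>y. X (chart_inv c y) c) (transition d c (chart_map d p)) (fd (transition d c) (chart_map d p) v))))
     (at (chart_map d p))"
    by (rule has_derivative_fd_apply[OF open_img_dom[OF cd(1,2)] transition_smooth[OF cd(1,2)] _
        has_derivative_fd[OF transition_differentiable[OF d c]]
        has_derivative_comp_fd[OF transition_differentiable[OF d c]]])
      (use cd Xc in auto)
  then have "((\<lambda>y. X (chart_inv d y) d) has_derivative
    (\<lambda>v. fd (\<lambda>y. fd (transition c d) y (X (chart_inv c (transition d c (chart_map d p))) c))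
        (transition d c (chart_map d p)) (fd (transition d c) (chart_map d p) v) +
     fd (transition c d) (transition d c (chart_map d p))
       (fd (\<lambda>y. X (chart_inv c y) c) (transition d c (chart_map d p)) (fd (transition d c) (chart_map d p) v))))
     (at (chart_map d p))"
  proof (rule has_derivative_transform_within_open)
    show "open (img d (chart_dom c \<inter> W))" "chart_map d p \<in> img d (chart_dom c \<inter> W)"
      using cd W open_img[OF manifold_open_Int[OF manifold_open_dom]] by auto
    fix y assume "y \<in> img d (chart_dom c \<inter> W)"
    then obtain q where q: "q \<in> chart_dom c" "q \<in> chart_dom d" "q \<in> W" "y = chart_map d q" by auto
    show "fd (transition c d) (transition d c y) (X (chart_inv c (transition d c y)) c) = X (chart_inv d y) d"
      using q cd tangent_change[OF X[OF q(3)], of c d] by (auto simp: charts_at_iff)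
  qed
  then show ?thesis by (rule differentiableI)
qed

section \<open>The Kaehler condition in an affine chart\<close>

lemma linear_Pair_base: "linear (\<lambda>e. (e, 0))"
  and linear_Pair_fibre: "linear (\<lambda>e. (0, e))"
  by (auto intro!: linearI)

lemmas linear_base_comp = linear_compose[OF linear_Pair_base, unfolded comp_def]
  and linear_fibre_comp = linear_compose[OF linear_Pair_fibre, unfolded comp_def]

locale affine_chart = dually_flat_manifold A h N N'
  for A :: "('a, real^'n::finite) chart set" and h and N N' +
  fixes c :: "('a, real^'n) chart" and f :: "'a \<times> ('a, real^'n) tvec \<Rightarrow> real"
  assumes c_mem: "c \<in> A"
    and flat: "\<And>p a b. p \<in> chart_dom c \<Longrightarrow> Christoffel A N c p a b = 0"
    and f_smooth: "smooth_fun_on (tangent_atlas A) (tangent_bundle A) f"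
begin

interpretation T: atlas "tangent_atlas A"
  by (rule atlas_tangent_atlas)

abbreviation "W \<equiv> bundle_restrict A (chart_dom c)"
abbreviation "TA \<equiv> tangent_atlas A"
abbreviation "tc \<equiv> tangent_chart A c"
abbreviation "S \<equiv> img c (chart_dom c) \<times> (UNIV :: (real^'n) set)"
abbreviation "g \<equiv> dombrowski_metric A h N"
abbreviation "\<omega> \<equiv> dombrowski_form A h N"

definition phi :: "(real^'n) \<times> (real^'n) \<Rightarrow> real" where
  "phi z = f (chart_inv tc z)"

text \<open>The Hessian of \<open>f\<close> in the coordinates of \<open>tc\<close>; arguments
  \<open>(e, 0)\<close> and \<open>(0, e)\<close> are directions along the base and along the
  fibre.\<close>

definition D2 :: "(real^'n) \<times> (real^'n) \<Rightarrow> (real^'n) \<times> (real^'n) \<Rightarrow> (real^'n) \<times> (real^'n) \<Rightarrow> real" where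
  "D2 z m e = fd (\<lambda>z. fd phi z e) z m"

lemma open_S: "open S"
  using open_img_dom[OF c_mem c_mem] by (intro open_Times) auto

lemma img_W: "img tc W = S"
  by (rule img_tangent_chart[OF c_mem])

lemma open_W: "manifold_open TA W"
  by (rule manifold_open_bundle_restrict[OF manifold_open_dom[OF c_mem]])

lemma phi_smooth: "smooth_on S phi"
proof -
  have "smooth_on (img tc (tangent_bundle A)) phi"
    using f_smooth tangent_chart_mem[OF c_mem] by (auto simp: smooth_fun_on_def comp_def phi_def[abs_def])
  moreover have "S \<subseteq> img tc (tangent_bundle A)"
    unfolding img_W[symmetric] by (rule image_mono) (auto simp: mem_bundle_restrict)
  ultimately show ?thesis by (rule smooth_on_mono)
qed

lemma W_D:
  assumes "u \<in> W"
  shows "u \<in> tangent_bundle A" "c \<in> charts_at A (fst u)" "tc \<in> charts_at TA u" "chart_map tc u \<in> S"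
    "chart_inv tc (chart_map tc u) = u" "chart_inv c (fst (chart_map tc u)) = fst u" "fst u \<in> chart_dom c"
proof -
  show u: "u \<in> tangent_bundle A" and c: "c \<in> charts_at A (fst u)" and "fst u \<in> chart_dom c"
    using assms c_mem by (auto simp: mem_bundle_restrict charts_at_iff)
  show tc: "tc \<in> charts_at TA u" by (rule tangent_chart_charts_at[OF u c])
  then show "chart_inv tc (chart_map tc u) = u"
    by (intro T.inv_map) (auto simp: charts_at_iff)
  show "chart_map tc u \<in> S" "chart_inv c (fst (chart_map tc u)) = fst u"
    using c by (auto simp: charts_at_iff)
qed

lemma S_D:
  assumes "z \<in> S"
  shows "chart_inv tc z \<in> W" "chart_map tc (chart_inv tc z) = z" "fst (chart_inv tc z) = chart_inv c (fst z)"
    "c \<in> charts_at A (chart_inv c (fst z))"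
proof -
  show "chart_inv tc z \<in> W" "chart_map tc (chart_inv tc z) = z"
    using T.img_inv[OF tangent_chart_mem[OF c_mem], of z W] assms img_W by auto
  show "fst (chart_inv tc z) = chart_inv c (fst z)" "c \<in> charts_at A (chart_inv c (fst z))"
    using assms chart_inv_tangent_chart[OF c_mem, of "fst z" "snd z"] c_mem by (auto simp: charts_at_iff)
qed

section \<open>Dombrowski's structure in the affine chart\<close>

lemma connector_affine:
  assumes "u \<in> W" "\<xi> \<in> tangent_space TA u"
  shows "connector A N u \<xi> c = snd (\<xi> tc)"
  using nabla.connector_chart[OF W_D(1) assms(2) W_D(2)] assms(1) flat[OF W_D(7)] by simp

lemma g_chart:
  assumes u: "u \<in> W" and xi: "\<xi> \<in> tangent_space TA u" and eta: "\<eta> \<in> tangent_space TA u"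
  shows "g u \<xi> \<eta> = G c (fst u) (fst (\<xi> tc)) (fst (\<eta> tc)) + G c (fst u) (snd (\<xi> tc)) (snd (\<eta> tc))"
  unfolding dombrowski_metric_def
    h_chart[OF W_D(2)[OF u] proj_push_tangent[OF W_D(1)[OF u] xi] proj_push_tangent[OF W_D(1)[OF u] eta]]
    h_chart[OF W_D(2)[OF u] nabla.connector_tangent[OF W_D(1)[OF u] xi] nabla.connector_tangent[OF W_D(1)[OF u] eta]]
  by (simp only: connector_affine[OF u xi] connector_affine[OF u eta]
      proj_push_chart[OF W_D(1)[OF u] xi W_D(2)[OF u]] proj_push_chart[OF W_D(1)[OF u] eta W_D(2)[OF u]])

text \<open>In the affine chart the two components of a vector are its images under
  \<open>proj_push\<close> and \<open>connector\<close>. They determine the vector, so the definite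
  description has exactly one solution.\<close>

lemma J_chart:
  assumes u: "u \<in> W" and xi: "\<xi> \<in> tangent_space TA u"
  shows "dombrowski_J A N u \<xi> \<in> tangent_space TA u" "dombrowski_J A N u \<xi> tc = (- snd (\<xi> tc), fst (\<xi> tc))"
proof -
  note u' = W_D[OF u]
  let ?J = "coord_field TA tc (- snd (\<xi> tc), fst (\<xi> tc)) u"
  note t = T.coord_field_tangent[OF u'(3)] and v = T.coord_field_same[OF u'(3)]
  have "dombrowski_J A N u \<xi> = ?J"
    unfolding dombrowski_J_def
  proof (rule the_equality, intro conjI)
    show "?J \<in> tangent_space TA u" by (rule t)
    show "proj_push A u ?J = tminus (connector A N u \<xi>)"
      by (rule tangent_eqI[OF proj_push_tangent[OF u'(1) t] tangent_tminus[OF nabla.connector_tangent[OF u'(1) xi]] u'(2)])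
        (simp add: proj_push_chart[OF u'(1) t u'(2)] connector_affine[OF u xi] v)
    show "connector A N u ?J = proj_push A u \<xi>"
      by (rule tangent_eqI[OF nabla.connector_tangent[OF u'(1) t] proj_push_tangent[OF u'(1) xi] u'(2)])
        (simp add: proj_push_chart[OF u'(1) xi u'(2)] connector_affine[OF u t] v)
  next
    fix \<eta> assume *: "\<eta> \<in> tangent_space TA u \<and> proj_push A u \<eta> = tminus (connector A N u \<xi>) \<and>
      connector A N u \<eta> = proj_push A u \<xi>"
    then have eta: "\<eta> \<in> tangent_space TA u" by simp
    have "proj_push A u \<eta> c = - connector A N u \<xi> c" "connector A N u \<eta> c = proj_push A u \<xi> c"
      using * by simp_all
    then have "fst (\<eta> tc) = - snd (\<xi> tc)" "snd (\<eta> tc) = fst (\<xi> tc)"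
      by (simp_all only: proj_push_chart[OF u'(1) eta u'(2)] proj_push_chart[OF u'(1) xi u'(2)]
          connector_affine[OF u eta] connector_affine[OF u xi])
    then show "\<eta> = ?J"
      by (intro T.tangent_eqI[OF eta t u'(3)]) (simp add: v prod_eq_iff)
  qed
  then show "dombrowski_J A N u \<xi> \<in> tangent_space TA u" "dombrowski_J A N u \<xi> tc = (- snd (\<xi> tc), fst (\<xi> tc))"
    using t v by simp_all
qed

lemma omega_chart:
  assumes u: "u \<in> W" and xi: "\<xi> \<in> tangent_space TA u" and eta: "\<eta> \<in> tangent_space TA u"
  shows "\<omega> u \<xi> \<eta> = G c (fst u) (- snd (\<xi> tc)) (fst (\<eta> tc)) + G c (fst u) (fst (\<xi> tc)) (snd (\<eta> tc))"
  unfolding dombrowski_form_def using g_chart[OF u J_chart(1)[OF u xi] eta] J_chart(2)[OF u xi] by simp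

section \<open>The Hamiltonian vector field\<close>

lemma df_chart:
  assumes u: "u \<in> W" and eta: "\<eta> \<in> tangent_space TA u"
  shows "dir_deriv TA f u \<eta> = fd phi (chart_map tc u) (\<eta> tc)"
  using T.dir_deriv_chart[OF W_D(3)[OF u] eta, of f] smooth_on_differentiable[OF phi_smooth W_D(4)[OF u]]
  by (simp add: phi_def[abs_def])

lemma phi_differentiable: "z \<in> S \<Longrightarrow> phi differentiable at z"
  by (rule smooth_on_differentiable[OF phi_smooth])

lemma dphi_differentiable: "z \<in> S \<Longrightarrow> (\<lambda>z. fd phi z e) differentiable at z"
  by (rule smooth_on_differentiable[OF smooth_on_fd[OF phi_smooth]])

text \<open>The metric is positive definite, so indices can be raised;
  \<open>differentiable_solution\<close> does this with a differentiable result, which pointwise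
  inversion would not show. \<open>L\<close> selects the base or the fibre half of the
  differential.\<close>

lemma solution_exists:
  assumes "linear L"
  shows "\<exists>a. \<forall>z\<in>S. (\<forall>e. G c (chart_inv c (fst z)) (a z) e = fd phi z (L e)) \<and> a differentiable at z"
proof (rule differentiable_solution[OF open_S, where B = "\<lambda>z. G c (chart_inv c (fst z))"])
  fix z assume z: "z \<in> S"
  note c = S_D(4)[OF z]
  show "linear (\<lambda>a. G c (chart_inv c (fst z)) a b)" for b by (rule linear_G_left[OF c])
  show "linear (G c (chart_inv c (fst z)) a)" for a by (rule linear_G_right[OF c])
  show "linear (\<lambda>e. fd phi z (L e))"
    using linear_compose[OF assms linear_frechet_derivative[OF phi_differentiable[OF z]]] by (simp add: comp_def)
  show "G c (chart_inv c (fst z)) a a > 0" if "a \<noteq> 0" for a by (rule G_pos[OF c that])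
  show "(\<lambda>z. G c (chart_inv c (fst z)) a b) differentiable at z" for a b
  proof -
    have "(\<lambda>y. G c (chart_inv c y) a b) differentiable at (fst z)"
      using G_differentiable[OF c] img_inv[OF c_mem, of "fst z" "chart_dom c"] z by auto
    then show ?thesis
      using has_derivative_comp_fd[of fst z "\<lambda>y. G c (chart_inv c y) a b"]
        bounded_linear_imp_differentiable[OF bounded_linear_fst]
      by (auto simp: differentiable_def)
  qed
  show "(\<lambda>z. fd phi z (L e)) differentiable at z" for e by (rule dphi_differentiable[OF z])
qed

text \<open>The base and fibre components of the Hamiltonian vector field of \<open>f\<close>.\<close>

definition ham_base :: "(real^'n) \<times> (real^'n) \<Rightarrow> real^'n" where
  "ham_base = (SOME a. \<forall>z\<in>S. (\<forall>e. G c (chart_inv c (fst z)) (a z) e = fd phi z (0, e)) \<and> a differentiable at z)"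

definition ham_fibre :: "(real^'n) \<times> (real^'n) \<Rightarrow> real^'n" where
  "ham_fibre = (SOME b. \<forall>z\<in>S. (\<forall>e. G c (chart_inv c (fst z)) (b z) e = fd phi z (- e, 0)) \<and> b differentiable at z)"

lemma ham_base:
  assumes "z \<in> S"
  shows "G c (chart_inv c (fst z)) (ham_base z) e = fd phi z (0, e)" "ham_base differentiable at z"
proof -
  from someI_ex[OF solution_exists[OF linear_Pair_fibre]]
  show "G c (chart_inv c (fst z)) (ham_base z) e = fd phi z (0, e)" "ham_base differentiable at z"
    using assms unfolding ham_base_def by blast+
qed

lemma ham_fibre:
  assumes "z \<in> S"
  shows "G c (chart_inv c (fst z)) (ham_fibre z) e = - fd phi z (e, 0)" "ham_fibre differentiable at z"
proof -
  \<comment> \<open>The sign in front of d_x f is put into the linear map, so that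
    \<open>solution_exists\<close> serves both components.\<close>
  have "linear (\<lambda>e::real^'n. (- e, 0::real^'n))" by (auto intro!: linearI)
  from someI_ex[OF solution_exists[OF this]]
  have *: "G c (chart_inv c (fst z)) (ham_fibre z) e = fd phi z (- e, 0)" "ham_fibre differentiable at z"
    using assms unfolding ham_fibre_def by blast+
  show "ham_fibre differentiable at z" by (rule *)
  show "G c (chart_inv c (fst z)) (ham_fibre z) e = - fd phi z (e, 0)"
    using * fd_minus[OF phi_differentiable[OF assms], of "(e, 0)"] by simp
qed

abbreviation "X \<equiv> hamiltonian_field TA \<omega> f"

text \<open>Testing the form against vectors with coordinates \<open>(e, 0)\<close> and
  \<open>(0, e)\<close> separates the two components, and nondegeneracy of \<open>G\<close> leaves a
  single candidate, as the definite description requires.\<close>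

lemma X_chart:
  assumes u: "u \<in> W"
  shows "X u \<in> tangent_space TA u" "X u tc = (ham_base (chart_map tc u), ham_fibre (chart_map tc u))"
proof -
  note u' = W_D[OF u]
  let ?z = "chart_map tc u"
  let ?X = "coord_field TA tc (ham_base ?z, ham_fibre ?z) u"
  note t = T.coord_field_tangent[OF u'(3)] and v = T.coord_field_same[OF u'(3)]
  have a: "G c (fst u) (ham_base ?z) e = fd phi ?z (0, e)" for e
    using ham_base(1)[OF u'(4)] unfolding u'(6) .
  have b: "G c (fst u) (ham_fibre ?z) e = - fd phi ?z (e, 0)" for e
    using ham_fibre(1)[OF u'(4)] unfolding u'(6) .
  have dphi: "fd phi ?z (m1, m2) = fd phi ?z (m1, 0) + fd phi ?z (0, m2)" for m1 m2
    using fd_add[OF phi_differentiable[OF u'(4)], of "(m1, 0)" "(0, m2)"] by simp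
  have "X u = ?X"
    unfolding hamiltonian_field_def
  proof (rule the_equality, intro conjI ballI)
    show "?X \<in> tangent_space TA u" by (rule t)
    fix \<eta> assume eta: "\<eta> \<in> tangent_space TA u"
    show "\<omega> u ?X \<eta> = dir_deriv TA f u \<eta>"
      unfolding omega_chart[OF u t eta] df_chart[OF u eta] v
      using dphi[of "fst (\<eta> tc)" "snd (\<eta> tc)"] by (simp add: linear_neg[OF linear_G_left[OF u'(2)]] a b del: tangent_chart_map)
  next
    fix \<xi> assume *: "\<xi> \<in> tangent_space TA u \<and> (\<forall>\<eta>\<in>tangent_space TA u. \<omega> u \<xi> \<eta> = dir_deriv TA f u \<eta>)"
    then have xi: "\<xi> \<in> tangent_space TA u" by simp
    have eq: "G c (fst u) (- snd (\<xi> tc)) (fst m) + G c (fst u) (fst (\<xi> tc)) (snd m) = fd phi ?z m" for m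
      using * omega_chart[OF u xi t[of m]] df_chart[OF u t[of m]] t[of m] v[of m] by simp
    have "snd (\<xi> tc) = ham_fibre ?z"
    proof (rule G_nondegenerate[OF u'(2)])
      show "G c (fst u) (snd (\<xi> tc)) e = G c (fst u) (ham_fibre ?z) e" for e
        using eq[of "(e, 0)"] b[of e]
        by (simp add: linear_neg[OF linear_G_left[OF u'(2)]] linear_0[OF linear_G_right[OF u'(2)]] del: tangent_chart_map)
    qed
    moreover have "fst (\<xi> tc) = ham_base ?z"
    proof (rule G_nondegenerate[OF u'(2)])
      show "G c (fst u) (fst (\<xi> tc)) e = G c (fst u) (ham_base ?z) e" for e
        using eq[of "(0, e)"] a[of e]
        by (simp add: linear_0[OF linear_G_right[OF u'(2)]] del: tangent_chart_map)
    qed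
    ultimately show "\<xi> = ?X"
      by (intro T.tangent_eqI[OF xi t u'(3)]) (simp add: v prod_eq_iff)
  qed
  then show "X u \<in> tangent_space TA u" "X u tc = (ham_base ?z, ham_fibre ?z)"
    using t v by simp_all
qed

section \<open>The Lie derivative of the metric\<close>

lemma X_has_derivative:
  assumes u: "u \<in> W"
  shows "((\<lambda>z. X (chart_inv tc z) tc) has_derivative
    (\<lambda>m. (fd ham_base (chart_map tc u) m, fd ham_fibre (chart_map tc u) m))) (at (chart_map tc u))"
proof (rule has_derivative_transform_within_open[OF _ open_S W_D(4)[OF u]])
  show "((\<lambda>z. (ham_base z, ham_fibre z)) has_derivative
    (\<lambda>m. (fd ham_base (chart_map tc u) m, fd ham_fibre (chart_map tc u) m))) (at (chart_map tc u))"
    by (intro has_derivative_Pair has_derivative_fd ham_base(2) ham_fibre(2) W_D(4)[OF u])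
  show "(ham_base z, ham_fibre z) = X (chart_inv tc z) tc" if "z \<in> S" for z
    using X_chart(2)[OF S_D(1)[OF that]] S_D(2)[OF that] by simp
qed

text \<open>Differentiating the relation that defines \<open>ham_base\<close> gives the derivative
  of the field with its index lowered, without a derivative of the inverse metric.\<close>

lemma ham_base_derivative:
  assumes u: "u \<in> W"
  shows "G c (fst u) (fd ham_base (chart_map tc u) m) e =
    D2 (chart_map tc u) m (0, e) - DG c (fst u) (fst m) (ham_base (chart_map tc u)) e"
proof -
  let ?z = "chart_map tc u"
  note u' = W_D[OF u]
  have "((\<lambda>z. G c (chart_inv c (fst z)) (ham_base z) e) has_derivative
    (\<lambda>m. DG c (fst u) (fst m) (ham_base ?z) e + G c (fst u) (fd ham_base ?z m) e + G c (fst u) (ham_base ?z) 0)) (at ?z)"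
    by (rule has_derivative_G[OF u'(2) _ _ has_derivative_fd[OF ham_base(2)[OF u'(4)]] has_derivative_const])
      (auto intro!: bounded_linear_imp_has_derivative bounded_linear_fst)
  then have "((\<lambda>z. fd phi z (0, e)) has_derivative
    (\<lambda>m. DG c (fst u) (fst m) (ham_base ?z) e + G c (fst u) (fd ham_base ?z m) e + G c (fst u) (ham_base ?z) 0)) (at ?z)"
    by (rule has_derivative_transform_within_open[OF _ open_S u'(4)]) (rule ham_base(1))
  from fun_cong[OF fd_eqI[OF this], of m] show ?thesis
    using linear_0[OF linear_G_right[OF u'(2)]] by (simp add: D2_def)
qed

lemma ham_fibre_derivative:
  assumes u: "u \<in> W"
  shows "G c (fst u) (fd ham_fibre (chart_map tc u) m) e =
    - D2 (chart_map tc u) m (e, 0) - DG c (fst u) (fst m) (ham_fibre (chart_map tc u)) e"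
proof -
  let ?z = "chart_map tc u"
  note u' = W_D[OF u]
  have "((\<lambda>z. - G c (chart_inv c (fst z)) (ham_fibre z) e) has_derivative
    (\<lambda>m. - (DG c (fst u) (fst m) (ham_fibre ?z) e + G c (fst u) (fd ham_fibre ?z m) e + G c (fst u) (ham_fibre ?z) 0))) (at ?z)"
    by (rule has_derivative_minus, rule has_derivative_G[OF u'(2) _ _ has_derivative_fd[OF ham_fibre(2)[OF u'(4)]] has_derivative_const])
      (auto intro!: bounded_linear_imp_has_derivative bounded_linear_fst)
  then have "((\<lambda>z. fd phi z (e, 0)) has_derivative
    (\<lambda>m. - (DG c (fst u) (fst m) (ham_fibre ?z) e + G c (fst u) (fd ham_fibre ?z m) e + G c (fst u) (ham_fibre ?z) 0))) (at ?z)"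
    by (rule has_derivative_transform_within_open[OF _ open_S u'(4)]) (simp add: ham_fibre(1))
  from fun_cong[OF fd_eqI[OF this], of m] show ?thesis
    using linear_0[OF linear_G_right[OF u'(2)]] by (simp add: D2_def)
qed

text \<open>The derivatives of \<open>Y\<close> and \<open>Z\<close> along \<open>X\<close> in the
  product rule cancel against those in the brackets. What remains depends on \<open>Y\<close> and
  \<open>Z\<close> only through their values at \<open>u\<close>: the derivative of the metric along
  the base part of \<open>X\<close>, and the derivatives of \<open>X\<close>.\<close>

lemma lie_deriv_chart:
  assumes u: "u \<in> W" and Y: "vector_field TA W Y" and Z: "vector_field TA W Z"
  defines "z \<equiv> chart_map tc u"
  shows "lie_deriv_metric TA g X Y Z u =
    DG c (fst u) (ham_base z) (fst (Y u tc)) (fst (Z u tc)) + DG c (fst u) (ham_base z) (snd (Y u tc)) (snd (Z u tc)) +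
    G c (fst u) (fd ham_base z (Y u tc)) (fst (Z u tc)) + G c (fst u) (fd ham_fibre z (Y u tc)) (snd (Z u tc)) +
    G c (fst u) (fst (Y u tc)) (fd ham_base z (Z u tc)) + G c (fst u) (snd (Y u tc)) (fd ham_fibre z (Z u tc))"
proof -
  note u' = W_D[OF u]
  let ?Y = "\<lambda>z. Y (chart_inv tc z) tc" and ?Z = "\<lambda>z. Z (chart_inv tc z) tc" and ?X = "\<lambda>z. X (chart_inv tc z) tc"
  have inv: "chart_inv tc z = u" unfolding z_def by (rule u')
  have zS: "z \<in> S" unfolding z_def by (rule u')
  have fz: "fst z = chart_map c (fst u)" by (simp add: z_def)
  have dY: "?Y differentiable at z" and dZ: "?Z differentiable at z"
    unfolding z_def by (rule T.vector_field_differentiable[OF _ u'(3) u], fact)+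
  have dX: "(?X has_derivative (\<lambda>m. (fd ham_base z m, fd ham_fibre z m))) (at z)"
    unfolding z_def by (rule X_has_derivative[OF u])
  \<comment> \<open>\<open>g_chart\<close> is about tangent vectors, so the bracket must be shown to
    be one before it can be evaluated.\<close>
  have bracket: "lie_bracket TA X V u \<in> tangent_space TA u"
    "lie_bracket TA X V u tc = fd (\<lambda>z. V (chart_inv tc z) tc) z (X u tc) -
      (fd ham_base z (V u tc), fd ham_fibre z (V u tc))" if V: "vector_field TA W V" for V
  proof -
    show "lie_bracket TA X V u \<in> tangent_space TA u"
    proof (rule T.lie_bracket_tangent[OF open_W u X_chart(1) _ T.vector_field_tangent[OF V]])
      fix d assume d: "d \<in> charts_at TA u"
      show "(\<lambda>y. X (chart_inv d y) d) differentiable at (chart_map d u)"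
        by (rule T.field_differentiable_chart[OF open_W u X_chart(1) u'(3) d differentiableI[OF X_has_derivative[OF u]]])
      show "(\<lambda>y. V (chart_inv d y) d) differentiable at (chart_map d u)"
        by (rule T.vector_field_differentiable[OF V d u])
    qed
    show "lie_bracket TA X V u tc = fd (\<lambda>z. V (chart_inv tc z) tc) z (X u tc) -
      (fd ham_base z (V u tc), fd ham_fibre z (V u tc))"
      using u'(3) fd_eqI[OF dX] by (simp add: lie_bracket_def z_def del: tangent_chart_map)
  qed
  note Yt = T.vector_field_tangent[OF Y u] and Zt = T.vector_field_tangent[OF Z u]
  have f': "((\<lambda>z. fst (?Y z)) has_derivative (\<lambda>m. fst (fd ?Y z m))) (at z)"
    "((\<lambda>z. snd (?Y z)) has_derivative (\<lambda>m. snd (fd ?Y z m))) (at z)"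
    "((\<lambda>z. fst (?Z z)) has_derivative (\<lambda>m. fst (fd ?Z z m))) (at z)"
    "((\<lambda>z. snd (?Z z)) has_derivative (\<lambda>m. snd (fd ?Z z m))) (at z)"
    by (intro bounded_linear.has_derivative[OF bounded_linear_fst] bounded_linear.has_derivative[OF bounded_linear_snd]
        has_derivative_fd dY dZ)+
  have fst': "(fst has_derivative fst) (at z)"
    by (auto intro!: bounded_linear_imp_has_derivative bounded_linear_fst)
  have "((\<lambda>z. g (chart_inv tc z) (Y (chart_inv tc z)) (Z (chart_inv tc z))) has_derivative
    (\<lambda>m. (DG c (fst u) (fst m) (fst (?Y z)) (fst (?Z z)) + G c (fst u) (fst (fd ?Y z m)) (fst (?Z z)) +
        G c (fst u) (fst (?Y z)) (fst (fd ?Z z m))) +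
      (DG c (fst u) (fst m) (snd (?Y z)) (snd (?Z z)) + G c (fst u) (snd (fd ?Y z m)) (snd (?Z z)) +
        G c (fst u) (snd (?Y z)) (snd (fd ?Z z m))))) (at z)"
  proof (rule has_derivative_transform_within_open[OF _ open_S zS])
    show "((\<lambda>z. G c (chart_inv c (fst z)) (fst (?Y z)) (fst (?Z z)) + G c (chart_inv c (fst z)) (snd (?Y z)) (snd (?Z z)))
      has_derivative
    (\<lambda>m. (DG c (fst u) (fst m) (fst (?Y z)) (fst (?Z z)) + G c (fst u) (fst (fd ?Y z m)) (fst (?Z z)) +
        G c (fst u) (fst (?Y z)) (fst (fd ?Z z m))) +
      (DG c (fst u) (fst m) (snd (?Y z)) (snd (?Z z)) + G c (fst u) (snd (fd ?Y z m)) (snd (?Z z)) +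
        G c (fst u) (snd (?Y z)) (snd (fd ?Z z m))))) (at z)"
      by (intro has_derivative_add has_derivative_G[OF u'(2) fz fst'] f')
    fix x assume x: "x \<in> S"
    show "G c (chart_inv c (fst x)) (fst (?Y x)) (fst (?Z x)) + G c (chart_inv c (fst x)) (snd (?Y x)) (snd (?Z x)) =
      g (chart_inv tc x) (Y (chart_inv tc x)) (Z (chart_inv tc x))"
      using g_chart[OF S_D(1)[OF x] T.vector_field_tangent[OF Y S_D(1)[OF x]] T.vector_field_tangent[OF Z S_D(1)[OF x]]]
        S_D(3)[OF x] by simp
  qed
  note D = this
  have "dir_deriv TA (\<lambda>q. g q (Y q) (Z q)) u (X u) =
    fd (\<lambda>z. g (chart_inv tc z) (Y (chart_inv tc z)) (Z (chart_inv tc z))) z (X u tc)"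
    unfolding z_def by (rule T.dir_deriv_chart[OF u'(3) X_chart(1)[OF u]]) (rule differentiableI[OF D[unfolded z_def]])
  then have dd: "dir_deriv TA (\<lambda>q. g q (Y q) (Z q)) u (X u) =
      (DG c (fst u) (ham_base z) (fst (Y u tc)) (fst (Z u tc)) + G c (fst u) (fst (fd ?Y z (X u tc))) (fst (Z u tc)) +
        G c (fst u) (fst (Y u tc)) (fst (fd ?Z z (X u tc)))) +
      (DG c (fst u) (ham_base z) (snd (Y u tc)) (snd (Z u tc)) + G c (fst u) (snd (fd ?Y z (X u tc))) (snd (Z u tc)) +
        G c (fst u) (snd (Y u tc)) (snd (fd ?Z z (X u tc))))"
    unfolding fd_eqI[OF D] inv by (simp only: X_chart(2)[OF u] fst_conv z_def)
  show ?thesis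
    unfolding lie_deriv_metric_def dd g_chart[OF u bracket(1)[OF Y] Zt] g_chart[OF u Yt bracket(1)[OF Z]]
      bracket(2)[OF Y] bracket(2)[OF Z]
    by (simp add: linear_diff[OF linear_G_left[OF u'(2)]] linear_diff[OF linear_G_right[OF u'(2)]])
qed

definition P :: "'a \<times> ('a, real^'n) tvec \<Rightarrow> real^'n \<Rightarrow> real^'n \<Rightarrow> real" where
  "P u e e' = D2 (chart_map tc u) (e, 0) (0, e') + D2 (chart_map tc u) (e', 0) (0, e) -
    DG c (fst u) (ham_base (chart_map tc u)) e e'"

definition Q :: "'a \<times> ('a, real^'n) tvec \<Rightarrow> real^'n \<Rightarrow> real^'n \<Rightarrow> real" where
  "Q u e e' = D2 (chart_map tc u) (0, e) (0, e') - D2 (chart_map tc u) (e, 0) (e', 0) -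
    DG c (fst u) (ham_fibre (chart_map tc u)) e e'"

lemma D2_sym: "z \<in> S \<Longrightarrow> D2 z m e = D2 z e m"
  unfolding D2_def by (rule second_derivative_symmetric[OF open_S _ phi_smooth])

lemma linear_D2_left: "z \<in> S \<Longrightarrow> linear (\<lambda>m. D2 z m e)"
  unfolding D2_def by (rule linear_frechet_derivative[OF dphi_differentiable])

lemma linear_D2_right:
  assumes "z \<in> S"
  shows "linear (D2 z m)"
proof -
  have "D2 z m = (\<lambda>e. D2 z e m)" by (rule ext) (rule D2_sym[OF assms])
  then show ?thesis using linear_D2_left[OF assms, of m] by simp
qed

lemma D2_Pair_left: "z \<in> S \<Longrightarrow> D2 z (m1, m2) e = D2 z (m1, 0) e + D2 z (0, m2) e"
  using linear_add[OF linear_D2_left, of z "(m1, 0)" "(0, m2)" e] by simp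

lemma DG_rotate:
  assumes u: "u \<in> W"
  shows "DG c (fst u) a b e = DG c (fst u) b a e" "DG c (fst u) a b e = DG c (fst u) e b a"
proof -
  note s = DG_totally_symmetric[OF W_D(2)[OF u] flat[OF W_D(7)[OF u]]] DG_sym[OF W_D(2)[OF u]]
  show "DG c (fst u) a b e = DG c (fst u) e b a" by (rule s)
  show "DG c (fst u) a b e = DG c (fst u) b a e" using s(1)[of a b e] s(1)[of b a e] s(2)[of e a b] by simp
qed

lemma P_sym: "P u e e' = P u e' e" if "u \<in> W"
  using DG_sym[OF W_D(2)[OF that]] by (simp add: P_def)

lemma Q_sym: "Q u e e' = Q u e' e" if "u \<in> W"
  using DG_sym[OF W_D(2)[OF that], of _ e e'] D2_sym[OF W_D(4)[OF that], of "(0, e)" "(0, e')"]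
    D2_sym[OF W_D(4)[OF that], of "(e, 0)" "(e', 0)"] by (simp add: Q_def)

text \<open>\<open>DG\<close> is linear in its first argument, being a derivative; total symmetry
  moves the argument in question to that place.\<close>

lemma linear_P:
  assumes u: "u \<in> W"
  shows "linear (\<lambda>e. P u e e')"
proof -
  note z = W_D(4)[OF u]
  have 1: "linear (\<lambda>e. D2 (chart_map tc u) (e, 0) (0, e'))"
    by (rule linear_base_comp[OF linear_D2_left[OF z]])
  have 2: "linear (\<lambda>e. D2 (chart_map tc u) (e', 0) (0, e))"
    by (rule linear_fibre_comp[OF linear_D2_right[OF z]])
  have 3: "linear (\<lambda>e. DG c (fst u) (ham_base (chart_map tc u)) e e')"
    using linear_DG[OF W_D(2)[OF u]] by (simp add: DG_rotate(1)[OF u, of "ham_base _"])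
  show ?thesis
    unfolding P_def by (intro linear_compose_sub linear_compose_add 1 2 3)
qed

lemma linear_Q:
  assumes u: "u \<in> W"
  shows "linear (\<lambda>e. Q u e e')"
proof -
  note z = W_D(4)[OF u]
  have 1: "linear (\<lambda>e. D2 (chart_map tc u) (0, e) (0, e'))"
    by (rule linear_fibre_comp[OF linear_D2_left[OF z]])
  have 2: "linear (\<lambda>e. D2 (chart_map tc u) (e, 0) (e', 0))"
    by (rule linear_base_comp[OF linear_D2_left[OF z]])
  have 3: "linear (\<lambda>e. DG c (fst u) (ham_fibre (chart_map tc u)) e e')"
    using linear_DG[OF W_D(2)[OF u]] by (simp add: DG_rotate(1)[OF u, of "ham_fibre _"])
  show ?thesis
    unfolding Q_def by (intro linear_compose_sub linear_compose_add 1 2 3)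
qed

text \<open>Once the derivatives of the field are expressed by \<open>D2\<close> and
  \<open>DG\<close>, total symmetry collects the \<open>DG\<close> terms. In the base block three of
  them leave one with a minus sign, in the fibre block a single one has a plus sign; this is why the
  same \<open>P\<close> appears with opposite signs.\<close>

lemma lie_deriv_PQ:
  assumes u: "u \<in> W" and Y: "vector_field TA W Y" and Z: "vector_field TA W Z"
  shows "lie_deriv_metric TA g X Y Z u =
    P u (fst (Y u tc)) (fst (Z u tc)) - P u (snd (Y u tc)) (snd (Z u tc)) +
    Q u (snd (Y u tc)) (fst (Z u tc)) + Q u (snd (Z u tc)) (fst (Y u tc))"
proof -
  obtain y1 y2 where y: "Y u tc = (y1, y2)" by fastforce
  obtain z1 z2 where z: "Z u tc = (z1, z2)" by fastforce
  note zS = W_D(4)[OF u] and Gs = G_sym[OF W_D(2)[OF u]]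
  define w where "w = chart_map tc u"
  have D: "G c (fst u) (fd ham_base w m) e = D2 w m (0, e) - DG c (fst u) (fst m) (ham_base w) e"
    "G c (fst u) (fd ham_fibre w m) e = - D2 w m (e, 0) - DG c (fst u) (fst m) (ham_fibre w) e" for m e
    unfolding w_def by (rule ham_base_derivative[OF u] ham_fibre_derivative[OF u])+
  have w: "w \<in> S" unfolding w_def by (rule zS)
  have split: "D2 w (y1, y2) e = D2 w (y1, 0) e + D2 w (0, y2) e"
    "D2 w (z1, z2) e = D2 w (z1, 0) e + D2 w (0, z2) e" for e
    by (rule D2_Pair_left[OF w])+
  have "lie_deriv_metric TA g X Y Z u =
    DG c (fst u) (ham_base w) y1 z1 + DG c (fst u) (ham_base w) y2 z2 +
    (D2 w (y1, y2) (0, z1) - DG c (fst u) y1 (ham_base w) z1) +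
    (- D2 w (y1, y2) (z2, 0) - DG c (fst u) y1 (ham_fibre w) z2) +
    (D2 w (z1, z2) (0, y1) - DG c (fst u) z1 (ham_base w) y1) +
    (- D2 w (z1, z2) (y2, 0) - DG c (fst u) z1 (ham_fibre w) y2)"
    using lie_deriv_chart[OF u Y Z] Gs[of y1] Gs[of y2] D[of "(y1, y2)"] D[of "(z1, z2)"]
    unfolding w_def[symmetric] y z by simp
  moreover have "DG c (fst u) y1 (ham_base w) z1 = DG c (fst u) (ham_base w) y1 z1"
    "DG c (fst u) z1 (ham_base w) y1 = DG c (fst u) (ham_base w) y1 z1"
    "DG c (fst u) y1 (ham_fibre w) z2 = DG c (fst u) (ham_fibre w) z2 y1"
    "DG c (fst u) z1 (ham_fibre w) y2 = DG c (fst u) (ham_fibre w) y2 z1"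
    using DG_rotate(1)[OF u] DG_sym[OF W_D(2)[OF u]] by metis+
  moreover have "D2 w (0, y2) (z2, 0) = D2 w (z2, 0) (0, y2)" "D2 w (0, z2) (y2, 0) = D2 w (y2, 0) (0, z2)"
    "D2 w (y1, 0) (z2, 0) = D2 w (z2, 0) (y1, 0)" "D2 w (z1, 0) (y2, 0) = D2 w (y2, 0) (z1, 0)"
    by (rule D2_sym[OF w])+
  ultimately show ?thesis
    unfolding P_def Q_def w_def[symmetric] y z split by simp
qed

text \<open>The formula for the Lie derivative is pointwise in the two fields, so coordinate fields
  are sufficient tests: coordinates \<open>(e, 0)\<close> and \<open>(e', 0)\<close> isolate
  \<open>P\<close>, while \<open>(0, e)\<close> and \<open>(e', 0)\<close> isolate
  \<open>Q\<close>.\<close>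

lemma kaehler_iff:
  "kaehler_function_on TA g \<omega> W f \<longleftrightarrow> (\<forall>u\<in>W. \<forall>e e'. P u e e' = 0 \<and> Q u e e' = 0)"
proof
  assume K: "kaehler_function_on TA g \<omega> W f"
  have vf: "vector_field TA W (coord_field TA tc m)" for m
    by (rule T.coord_field_vector_field[OF open_W _ tangent_chart_mem[OF c_mem]]) simp
  show "\<forall>u\<in>W. \<forall>e e'. P u e e' = 0 \<and> Q u e e' = 0"
  proof (intro ballI allI)
    fix u e e' assume u: "u \<in> W"
    note v = T.coord_field_same[OF W_D(3)[OF u]]
    have L: "P u (fst m) (fst m') - P u (snd m) (snd m') + Q u (snd m) (fst m') + Q u (snd m') (fst m) = 0" for m m'
      using K vf u lie_deriv_PQ[OF u vf[of m] vf[of m']] by (simp add: kaehler_function_on_def v)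
    have 0: "P u 0 x = 0" "Q u 0 x = 0" "P u x 0 = 0" "Q u x 0 = 0" for x
      using linear_0[OF linear_P[OF u]] linear_0[OF linear_Q[OF u]] P_sym[OF u] Q_sym[OF u] by metis+
    show "P u e e' = 0 \<and> Q u e e' = 0"
      using L[of "(e, 0)" "(e', 0)"] L[of "(0, e)" "(e', 0)"] by (simp add: 0)
  qed
next
  assume "\<forall>u\<in>W. \<forall>e e'. P u e e' = 0 \<and> Q u e e' = 0"
  moreover have "smooth_fun_on TA W f"
    by (rule T.smooth_fun_mono[OF f_smooth]) (auto simp: mem_bundle_restrict)
  ultimately show "kaehler_function_on TA g \<omega> W f"
    by (auto simp: kaehler_function_on_def lie_deriv_PQ)
qed

lemma basis_iff:
  assumes u: "u \<in> W"
  shows "(\<forall>e e'. P u e e' = 0 \<and> Q u e e' = 0) \<longleftrightarrow>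
    (\<forall>i j. P u (axis i 1) (axis j 1) = 0 \<and> Q u (axis i 1) (axis j 1) = 0)"
proof
  assume *: "\<forall>i j. P u (axis i 1) (axis j 1) = 0 \<and> Q u (axis i 1) (axis j 1) = 0"
  have "linear (P u e)" "linear (Q u e)" for e
  proof -
    have "P u e = (\<lambda>e'. P u e' e)" "Q u e = (\<lambda>e'. Q u e' e)"
      using P_sym[OF u] Q_sym[OF u] by blast+
    then show "linear (P u e)" "linear (Q u e)"
      using linear_P[OF u, of e] linear_Q[OF u, of e] by simp_all
  qed
  then have "P u e e' = (\<Sum>i\<in>Basis. \<Sum>j\<in>Basis. (e \<bullet> i) * ((e' \<bullet> j) * P u i j))"
    "Q u e e' = (\<Sum>i\<in>Basis. \<Sum>j\<in>Basis. (e \<bullet> i) * ((e' \<bullet> j) * Q u i j))" for e e'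
    by (auto intro!: bilinear_Basis_expansion linear_P[OF u] linear_Q[OF u])
  moreover have "P u i j = 0" "Q u i j = 0" if "i \<in> Basis" "j \<in> Basis" for i j
    using that * by (auto simp: Basis_vec_def)
  ultimately show "\<forall>e e'. P u e e' = 0 \<and> Q u e e' = 0" by simp
qed auto

section \<open>The complex equation\<close>

lemma partial_along_chart:
  assumes u: "u \<in> W" and F: "\<And>z. z \<in> S \<Longrightarrow> F (chart_inv tc z) = Complex (r z) (s z)"
    and r: "r differentiable at (chart_map tc u)" and s: "s differentiable at (chart_map tc u)"
  shows "partial_along tc e F u = Complex (fd r (chart_map tc u) e) (fd s (chart_map tc u) e)"
proof -
  let ?z = "chart_map tc u"
  have "((\<lambda>z. complex_of_real (r z) + \<i> * complex_of_real (s z)) has_derivative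
      (\<lambda>e. complex_of_real (fd r ?z e) + \<i> * complex_of_real (fd s ?z e))) (at ?z)"
    by (intro has_derivative_add has_derivative_mult_right has_derivative_of_real has_derivative_fd r s)
  then have "((F \<circ> chart_inv tc) has_derivative
      (\<lambda>e. complex_of_real (fd r ?z e) + \<i> * complex_of_real (fd s ?z e))) (at ?z)"
    by (rule has_derivative_transform_within_open[OF _ open_S W_D(4)[OF u]]) (simp add: F Complex_eq)
  from fun_cong[OF fd_eqI[OF this], of e] show ?thesis
    by (simp add: partial_along_def Complex_eq)
qed

lemma partial_z_f:
  assumes u: "u \<in> W"
  shows "partial_z A c j (\<lambda>q. complex_of_real (f q)) u =
    Complex (fd phi (chart_map tc u) (axis j 1, 0) / 2) (- fd phi (chart_map tc u) (0, axis j 1) / 2)"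
proof -
  have "partial_along tc e (\<lambda>q. complex_of_real (f q)) u = Complex (fd phi (chart_map tc u) e) 0" for e
    using partial_along_chart[OF u, of "\<lambda>q. complex_of_real (f q)" phi "\<lambda>z. 0" e] phi_differentiable[OF W_D(4)[OF u]]
    by (simp add: phi_def complex_of_real_def)
  then show ?thesis
    unfolding partial_z_def by (simp add: complex_eq_iff)
qed

text \<open>The inner operator yields a complex function, whose real and imaginary parts are
  differentiated separately; the factor 1/4 is the product of the two halves in
  \<open>partial_z\<close>.\<close>

lemma partial_z_partial_z_f:
  assumes u: "u \<in> W"
  shows "partial_z A c i (partial_z A c j (\<lambda>q. complex_of_real (f q))) u =
    Complex ((D2 (chart_map tc u) (axis i 1, 0) (axis j 1, 0) - D2 (chart_map tc u) (0, axis i 1) (0, axis j 1)) / 4)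
      (- (D2 (chart_map tc u) (axis i 1, 0) (0, axis j 1) + D2 (chart_map tc u) (0, axis i 1) (axis j 1, 0)) / 4)"
proof -
  let ?z = "chart_map tc u"
  have d: "(\<lambda>z. fd phi z e) differentiable at ?z" for e by (rule dphi_differentiable[OF W_D(4)[OF u]])
  have pa: "partial_along tc m (partial_z A c j (\<lambda>q. complex_of_real (f q))) u =
    Complex (D2 ?z m (axis j 1, 0) / 2) (- D2 ?z m (0, axis j 1) / 2)" for m
  proof -
    have "partial_along tc m (partial_z A c j (\<lambda>q. complex_of_real (f q))) u =
      Complex (fd (\<lambda>z. (1/2) * fd phi z (axis j 1, 0)) ?z m) (fd (\<lambda>z. (-1/2) * fd phi z (0, axis j 1)) ?z m)"
    proof (rule partial_along_chart[OF u])
      show "partial_z A c j (\<lambda>q. complex_of_real (f q)) (chart_inv tc z) =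
        Complex ((1/2) * fd phi z (axis j 1, 0)) ((-1/2) * fd phi z (0, axis j 1))" if "z \<in> S" for z
        using partial_z_f[OF S_D(1)[OF that], of j] S_D(2)[OF that] by (simp del: tangent_chart_map)
    qed (intro differentiable_mult differentiable_const d)+
    then show ?thesis
      using fd_linear_comp[OF bounded_linear_mult_right[of "1/2"] d[of "(axis j 1, 0)"], of m]
        fd_linear_comp[OF bounded_linear_mult_right[of "-1/2"] d[of "(0, axis j 1)"], of m]
      by (simp add: D2_def del: tangent_chart_map)
  qed
  show ?thesis
    unfolding partial_z_def[of A c i] pa by (simp add: complex_eq_iff field_simps del: tangent_chart_map)
qed

text \<open>Linearity turns the sum over \<open>b\<close> into \<open>fd phi\<close> at the vector
  of symbols. The relations defining the Hamiltonian field rewrite this through \<open>G\<close>,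
  and \<open>Levi_Civita_affine_chart\<close> makes it half of \<open>DG\<close>; the factor 1/4
  combines this half with the one in \<open>partial_z\<close>.\<close>

lemma rhs_chart:
  assumes u: "u \<in> W"
  shows "(\<Sum>b\<in>UNIV. complex_of_real (christoffel A (levi_civita A h) c i j b (fst u)) *
      partial_z A c b (\<lambda>q. complex_of_real (f q)) u) =
    Complex (- DG c (fst u) (ham_fibre (chart_map tc u)) (axis i 1) (axis j 1) / 4)
      (- DG c (fst u) (ham_base (chart_map tc u)) (axis i 1) (axis j 1) / 4)"
proof -
  let ?z = "chart_map tc u"
  note u' = W_D[OF u]
  define \<Gamma> where "\<Gamma> = Christoffel A (levi_civita A h) c (fst u) (axis i 1) (axis j 1)"
  have chr: "christoffel A (levi_civita A h) c i j b (fst u) = \<Gamma> $ b" for b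
    by (simp add: \<Gamma>_def christoffel_def Christoffel_def)
  have expand: "(\<Sum>b\<in>UNIV. \<Gamma> $ b * L (axis b 1)) = L \<Gamma>" if "linear L" for L :: "real^'n \<Rightarrow> real"
  proof -
    have "L (\<Sum>b\<in>UNIV. \<Gamma> $ b *\<^sub>R axis b 1) = (\<Sum>b\<in>UNIV. \<Gamma> $ b * L (axis b 1))"
      by (simp add: linear_sum[OF that] linear_scale[OF that])
    then show ?thesis using basis_expansion[of \<Gamma>] by (simp add: scalar_mult_eq_scaleR)
  qed
  note lphi = linear_frechet_derivative[OF phi_differentiable[OF u'(4)]]
  have "linear (\<lambda>e. fd phi ?z (e, 0))"
    by (rule linear_base_comp[OF lphi])
  note e1 = expand[OF this]
  have "linear (\<lambda>e. fd phi ?z (0, e))"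
    by (rule linear_fibre_comp[OF lphi])
  note e2 = expand[OF this]
  have LC: "2 * G c (fst u) \<Gamma> e = DG c (fst u) e (axis i 1) (axis j 1)" for e
    unfolding \<Gamma>_def by (rule Levi_Civita_affine_chart[OF u'(2) flat[OF u'(7)]])
  have "fd phi ?z (\<Gamma>, 0) = - G c (fst u) (ham_fibre ?z) \<Gamma>" "fd phi ?z (0, \<Gamma>) = G c (fst u) (ham_base ?z) \<Gamma>"
    using ham_fibre(1)[OF u'(4), of \<Gamma>] ham_base(1)[OF u'(4), of \<Gamma>] unfolding u'(6) by simp_all
  then have val: "2 * fd phi ?z (\<Gamma>, 0) = - DG c (fst u) (ham_fibre ?z) (axis i 1) (axis j 1)"
    "2 * fd phi ?z (0, \<Gamma>) = DG c (fst u) (ham_base ?z) (axis i 1) (axis j 1)"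
    using LC[of "ham_fibre ?z"] LC[of "ham_base ?z"] G_sym[OF u'(2), of _ \<Gamma>] by simp_all
  have "(\<Sum>b\<in>UNIV. complex_of_real (\<Gamma> $ b) * partial_z A c b (\<lambda>q. complex_of_real (f q)) u) =
    Complex (fd phi ?z (\<Gamma>, 0) / 2) (- fd phi ?z (0, \<Gamma>) / 2)"
    unfolding e1[symmetric] e2[symmetric] partial_z_f[OF u]
    by (simp add: complex_eq_iff sum_divide_distrib sum_negf del: tangent_chart_map)
  then show ?thesis
    using val by (simp add: chr complex_eq_iff del: tangent_chart_map)
qed

text \<open>At the axis vectors of \<open>i\<close> and \<open>j\<close>, the left side minus the
  right side is -(Q + i P)/4, once the mixed second derivatives are exchanged by symmetry; it
  vanishes exactly when both real quantities do.\<close>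

theorem kaehler_iff_partial_z:
  "kaehler_function_on TA g \<omega> W f \<longleftrightarrow>
    (\<forall>i j. \<forall>u\<in>W. partial_z A c i (partial_z A c j (\<lambda>q. complex_of_real (f q))) u =
      (\<Sum>b\<in>UNIV. complex_of_real (christoffel A (levi_civita A h) c i j b (fst u)) *
        partial_z A c b (\<lambda>q. complex_of_real (f q)) u))"
proof -
  have "partial_z A c i (partial_z A c j (\<lambda>q. complex_of_real (f q))) u =
      (\<Sum>b\<in>UNIV. complex_of_real (christoffel A (levi_civita A h) c i j b (fst u)) *
        partial_z A c b (\<lambda>q. complex_of_real (f q)) u) \<longleftrightarrow>
    P u (axis i 1) (axis j 1) = 0 \<and> Q u (axis i 1) (axis j 1) = 0" if u: "u \<in> W" for i j u
    unfolding partial_z_partial_z_f[OF u] rhs_chart[OF u] P_def Q_def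
    using D2_sym[OF W_D(4)[OF u], of "(0, axis i 1)" "(axis j 1, 0)"]
    by (auto simp del: tangent_chart_map)
  then show ?thesis
    unfolding kaehler_iff using basis_iff by blast
qed

end

theorem proposition2p26:
  fixes A :: "('a, real^'n::finite) chart set"
    and h :: "('a, real^'n) bilin_field"
    and nabla nabla_dual :: "('a, real^'n) covariant"
    and f :: "'a \<times> ('a, real^'n) tvec \<Rightarrow> real"
    and U :: "'a set"
    and x :: "'a \<Rightarrow> real^'n"
  assumes "smooth_manifold A"
    and "dually_flat A h nabla nabla_dual"
    and "smooth_fun_on (tangent_atlas A) (tangent_bundle A) f"
    and "(U, x) \<in> A"
    and "affine_coordinates A nabla (U, x)"
  shows "kaehler_function_on (tangent_atlas A)
           (dombrowski_metric A h nabla) (dombrowski_form A h nabla) (bundle_restrict A U) f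
    \<longleftrightarrow> (\<forall>i j. \<forall>u\<in>bundle_restrict A U.
           partial_z A (U, x) i (partial_z A (U, x) j (\<lambda>q. complex_of_real (f q))) u =
           (\<Sum>b\<in>UNIV.
              complex_of_real (christoffel A (levi_civita A h) (U, x) i j b (fst u)) *
              partial_z A (U, x) b (\<lambda>q. complex_of_real (f q)) u))"
proof -
  interpret dually_flat_manifold A h nabla nabla_dual
    using assms(1,2) by unfold_locales (simp_all add: smooth_manifold_def dually_flat_def)
  \<comment> \<open>\<open>affine_coordinates\<close> speaks of axis vectors; bilinearity of the
    symbols extends the vanishing to all coordinate vectors.\<close>
  have "Christoffel A nabla (U, x) p a b = 0" if "p \<in> U" for p a b
  proof -
    have c: "(U, x) \<in> charts_at A p" using assms(4) that by (simp add: charts_at_iff)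
    have "Christoffel A nabla (U, x) p i j = 0" if ij: "i \<in> Basis" "j \<in> Basis" for i j
    proof -
      obtain k l where kl: "i = axis k 1" "j = axis l 1" using ij by (auto simp: Basis_vec_def)
      have "christoffel A nabla (U, x) k l b p = 0" for b
        using assms(5) \<open>p \<in> U\<close> by (simp add: affine_coordinates_def)
      then show ?thesis
        unfolding kl by (simp add: christoffel_def Christoffel_def vec_eq_iff)
    qed
    then show ?thesis
      using nabla.Gam_expansion_left[OF c, of a b] nabla.Gam_expansion_right[OF c, of _ b] by simp
  qed
  then interpret affine_chart A h nabla nabla_dual "(U, x)" f
    using assms(3,4) by unfold_locales simp_all
  show ?thesis
    using kaehler_iff_partial_z by simp
qed

end
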